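(* There exist constants $c, c'>0$ such that the following holds in the preferential attachment model. (a) For every $\epsilon\in(0,1)$ and every positive integer $K$, if there exists a root-finding procedure with output size $K$ and accuracy $\epsilon$, then $$K \geq \frac{c}{\epsilon}.$$ (b) There exists an algorithm, running in polynomial time, which for every $\epsilon\in(0,1)$ implements a root-finding procedure of accuracy $\epsilon$ with some output size $K(\epsilon)$ (not depending on the number $n$ of vertices of the input tree) satisfying $$K(\epsilon) \leq c' \frac{\log^2(1/\epsilon)}{\epsilon^4}.$$
   Context: Write $[n]=\{1,\dots,n\}$. The preferential attachment tree $\mathrm{PA}(n)$, $n\ge 2$, is the random labeled tree on vertex set $[n]$ defined inductively: $\mathrm{PA}(2)$ is the unique tree on two vertices, and $\mathrm{PA}(n+1)$ is obtained from $\mathrm{PA}(n)$ by adding the vertex $n+1$ and an edge $\{i,n+1\}$, where $i\in[n]$ is chosen at random with probability proportional to its degree in $\mathrm{PA}(n)$. Vertex $1$ is called the root. For a labeled tree $T$, $T^\circ$ denotes its isomorphism class, i.e. the unlabeled copy of $T$. A root-finding procedure with output size $K$ and accuracy $\epsilon$ (in the preferential attachment model) is a mapping $H$ which, given an unlabeled tree with at least $K$ vertices, outputs a set of $K$ of its vertices, such that $$\liminf_{n\to\infty} \mathbb{P}\left(1\in H(\mathrm{PA}(n)^\circ)\right)\ge 1-\epsilon .$$ The integer $K$ may depend on $\epsilon$ but not on $n$. Here the vertices of the unlabeled tree are identified with those of the labeled tree through an isomorphism that carries no information on the original labels. Concretely: $H$ may be viewed as a function from labeled trees on $[n]$ to $K$-subsets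 of $[n]$, and the event $1\in H(\mathrm{PA}(n)^\circ)$ means $\sigma(1)\in H(\sigma(\mathrm{PA}(n)))$, where $\sigma$ is a uniformly random permutation of $[n]$ independent of the tree and $\sigma(T)$ is $T$ with its vertices relabeled by $\sigma$.
   Formalization: In (b) the bound is K(ε) ≤ max(1, c' log²(1/ε)/ε⁴): as printed, it would force K(ε)=0 for ε close to 1, which is impossible for a root-finding procedure. The algorithm receives the tree and the output size K(ε). *)

theory Defs
  imports
    "HOL-Probability.Probability"
    "HOL-Combinatorics.Permutations"
    "HOL-Computational_Algebra.Polynomial"
begin

text \<open>
  A graph on the vertex set \<open>{1..n}\<close> is represented by its set of edges, an edge being a
  two-element set of vertices.
\<close>

definition simple_graph :: "nat \<Rightarrow> nat set set \<Rightarrow> bool" where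
  "simple_graph n T \<longleftrightarrow> (\<forall>e\<in>T. e \<subseteq> {1..n} \<and> card e = 2)"

definition connected_graph :: "nat \<Rightarrow> nat set set \<Rightarrow> bool" where
  "connected_graph n T \<longleftrightarrow> (\<forall>u\<in>{1..n}. \<forall>v\<in>{1..n}. (u, v) \<in> {(x, y). {x, y} \<in> T}\<^sup>*)"

definition is_cycle :: "nat set set \<Rightarrow> nat list \<Rightarrow> bool" where
  "is_cycle T p \<longleftrightarrow> 3 \<le> length p \<and> distinct p \<and>
     successively (\<lambda>x y. {x, y} \<in> T) p \<and> {last p, hd p} \<in> T"

definition labeled_tree :: "nat \<Rightarrow> nat set set \<Rightarrow> bool" where
  "labeled_tree n T \<longleftrightarrow>
     1 \<le> n \<and> simple_graph n T \<and> connected_graph n T \<and> (\<nexists>p. is_cycle T p)"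

definition vertex_degree :: "nat set set \<Rightarrow> nat \<Rightarrow> nat" where
  "vertex_degree T i = card {e \<in> T. i \<in> e}"

definition attach :: "nat \<Rightarrow> nat set set \<Rightarrow> nat pmf" where
  "attach n T = embed_pmf (\<lambda>i. if i \<in> {1..n}
     then real (vertex_degree T i) / (\<Sum>j\<in>{1..n}. real (vertex_degree T j)) else 0)"

text \<open>
  \<open>embed_pmf\<close> is meaningful only for genuine probability mass functions; the next lemma shows
  that this is the case here as soon as the graph has an edge.
\<close>

lemma pmf_attach:
  assumes "(\<Sum>j\<in>{1..n}. real (vertex_degree T j)) > 0"
  shows "pmf (attach n T) i = (if i \<in> {1..n}
     then real (vertex_degree T i) / (\<Sum>j\<in>{1..n}. real (vertex_degree T j)) else 0)"
proof -
  define S where "S = (\<Sum>j\<in>{1..n}. real (vertex_degree T j))"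
  define f where "f = (\<lambda>i. if i \<in> {1..n} then real (vertex_degree T i) / S else 0)"
  have S: "S > 0" using assms by (simp add: S_def)
  have nonneg: "0 \<le> f x" for x using S by (simp add: f_def)
  have "(\<integral>\<^sup>+x. ennreal (f x) \<partial>count_space UNIV) = (\<Sum>x\<in>{1..n}. ennreal (f x))"
    by (rule nn_integral_count_space'[of "{1..n}"]) (auto simp: f_def)
  also have "\<dots> = ennreal (\<Sum>x\<in>{1..n}. f x)"
    using nonneg by (simp add: sum_ennreal)
  also have "(\<Sum>x\<in>{1..n}. f x) = (\<Sum>x\<in>{1..n}. real (vertex_degree T x)) / S"
    by (simp add: f_def sum_divide_distrib)
  also have "\<dots> = 1" using S by (simp add: S_def)
  finally have "(\<integral>\<^sup>+x. ennreal (f x) \<partial>count_space UNIV) = 1" by simp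
  from pmf_embed_pmf[OF nonneg this, of i] show ?thesis
    unfolding attach_def f_def S_def .
qed

text \<open>
  The preferential attachment tree; only the values at arguments \<open>n \<ge> 2\<close> are meaningful.
\<close>

primrec PA :: "nat \<Rightarrow> nat set set pmf" where
  "PA 0 = return_pmf {{1, 2}}"
| "PA (Suc n) = (if n < 2 then return_pmf {{1, 2}}
     else bind_pmf (PA n) (\<lambda>T. map_pmf (\<lambda>i. insert {i, Suc n} T) (attach n T)))"

definition relabel :: "(nat \<Rightarrow> nat) \<Rightarrow> nat set set \<Rightarrow> nat set set" where
  "relabel \<sigma> T = (\<lambda>e. \<sigma> ` e) ` T"

text \<open>
  A procedure acts on an unlabeled tree through a uniformly random labeling of it, independent of
  the tree. So it is an arbitrary function of the number \<open>n\<close> of vertices and of a labeled tree on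
  \<open>{1..n}\<close>, and the probability that it finds the root is taken over both sources of randomness.
\<close>

definition root_found_prob :: "(nat \<Rightarrow> nat set set \<Rightarrow> nat set) \<Rightarrow> nat \<Rightarrow> real" where
  "root_found_prob H n =
     measure_pmf.prob (pair_pmf (PA n) (pmf_of_set {\<sigma>. \<sigma> permutes {1..n}}))
       {(T, \<sigma>). \<sigma> 1 \<in> H n (relabel \<sigma> T)}"

definition root_finding_procedure ::
    "(nat \<Rightarrow> nat set set \<Rightarrow> nat set) \<Rightarrow> nat \<Rightarrow> real \<Rightarrow> bool" where
  "root_finding_procedure H K \<epsilon> \<longleftrightarrow>
     (\<forall>n T. labeled_tree n T \<and> K \<le> n \<longrightarrow> H n T \<subseteq> {1..n} \<and> card (H n T) = K) \<and>
     ereal (1 - \<epsilon>) \<le> liminf (\<lambda>n. ereal (root_found_prob H n))"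

text \<open>
  The model of computation is a random access machine with structured control flow: a program works
  on finitely many variables and one-dimensional arrays, all of whose entries are natural numbers,
  and each elementary command and each test costs one unit of time. The only arithmetic operations
  are addition and truncated subtraction. Hence in a fixed program one step lengthens the binary
  representation of the numbers in memory by at most a constant, and running times agree with Turing
  machine time up to a polynomial (this would fail for unit-cost multiplication).
\<close>

datatype expr =
    Const nat
  | Var nat
  | Read nat expr
  | Plus expr expr
  | Minus expr expr

datatype prog =
    Skip
  | Assign nat expr
  | Write nat expr expr
  | Seq prog prog
  | IfLess expr expr prog prog
  | WhileLess expr expr prog

type_synonym state = "(nat \<Rightarrow> nat) \<times> (nat \<Rightarrow> nat \<Rightarrow> nat)"

primrec eval_expr :: "expr \<Rightarrow> state \<Rightarrow> nat" where
  "eval_expr (Const k) s = k"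
| "eval_expr (Var x) s = fst s x"
| "eval_expr (Read a e) s = snd s a (eval_expr e s)"
| "eval_expr (Plus e f) s = eval_expr e s + eval_expr f s"
| "eval_expr (Minus e f) s = eval_expr e s - eval_expr f s"

text \<open>
  \<open>exec P s t s'\<close>: started in the state \<open>s\<close>, the program \<open>P\<close> halts after exactly \<open>t\<close> steps, in the
  state \<open>s'\<close>.
\<close>

inductive exec :: "prog \<Rightarrow> state \<Rightarrow> nat \<Rightarrow> state \<Rightarrow> bool" where
  Skip: "exec Skip s 1 s"
| Assign: "exec (Assign x e) s 1 ((fst s)(x := eval_expr e s), snd s)"
| Write: "exec (Write a e f) s 1
    (fst s, (snd s)(a := (snd s a)(eval_expr e s := eval_expr f s)))"
| Seq: "exec P s t s' \<Longrightarrow> exec Q s' u s'' \<Longrightarrow> exec (Seq P Q) s (t + u) s''"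
| IfTrue: "eval_expr e s < eval_expr f s \<Longrightarrow> exec P s t s' \<Longrightarrow>
    exec (IfLess e f P Q) s (Suc t) s'"
| IfFalse: "\<not> eval_expr e s < eval_expr f s \<Longrightarrow> exec Q s t s' \<Longrightarrow>
    exec (IfLess e f P Q) s (Suc t) s'"
| WhileTrue: "eval_expr e s < eval_expr f s \<Longrightarrow> exec P s t s' \<Longrightarrow>
    exec (WhileLess e f P) s' u s'' \<Longrightarrow> exec (WhileLess e f P) s (Suc (t + u)) s''"
| WhileFalse: "\<not> eval_expr e s < eval_expr f s \<Longrightarrow> exec (WhileLess e f P) s 1 s"

inductive_cases exec_elims:
  "exec Skip s t s'"
  "exec (Assign x e) s t s'"
  "exec (Write a e f) s t s'"
  "exec (Seq P Q) s t s'"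
  "exec (IfLess e f P Q) s t s'"
  "exec (WhileLess e f P) s t s'"

lemma exec_deterministic:
  "exec P s t s' \<Longrightarrow> exec P s u s'' \<Longrightarrow> u = t \<and> s'' = s'"
proof (induction arbitrary: u s'' rule: exec.induct)
  case (Seq P s t s' Q v r)
  from Seq.prems show ?case by (rule exec_elims(4)) (metis Seq.IH)
next
  case (IfTrue e s f P t s' Q)
  from IfTrue.prems show ?case by (rule exec_elims(5)) (metis IfTrue.IH IfTrue.hyps(1))+
next
  case (IfFalse e s f Q t s' P)
  from IfFalse.prems show ?case by (rule exec_elims(5)) (metis IfFalse.IH IfFalse.hyps(1))+
next
  case (WhileTrue e s f P t s' v r)
  from WhileTrue.prems show ?case by (rule exec_elims(6)) (metis WhileTrue.IH WhileTrue.hyps(1))+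
next
  case (WhileFalse e s f P)
  from WhileFalse.prems show ?case by (rule exec_elims(6)) (use WhileFalse.hyps in simp_all)
qed (erule exec_elims; simp)+

text \<open>
  Input: the number of vertices in variable 0, the requested output size in variable 1, and the
  adjacency matrix of the tree in array 0, the entry for the vertices \<open>i, j \<in> {1..n}\<close> being stored
  at the index \<open>i * n + j\<close>. All other variables and array entries are 0.
  Output: the set of vertices with a nonzero entry in array 1.
\<close>

definition input_state :: "nat \<Rightarrow> nat \<Rightarrow> nat set set \<Rightarrow> state" where
  "input_state n K T =
     ((\<lambda>_. 0)(0 := n, 1 := K),
      \<lambda>a k. if a = 0 \<and> (\<exists>i\<in>{1..n}. \<exists>j\<in>{1..n}. k = i * n + j \<and> {i, j} \<in> T) then 1 else 0)"

definition output_set :: "nat \<Rightarrow> state \<Rightarrow> nat set" where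
  "output_set n s = {v \<in> {1..n}. snd s 1 v \<noteq> 0}"

text \<open>
  The input has size at least \<open>n\<close> and at most polynomial in \<open>n\<close>, so polynomial time means time
  polynomial in \<open>n\<close>. The polynomial depends neither on the tree nor on the output size \<open>K\<close>.
\<close>

definition computes_in_poly_time ::
    "prog \<Rightarrow> (nat \<Rightarrow> nat \<Rightarrow> nat set set \<Rightarrow> nat set) \<Rightarrow> bool" where
  "computes_in_poly_time P F \<longleftrightarrow>
     (\<exists>p :: nat poly. \<forall>n K T. labeled_tree n T \<and> K \<le> n \<longrightarrow>
        (\<exists>t s. exec P (input_state n K T) t s \<and> t \<le> poly p n \<and> output_set n s = F K n T))"

end

theory Submission
  imports Defs
begin

text \<open>
  Lower bound. At a time of order \<open>K\<^sup>2\<close> it happens with probability at least of order \<open>1 / K\<close> that the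
  root is still a leaf while vertex 2 has at least \<open>2 * K\<close> leaf neighbours, the root among them
  (\<open>prob_hidden_root\<close>, a second moment argument). Exchanging the root with another of these leaves is
  an automorphism of the present tree, and attachment commutes with it, so given this event all the
  leaves are equally likely to be output by a procedure that sees no labels. As it outputs only
  \<open>K\<close> vertices, it then misses the root with probability at least \<open>1/2\<close>
  (\<open>card_orbit_times_found_prob_le\<close>). Hence \<open>\<epsilon>\<close> is at least of order \<open>1 / K\<close>.

  Upper bound. The algorithm gives every vertex \<open>v\<close> a score that is essentially the number of ordered
  pairs of vertices connected in the tree without \<open>v\<close>, and outputs the \<open>K\<close> vertices of smallest score.
  A score near \<open>n\<^sup>2\<close> means that \<open>v\<close> leaves almost the whole tree connected, so the score measures how
  central a vertex is. Two facts show that the root is central and late vertices are not.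

  First, when the edge between 1 and 2 is removed, the sizes of the two sides follow an urn scheme
  with limit the arcsine law; so both sides contain at least \<open>3 * y * n\<close> vertices up to probability
  \<open>O(sqrt y)\<close> (\<open>prob_unbalanced_halves\<close>), and then the score of the root is at most about
  \<open>(1 - 3 * y) * n\<^sup>2\<close>. Secondly, let \<open>m\<close> be a fixed time and let the \<open>k\<close>-th group consist of the
  vertices whose last ancestor among \<open>1, \<dots>, m\<close> is \<open>k\<close>. If every group has fewer than \<open>y * n\<close>
  vertices, each vertex later than \<open>m\<close> separates at most one group from the rest and has score
  greater than \<open>(1 - y)\<^sup>2 * n\<^sup>2\<close>, which exceeds the score of the root
  (\<open>root_wins_if_balanced\<close>). The size of the group of \<open>k\<close> is controlled by the degree of \<open>k\<close> at time \<open>m\<close>, of order \<open>sqrt (m / k)\<close>, and by an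
  urn after that time. Moments of order \<open>2 * q\<close> bound the probability that it reaches \<open>y * n\<close> by
  \<open>(16 * q\<^sup>2 / (y\<^sup>2 * m * k))\<close> to the power \<open>q\<close>, up to shifts of \<open>m\<close> and \<open>k\<close> by one
  (\<open>prob_large_branch\<close>). With \<open>y\<close> of order \<open>\<epsilon>\<^sup>2\<close>, \<open>q\<close> of order \<open>log (1 / \<epsilon>)\<close> and \<open>m\<close> of order
  \<open>q\<^sup>2 / y\<^sup>2\<close> the sum over \<open>k\<close> is at most \<open>\<epsilon> / 2\<close>, and \<open>m\<close> is the output size.

  For \<open>\<epsilon>\<close> close to 1 the bound only allows the output size 1. There it suffices that
  the root has the smallest score with a probability bounded away from 0, and this is so because it
  holds given that the tree starts as a large spider centred at the root (\<open>prob_root_wins_alone\<close>).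
  All probabilistic estimates come from recursions for conditional expectations at finite \<open>n\<close>
  (\<open>expectation_growth\<close>).
\<close>

section \<open>The score of a vertex\<close>

definition avoid :: "nat set set \<Rightarrow> nat \<Rightarrow> (nat \<times> nat) set" where
  "avoid T v = {(x, y). {x, y} \<in> T \<and> y \<noteq> v}"

text \<open>
  The start \<open>u\<close> may be \<open>v\<close> itself, which contributes the whole tree: only the arrival in \<open>v\<close> is
  forbidden. This adds \<open>n\<close> to all scores of a tree and saves the program a case distinction.
\<close>

definition score :: "nat \<Rightarrow> nat set set \<Rightarrow> nat \<Rightarrow> nat" where
  "score n T v = (\<Sum>u\<in>{1..n}. card ((avoid T v)\<^sup>* `` {u}))"

lemma rtrancl_Image_least:
  assumes "u \<in> M" "E `` M \<subseteq> M"
  shows "E\<^sup>* `` {u} \<subseteq> M"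
proof
  fix y assume "y \<in> E\<^sup>* `` {u}"
  then have "(u, y) \<in> E\<^sup>*" by simp
  then show "y \<in> M" by induction (use assms in auto)
qed

section \<open>Recursive trees\<close>

abbreviation expect :: "'a pmf \<Rightarrow> ('a \<Rightarrow> real) \<Rightarrow> real" where
  "expect p f \<equiv> measure_pmf.expectation p f"

text \<open>
  These are the possible values of \<open>PA n\<close>, so that deterministic facts about the random tree can be
  proved by induction on the attached leaves.
\<close>

inductive rtree :: "nat \<Rightarrow> nat set set \<Rightarrow> bool" where
  edge: "rtree 2 {{1, 2}}"
| leaf: "rtree n T \<Longrightarrow> i \<in> {1..n} \<Longrightarrow> rtree (Suc n) (insert {i, Suc n} T)"

lemma rtree_ge_2: "rtree n T \<Longrightarrow> 2 \<le> n"
  by (induction rule: rtree.induct) auto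

lemma rtree_edge: "rtree n T \<Longrightarrow> e \<in> T \<Longrightarrow> e \<subseteq> {1..n} \<and> card e = 2"
proof (induction rule: rtree.induct)
  case (leaf n T i)
  then have "card {i, Suc n} = 2" by simp
  moreover have "{1..n} \<subseteq> {1..Suc n}" by auto
  moreover have "e \<subseteq> {1..n} \<and> card e = 2" if "e \<noteq> {i, Suc n}" using leaf that by blast
  ultimately show ?case using leaf(2) by (cases "e = {i, Suc n}") (simp, blast)
qed auto

lemma rtree_subset: "rtree n T \<Longrightarrow> T \<subseteq> Pow {1..n}"
  using rtree_edge by blast

lemma rtree_finite: "rtree n T \<Longrightarrow> finite T"
  by (induction rule: rtree.induct) auto

lemma finite_rtrees: "finite {T. rtree n T}"
  by (rule finite_subset[of _ "Pow (Pow {1..n})"]) (use rtree_subset in auto)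

lemma rtree_new_vertex: "rtree n T \<Longrightarrow> e \<in> T \<Longrightarrow> x \<in> e \<Longrightarrow> x \<noteq> Suc n"
  using rtree_edge by fastforce

lemma rtree_no_loop: "rtree n T \<Longrightarrow> {x} \<notin> T"
  using rtree_edge by fastforce

lemma vertex_degree_insert:
  assumes "rtree n T" "i \<in> {1..n}"
  shows "vertex_degree (insert {i, Suc n} T) v =
     (if v = Suc n then 1 else vertex_degree T v + (if v = i then 1 else 0))"
proof -
  have new: "{i, Suc n} \<notin> {e \<in> T. v \<in> e}" using rtree_new_vertex[OF assms(1)] by blast
  have fin: "finite {e \<in> T. v \<in> e}" using rtree_finite[OF assms(1)] by simp
  have eq: "{e \<in> insert {i, Suc n} T. v \<in> e} =
      (if v = i \<or> v = Suc n then insert {i, Suc n} {e \<in> T. v \<in> e} else {e \<in> T. v \<in> e})" by auto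
  have "{e \<in> T. v \<in> e} = {}" if "v = Suc n" using that rtree_new_vertex[OF assms(1)] by blast
  then show ?thesis
    unfolding vertex_degree_def eq using new fin assms(2)
    by (auto simp: card_insert_disjoint)
qed

lemma sum_delta_add:
  fixes i :: nat
  assumes "finite A"
  shows "(\<Sum>v\<in>A. f v + (if v = i then c else 0)) = sum f A + (if i \<in> A then c else (0::nat))"
  using assms by (simp add: sum.distrib)

lemma vertex_degree_edge:
  "vertex_degree {{Suc 0, 2}} v = (if v = Suc 0 \<or> v = 2 then 1 else 0)"
proof -
  have "{e \<in> {{Suc 0, 2::nat}}. v \<in> e} = (if v = Suc 0 \<or> v = 2 then {{Suc 0, 2}} else {})" by auto
  then show ?thesis by (simp add: vertex_degree_def)
qed

lemma sum_vertex_degree: "rtree n T \<Longrightarrow> (\<Sum>v\<in>{1..n}. vertex_degree T v) = 2 * (n - 1)"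
proof (induction rule: rtree.induct)
  case edge
  have "{1..2::nat} = {Suc 0, 2}" by auto
  then show ?case by (simp add: vertex_degree_edge)
next
  case (leaf n T i)
  have "(\<Sum>v\<in>{1..n}. vertex_degree (insert {i, Suc n} T) v) =
      (\<Sum>v\<in>{1..n}. vertex_degree T v + (if v = i then 1 else 0))"
    by (rule sum.cong) (use leaf in \<open>auto simp: vertex_degree_insert\<close>)
  also have "\<dots> = 2 * (n - 1) + 1" using leaf by (simp add: sum_delta_add)
  finally show ?case using leaf rtree_ge_2[OF leaf(1)] by (simp add: vertex_degree_insert)
qed

lemma sum_vertex_degree_real:
  "rtree n T \<Longrightarrow> (\<Sum>v\<in>{1..n}. real (vertex_degree T v)) = 2 * (real n - 1)"
  using sum_vertex_degree[of n T] rtree_ge_2[of n T]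
  by (simp flip: of_nat_sum add: of_nat_diff)

lemma vertex_degree_pos: "rtree n T \<Longrightarrow> v \<in> {1..n} \<Longrightarrow> 1 \<le> vertex_degree T v"
  by (induction arbitrary: v rule: rtree.induct)
     (auto simp: vertex_degree_edge vertex_degree_insert le_Suc_eq)

lemma vertex_degree_last: "rtree n T \<Longrightarrow> vertex_degree T n = 1"
  by (induction rule: rtree.induct) (auto simp: vertex_degree_edge vertex_degree_insert)

lemma pmf_attach_rtree:
  "rtree n T \<Longrightarrow> pmf (attach n T) i =
     (if i \<in> {1..n} then real (vertex_degree T i) / (2 * (real n - 1)) else 0)"
  using pmf_attach[where n = n and T = T and i = i] sum_vertex_degree_real[of n T] rtree_ge_2[of n T] by auto

lemma set_pmf_attach: "rtree n T \<Longrightarrow> set_pmf (attach n T) = {1..n}"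
  using rtree_ge_2[of n T] vertex_degree_pos[of n T]
  by (auto simp: set_pmf_eq pmf_attach_rtree split: if_splits) fastforce

text \<open>
  The transition kernel of the Markov chain \<open>PA\<close>.
\<close>

definition attach_leaf :: "nat \<Rightarrow> nat set set \<Rightarrow> nat set set pmf" where
  "attach_leaf n T = map_pmf (\<lambda>i. insert {i, Suc n} T) (attach n T)"

lemma PA_Suc: "2 \<le> n \<Longrightarrow> PA (Suc n) = PA n \<bind> attach_leaf n"
  by (simp add: attach_leaf_def[abs_def])

lemma PA_2: "PA 2 = return_pmf {{1, 2}}"
  by (simp add: numeral_2_eq_2)

lemma rtree_2: "rtree 2 T \<longleftrightarrow> T = {{1, 2}}"
proof
  assume "rtree 2 T"
  then show "T = {{1, 2}}"
    by cases (use rtree_ge_2 in fastforce)+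
qed (use rtree.edge in simp)

lemma set_pmf_PA: "2 \<le> n \<Longrightarrow> set_pmf (PA n) = {T. rtree n T}"
proof (induction n rule: dec_induct)
  case base
  show ?case unfolding PA_2 rtree_2 by simp
next
  case (step n)
  have "rtree (Suc n) T \<longleftrightarrow> (\<exists>T'\<in>{T. rtree n T}. T \<in> (\<lambda>i. insert {i, Suc n} T') ` {1..n})" for T
  proof
    assume "rtree (Suc n) T"
    then show "\<exists>T'\<in>{T. rtree n T}. T \<in> (\<lambda>i. insert {i, Suc n} T') ` {1..n}"
    proof cases
      case (leaf T' i)
      then show ?thesis by (intro bexI[of _ T'] image_eqI[of _ _ i]) simp_all
    qed (use step(1) in simp)
  qed (auto intro: rtree.leaf)
  then have "{T. rtree (Suc n) T} = (\<Union>T'\<in>{T. rtree n T}. (\<lambda>i. insert {i, Suc n} T') ` {1..n})"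
    by (intro set_eqI) (simp only: mem_Collect_eq UN_iff)
  also have "\<dots> = set_pmf (PA (Suc n))"
    using step by (simp add: PA_Suc attach_leaf_def set_bind_pmf set_pmf_attach)
  finally show ?case ..
qed

lemma finite_set_pmf_PA: "2 \<le> n \<Longrightarrow> finite (set_pmf (PA n))"
  by (simp add: set_pmf_PA finite_rtrees)

lemma integrable_PA: "2 \<le> n \<Longrightarrow> integrable (measure_pmf (PA n)) (f :: _ \<Rightarrow> real)"
  by (rule integrable_measure_pmf_finite) (rule finite_set_pmf_PA)

lemma expectation_PA_mono:
  fixes f g :: "nat set set \<Rightarrow> real"
  assumes "2 \<le> n" "\<And>T. rtree n T \<Longrightarrow> f T \<le> g T"
  shows "expect (PA n) f \<le> expect (PA n) g"
  by (rule integral_mono_AE) (use assms in \<open>auto simp: integrable_PA AE_measure_pmf_iff set_pmf_PA\<close>)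

definition attach_prob :: "nat \<Rightarrow> nat set set \<Rightarrow> nat \<Rightarrow> real" where
  "attach_prob n T i = real (vertex_degree T i) / (2 * (real n - 1))"

lemma sum_attach_prob: "rtree n T \<Longrightarrow> (\<Sum>i\<in>{1..n}. attach_prob n T i) = 1"
  unfolding attach_prob_def sum_divide_distrib[symmetric]
  using sum_vertex_degree_real[of n T] rtree_ge_2[of n T] by simp

lemma expectation_attach_leaf:
  fixes f :: "nat set set \<Rightarrow> real"
  assumes "rtree n T"
  shows "expect (attach_leaf n T) f =
    (\<Sum>i\<in>{1..n}. attach_prob n T i * f (insert {i, Suc n} T))"
  unfolding attach_leaf_def attach_prob_def
  by (subst integral_map_pmf, subst integral_measure_pmf[of "{1..n}"])
     (use assms in \<open>auto simp: set_pmf_attach pmf_attach_rtree\<close>)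

lemma expectation_PA_Suc:
  fixes f :: "nat set set \<Rightarrow> real"
  assumes "2 \<le> n"
  shows "expect (PA (Suc n)) f =
    expect (PA n) (\<lambda>T. expect (attach_leaf n T) f)"
proof -
  have fin: "finite (set_pmf (PA n))" using assms by (rule finite_set_pmf_PA)
  have "expect (PA (Suc n)) f =
      (\<Sum>T\<in>set_pmf (PA n). pmf (PA n) T *\<^sub>R expect (attach_leaf n T) f)"
    unfolding PA_Suc[OF assms]
    by (rule pmf_expectation_bind[OF fin])
       (use assms set_pmf_attach in \<open>auto simp: attach_leaf_def set_pmf_PA\<close>)
  also have "\<dots> = expect (PA n) (\<lambda>T. expect (attach_leaf n T) f)"
    by (rule integral_measure_pmf[symmetric, OF fin]) auto
  finally show ?thesis .
qed

text \<open>
  The principle behind all moment estimates: a function that grows in conditional mean by a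
  factor of at most \<open>c j\<close> in step \<open>j\<close> grows in mean by at most the product of these factors.
  Functions of both signs are allowed, so that lower bounds follow by applying it to \<open>- f\<close>.
\<close>

lemma expectation_growth:
  fixes f :: "nat \<Rightarrow> nat set set \<Rightarrow> real"
  assumes "2 \<le> m" "m \<le> n"
    and c: "\<And>j. m \<le> j \<Longrightarrow> 0 \<le> c j"
    and step: "\<And>j T. m \<le> j \<Longrightarrow> rtree j T \<Longrightarrow>
       expect (attach_leaf j T) (f (Suc j)) \<le> c j * f j T"
  shows "expect (PA n) (f n) \<le>
     (\<Prod>j\<in>{m..<n}. c j) * expect (PA m) (f m)"
  using assms(2)
proof (induction n rule: dec_induct)
  case (step n)
  have 2: "2 \<le> n" using step assms(1) by simp
  have "expect (PA (Suc n)) (f (Suc n)) \<le>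
      expect (PA n) (\<lambda>T. c n * f n T)"
    unfolding expectation_PA_Suc[OF 2]
    by (rule expectation_PA_mono[OF 2]) (use step assms(4) in auto)
  also have "\<dots> = c n * expect (PA n) (f n)" by simp
  also have "\<dots> \<le> c n * ((\<Prod>j\<in>{m..<n}. c j) * expect (PA m) (f m))"
    by (rule mult_left_mono) (use step c in auto)
  finally show ?case using step by (simp add: prod.atLeastLessThan_Suc mult_ac)
qed simp

section \<open>Connectivity of recursive trees\<close>

lemma rtree_parent_exists:
  "rtree n T \<Longrightarrow> x \<in> {1..n} \<Longrightarrow> x \<noteq> 1 \<Longrightarrow> \<exists>y\<in>{1..n}. y < x \<and> {x, y} \<in> T"
proof (induction arbitrary: x rule: rtree.induct)
  case edge
  then have "x = 2" by auto
  then show ?case by (intro bexI[of _ 1]) (auto simp: insert_commute)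
next
  case (leaf n T i)
  show ?case
  proof (cases "x = Suc n")
    case True
    with leaf show ?thesis by (intro bexI[of _ i]) (auto simp: insert_commute)
  next
    case False
    with leaf(3)[of x] leaf(4,5) obtain y where "y \<in> {1..n}" "y < x" "{x, y} \<in> T" by auto
    then show ?thesis by (intro bexI[of _ y]) auto
  qed
qed

text \<open>
  Following parents from any vertex leads to the root; if a set contains the parents of its elements,
  these paths stay inside the set.
\<close>

lemma connected_by_parents:
  assumes "1 \<in> S" "v \<notin> S"
    and par: "\<And>x. x \<in> S \<Longrightarrow> x \<noteq> 1 \<Longrightarrow> \<exists>y\<in>S. y < x \<and> {x, y} \<in> T"
  shows "x \<in> S \<Longrightarrow> (x, 1) \<in> (avoid T v)\<^sup>* \<and> (1, x) \<in> (avoid T v)\<^sup>*"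
proof (induction x rule: less_induct)
  case (less x)
  show ?case
  proof (cases "x = 1")
    case False
    from par[OF less(2) this] obtain y where y: "y \<in> S" "y < x" "{x, y} \<in> T" by blast
    have "(x, y) \<in> avoid T v" "(y, x) \<in> avoid T v"
      using y less(2) assms(2) by (auto simp: avoid_def insert_commute)
    with less(1)[OF y(2,1)] show ?thesis
      by (meson converse_rtrancl_into_rtrancl rtrancl.rtrancl_into_rtrancl)
  qed simp
qed

lemma avoid_Image_subset: "rtree n T \<Longrightarrow> u \<in> {1..n} \<Longrightarrow> (avoid T v)\<^sup>* `` {u} \<subseteq> {1..n}"
  by (rule rtrancl_Image_least) (use rtree_edge in \<open>auto simp: avoid_def\<close>)

lemma score_ge_of_connected:
  assumes "rtree n T" "S \<subseteq> {1..n}" "1 \<in> S" "v \<notin> S"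
    and par: "\<And>x. x \<in> S \<Longrightarrow> x \<noteq> 1 \<Longrightarrow> \<exists>y\<in>S. y < x \<and> {x, y} \<in> T"
  shows "(card S)\<^sup>2 \<le> score n T v"
proof -
  have "S \<subseteq> (avoid T v)\<^sup>* `` {u}" if "u \<in> S" for u
    using connected_by_parents[OF assms(3-4) par] that by (auto intro: rtrancl_trans)
  moreover have "finite ((avoid T v)\<^sup>* `` {u})" if "u \<in> S" for u
    using avoid_Image_subset[OF assms(1)] that assms(2) by (meson finite_atLeastAtMost finite_subset subsetD)
  ultimately have "card S \<le> card ((avoid T v)\<^sup>* `` {u})" if "u \<in> S" for u
    using that by (simp add: card_mono)
  then have "(\<Sum>u\<in>S. card S) \<le> (\<Sum>u\<in>S. card ((avoid T v)\<^sup>* `` {u}))"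
    by (rule sum_mono)
  also have "\<dots> \<le> score n T v"
    unfolding score_def by (rule sum_mono2) (use assms(2) in auto)
  finally show ?thesis by (simp add: power2_eq_square)
qed

text \<open>
  On a cycle the predecessor and the successor of a vertex are different because the cycle has at
  least three vertices. In particular no leaf lies on a cycle.
\<close>

lemma is_cycle_neighbours:
  assumes "is_cycle T p" "x \<in> set p"
  shows "\<exists>y z. y \<noteq> z \<and> {x, y} \<in> T \<and> {x, z} \<in> T"
proof -
  from assms have len: "3 \<le> length p" and dist: "distinct p"
    and succ: "\<And>j. Suc j < length p \<Longrightarrow> {p ! j, p ! Suc j} \<in> T"
    and clos: "{last p, hd p} \<in> T"
    by (auto simp: is_cycle_def successively_conv_nth)
  have pos: "0 < length p" using len by linarith
  have ends: "last p = p ! (length p - 1)" "hd p = p ! 0"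
    using len by (cases p; simp add: last_conv_nth)+
  from assms(2) obtain k where k: "k < length p" "x = p ! k" by (auto simp: in_set_conv_nth)
  consider "k = 0" | "k = length p - 1" | "0 < k" "Suc k < length p" using k by linarith
  then show ?thesis
  proof cases
    case 1
    have "p ! 1 \<noteq> p ! (length p - 1)" using nth_eq_iff_index_eq[OF dist, of 1 "length p - 1"] len by auto
    moreover have "{x, p ! 1} \<in> T" using succ[of 0] 1 k len by simp
    moreover have "{x, p ! (length p - 1)} \<in> T" using clos 1 k by (simp add: ends insert_commute)
    ultimately show ?thesis by blast
  next
    case 2
    have "p ! 0 \<noteq> p ! (k - 1)" using nth_eq_iff_index_eq[OF dist pos, of "k - 1"] len 2 by simp
    moreover have "{x, p ! 0} \<in> T" using clos 2 k by (simp add: ends)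
    moreover have "Suc (k - 1) = k" using 2 len by simp
    then have "{x, p ! (k - 1)} \<in> T" using succ[of "k - 1"] k by (simp add: insert_commute)
    ultimately show ?thesis by blast
  next
    case 3
    have "p ! Suc k \<noteq> p ! (k - 1)" using nth_eq_iff_index_eq[OF dist, of "Suc k" "k - 1"] 3 k by auto
    moreover have "{x, p ! Suc k} \<in> T" using succ 3 k by simp
    moreover have "{x, p ! (k - 1)} \<in> T" using succ[of "k - 1"] 3 k by (simp add: insert_commute)
    ultimately show ?thesis by blast
  qed
qed

lemma rtree_acyclic: "rtree n T \<Longrightarrow> \<not> is_cycle T p"
proof (induction rule: rtree.induct)
  case edge
  show ?case
  proof
    assume c: "is_cycle {{1, 2}} p"
    then have "p \<noteq> []" by (auto simp: is_cycle_def)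
    then have "hd p \<in> set p" by simp
    from is_cycle_neighbours[OF c this] show False by (auto simp: doubleton_eq_iff)
  qed
next
  case (leaf n T i)
  show ?case
  proof
    assume c: "is_cycle (insert {i, Suc n} T) p"
    have "Suc n \<notin> set p"
    proof
      assume "Suc n \<in> set p"
      from is_cycle_neighbours[OF c this] obtain y z where
        "y \<noteq> z" "{Suc n, y} \<in> insert {i, Suc n} T" "{Suc n, z} \<in> insert {i, Suc n} T" by blast
      then show False
        using rtree_new_vertex[OF leaf(1)] by (auto simp: doubleton_eq_iff)
    qed
    then have old: "{x, y} \<in> T" if "{x, y} \<in> insert {i, Suc n} T" "x \<in> set p" "y \<in> set p" for x y
      using that by (auto simp: doubleton_eq_iff)
    have p: "p \<noteq> []" using c by (auto simp: is_cycle_def)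
    have "successively (\<lambda>x y. {x, y} \<in> T) p" unfolding successively_conv_nth
    proof (intro allI impI)
      fix j assume j: "Suc j < length p"
      then have "{p ! j, p ! Suc j} \<in> insert {i, Suc n} T"
        using c unfolding is_cycle_def successively_conv_nth by blast
      with j show "{p ! j, p ! Suc j} \<in> T" by (intro old) simp_all
    qed
    moreover have "{last p, hd p} \<in> T" using c p by (intro old) (simp_all add: is_cycle_def)
    ultimately have "is_cycle T p" using c by (simp add: is_cycle_def)
    with leaf show False by simp
  qed
qed

lemma rtree_labeled_tree:
  assumes "rtree n T"
  shows "labeled_tree n T"
proof -
  have "(x, 1) \<in> (avoid T 0)\<^sup>* \<and> (1, x) \<in> (avoid T 0)\<^sup>*" if "x \<in> {1..n}" for x
    by (rule connected_by_parents[of "{1..n}", OF _ _ _ that])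
       (use rtree_parent_exists[OF assms] rtree_ge_2[OF assms] in auto)
  then have "(x, y) \<in> (avoid T 0)\<^sup>*" if "x \<in> {1..n}" "y \<in> {1..n}" for x y
    using that by (meson rtrancl_trans)
  moreover have "(avoid T 0)\<^sup>* \<subseteq> {(x, y). {x, y} \<in> T}\<^sup>*"
    by (rule rtrancl_mono) (auto simp: avoid_def)
  ultimately have "connected_graph n T" unfolding connected_graph_def by blast
  then show ?thesis
    using rtree_ge_2[OF assms] rtree_edge[OF assms] rtree_acyclic[OF assms]
    unfolding labeled_tree_def simple_graph_def by auto
qed

section \<open>Groups of descendants and their influence on scores\<close>

text \<open>
  The vertices up to \<open>n\<close> whose last ancestor with label at most \<open>m\<close> lies in \<open>A\<close>. The recursion
  reads this off the final tree, where the edge from \<open>Suc n\<close> to a smaller vertex is unique.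
\<close>

primrec desc :: "nat \<Rightarrow> nat set \<Rightarrow> nat \<Rightarrow> nat set set \<Rightarrow> nat set" where
  "desc m A 0 T = A"
| "desc m A (Suc n) T = (if n < m then A else
     desc m A n T \<union> (if \<exists>i\<in>desc m A n T. {i, Suc n} \<in> T then {Suc n} else {}))"

lemma desc_base: "n \<le> m \<Longrightarrow> desc m A n T = A"
  by (cases n) auto

lemma desc_subset: "A \<subseteq> {1..m} \<Longrightarrow> m \<le> n \<Longrightarrow> desc m A n T \<subseteq> {1..n}"
proof (induction n)
  case (Suc n)
  show ?case
  proof (cases "n < m")
    case False
    then have "desc m A n T \<subseteq> {1..Suc n}" using Suc by fastforce
    then show ?thesis using False by auto
  qed (use Suc in auto)
qed simp

declare desc.simps [simp del]

lemma desc_insert_later: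
  assumes "A \<subseteq> {1..m}" "k \<le> n" "m \<le> n"
  shows "desc m A k (insert {i, Suc n} T) = desc m A k T"
  using assms(2)
proof (induction k)
  case (Suc k)
  have "{j, Suc k} \<noteq> {i, Suc n}" if "j \<in> desc m A k T" "m \<le> k" for j
    using subsetD[OF desc_subset[OF assms(1), of k T]] that Suc(2)
    by (fastforce simp: doubleton_eq_iff)
  then have "(\<exists>j\<in>desc m A k T. {j, Suc k} \<in> insert {i, Suc n} T) = (\<exists>j\<in>desc m A k T. {j, Suc k} \<in> T)"
    if "m \<le> k" using that by blast
  then show ?case using Suc by (simp add: desc.simps)
qed (simp add: desc.simps)

lemma desc_insert:
  assumes "rtree n T" "A \<subseteq> {1..m}" "m \<le> n"
  shows "desc m A (Suc n) (insert {i, Suc n} T) =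
     desc m A n T \<union> (if i \<in> desc m A n T then {Suc n} else {})"
proof -
  have "(\<exists>j\<in>desc m A n T. {j, Suc n} \<in> insert {i, Suc n} T) \<longleftrightarrow> i \<in> desc m A n T"
    using rtree_new_vertex[OF assms(1)] by (auto simp: doubleton_eq_iff)
  then show ?thesis
    using assms by (simp add: desc_insert_later desc.simps)
qed

lemma desc_compl:
  "rtree n T \<Longrightarrow> A \<subseteq> {1..m} \<Longrightarrow> 2 \<le> m \<Longrightarrow> m \<le> n \<Longrightarrow> desc m ({1..m} - A) n T = {1..n} - desc m A n T"
proof (induction rule: rtree.induct)
  case (leaf n T i)
  show ?case
  proof (cases "m \<le> n")
    case True
    let ?D = "desc m A n T"
    have sub: "?D \<subseteq> {1..n}" by (rule desc_subset[OF leaf(4) True])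
    have compl: "desc m ({1..m} - A) n T = {1..n} - ?D" by (rule leaf(3)[OF leaf(4,5) True])
    have "Suc n \<notin> ?D" using sub by auto
    moreover have "{1..Suc n} = insert (Suc n) {1..n}" by auto
    ultimately show ?thesis
      unfolding desc_insert[OF leaf(1,4) True] desc_insert[OF leaf(1) Diff_subset True] compl
      using leaf(2) by (cases "i \<in> ?D") (simp_all add: insert_Diff_if)
  next
    case False
    then have "m = Suc n" using leaf(6) by linarith
    then show ?thesis by (simp add: desc_base)
  qed
next
  case edge
  then have "m = 2" by simp
  with edge show ?case by (auto simp: desc_base)
qed

lemma desc_cover:
  "rtree n T \<Longrightarrow> \<Union>\<A> = {1..m} \<Longrightarrow> 2 \<le> m \<Longrightarrow> m \<le> n \<Longrightarrow> v \<in> {1..n} \<Longrightarrow> \<exists>A\<in>\<A>. v \<in> desc m A n T"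
proof (induction arbitrary: v rule: rtree.induct)
  case (leaf n T i)
  show ?case
  proof (cases "m \<le> n")
    case True
    define w where "w = (if v = Suc n then i else v)"
    have "w \<in> {1..n}" using leaf(2,7) by (auto simp: w_def)
    from leaf(3)[OF leaf(4,5) True this] obtain A where A: "A \<in> \<A>" "w \<in> desc m A n T" ..
    then have "A \<subseteq> {1..m}" using leaf(4) by blast
    from desc_insert[OF leaf(1) this True, of i] A(2)
    have "v \<in> desc m A (Suc n) (insert {i, Suc n} T)" by (auto simp: w_def split: if_splits)
    with A(1) show ?thesis ..
  next
    case False
    then have "m = Suc n" using leaf(6) by linarith
    then show ?thesis using leaf(4,7) by (simp add: desc_base) (metis Union_iff atLeastAtMost_iff One_nat_def)
  qed
next
  case edge
  then have "m = 2" by simp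
  then show ?case using edge by (simp add: desc_base) (metis Union_iff atLeastAtMost_iff)
qed

lemma desc_inter_base: "rtree n T \<Longrightarrow> A \<subseteq> {1..m} \<Longrightarrow> 2 \<le> m \<Longrightarrow> m \<le> n \<Longrightarrow> desc m A n T \<inter> {1..m} = A"
proof (induction rule: rtree.induct)
  case (leaf n T i)
  show ?case
  proof (cases "m \<le> n")
    case True
    from leaf(3)[OF leaf(4,5) True] show ?thesis
      using True unfolding desc_insert[OF leaf(1,4) True] by (simp add: Int_Un_distrib2)
  next
    case False
    then have "m = Suc n" using leaf(6) by linarith
    with leaf(4) show ?thesis by (auto simp: desc_base)
  qed
next
  case edge
  then have "m = 2" by simp
  with edge show ?case by (auto simp: desc_base)
qed

lemma desc_edge:
  "rtree n T \<Longrightarrow> A \<subseteq> {1..m} \<Longrightarrow> 2 \<le> m \<Longrightarrow> m \<le> n \<Longrightarrow> {x, y} \<in> T \<Longrightarrow> x < y \<Longrightarrow> m < y \<Longrightarrow>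
     y \<in> desc m A n T \<longleftrightarrow> x \<in> desc m A n T"
proof (induction rule: rtree.induct)
  case edge
  then show ?case by (auto simp: doubleton_eq_iff)
next
  case (leaf n T i)
  have y: "y \<le> Suc n" using leaf(2,7) rtree_edge[OF leaf(1)] by (auto simp: doubleton_eq_iff) fastforce
  then have mn: "m \<le> n" using leaf(9) by linarith
  have sub: "desc m A n T \<subseteq> {1..n}" by (rule desc_subset) (use leaf mn in auto)
  show ?case
  proof (cases "{x, y} \<in> T")
    case True
    then have "x \<noteq> Suc n" "y \<noteq> Suc n" using rtree_new_vertex[OF leaf(1)] by blast+
    moreover have "y \<in> desc m A n T \<longleftrightarrow> x \<in> desc m A n T" using leaf True mn by blast
    ultimately show ?thesis using leaf mn by (simp add: desc_insert)
  next
    case False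
    then have "x = i" "y = Suc n" using leaf by (auto simp: doubleton_eq_iff)
    then show ?thesis using sub leaf mn by (auto simp: desc_insert)
  qed
qed

text \<open>
  Without the root, no path leaves a group that is closed under the edges among the first \<open>m\<close>
  vertices. The term \<open>n\<close> accounts for the paths that start in the root.
\<close>

lemma score_root_le:
  assumes T: "rtree n T" and m: "2 \<le> m" "m \<le> n" and cov: "\<Union>\<A> = {1..m}"
    and closed: "\<And>A x y. A \<in> \<A> \<Longrightarrow> x \<in> A \<Longrightarrow> x \<noteq> 1 \<Longrightarrow> y \<in> {1..m} \<Longrightarrow> y \<noteq> 1 \<Longrightarrow> {x, y} \<in> T \<Longrightarrow> y \<in> A"
    and b: "\<And>A. A \<in> \<A> \<Longrightarrow> card (desc m A n T) \<le> b"
  shows "score n T 1 \<le> n + n * b"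
proof -
  have le: "card ((avoid T 1)\<^sup>* `` {u}) \<le> b + (if u = 1 then n else 0)" if u: "u \<in> {1..n}" for u
  proof (cases "u = 1")
    case True
    have "card ((avoid T 1)\<^sup>* `` {u}) \<le> card {1..n}"
      by (rule card_mono) (use avoid_Image_subset[OF T u] in auto)
    then show ?thesis using True by simp
  next
    case False
    from desc_cover[OF T cov m u] obtain A where A: "A \<in> \<A>" "u \<in> desc m A n T" by blast
    have sub: "A \<subseteq> {1..m}" using A cov by blast
    let ?D = "desc m A n T"
    have "y \<in> ?D" if xy: "x \<in> ?D" "x \<noteq> 1" "{x, y} \<in> T" "y \<noteq> 1" for x y
    proof -
      have xyn: "x \<in> {1..n}" "y \<in> {1..n}" using rtree_edge[OF T xy(3)] by auto
      have ne: "x \<noteq> y" using rtree_no_loop[OF T] xy(3) by auto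
      show ?thesis
      proof (cases "x \<le> m \<and> y \<le> m")
        case True
        with xy(1) xyn have "x \<in> ?D \<inter> {1..m}" by simp
        then have "x \<in> A" unfolding desc_inter_base[OF T sub m] .
        then have "y \<in> A" by (rule closed[OF A(1)]) (use True xy xyn in simp_all)
        then have "y \<in> ?D \<inter> {1..m}" unfolding desc_inter_base[OF T sub m] .
        then show ?thesis by simp
      next
        case False
        then have "m < max x y" by auto
        moreover have "{min x y, max x y} = {x, y}" by (auto simp: min_def max_def)
        ultimately have "max x y \<in> ?D \<longleftrightarrow> min x y \<in> ?D"
          by (intro desc_edge[OF T sub m]) (use xy ne in auto)
        then show ?thesis using xy(1) by (auto simp: min_def max_def split: if_splits)
      qed
    qed
    then have "(avoid T 1)\<^sup>* `` {u} \<subseteq> ?D - {1}"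
      by (intro rtrancl_Image_least) (use A False in \<open>auto simp: avoid_def\<close>)
    then have "(avoid T 1)\<^sup>* `` {u} \<subseteq> ?D" by blast
    moreover have "finite ?D" using finite_subset[OF desc_subset[OF sub m(2)]] by simp
    ultimately have "card ((avoid T 1)\<^sup>* `` {u}) \<le> card ?D" by (rule card_mono[rotated])
    then show ?thesis using b[OF A(1)] by simp
  qed
  have "score n T 1 \<le> (\<Sum>u\<in>{1..n}. b + (if u = 1 then n else 0))"
    unfolding score_def by (rule sum_mono) (rule le)
  also have "\<dots> = n * b + n" using m by (simp add: sum_delta_add)
  finally show ?thesis by simp
qed

text \<open>
  If \<open>v\<close> belongs to a group, the complement of the group stays connected without \<open>v\<close>, since it is
  connected through parents. The set \<open>C\<close> consists of early vertices that may be used in addition,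
  even if they belong to the group of \<open>v\<close>; this matters when the group of \<open>v\<close> contains the centre
  of the early tree.
\<close>

lemma score_ge_compl:
  assumes T: "rtree n T" and m: "2 \<le> m" "m \<le> n" and A: "A \<subseteq> {1..m}"
    and v: "v \<in> desc m A n T" "v \<notin> C"
    and C: "C \<subseteq> {1..m}" "{1..m} - A \<subseteq> C" "1 \<in> C"
    and par: "\<And>x. x \<in> C \<Longrightarrow> x \<noteq> 1 \<Longrightarrow> \<exists>y\<in>C. y < x \<and> {x, y} \<in> T"
  shows "(n - card (desc m A n T))\<^sup>2 \<le> score n T v"
proof -
  let ?D = "desc m A n T"
  let ?S = "C \<union> ({1..n} - ?D)"
  have D: "?D \<subseteq> {1..n}" "?D \<inter> {1..m} = A"
    using desc_subset[OF A m(2)] desc_inter_base[OF T A m] by auto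
  have "(card ?S)\<^sup>2 \<le> score n T v"
  proof (rule score_ge_of_connected[OF T])
    fix x assume x: "x \<in> ?S" "x \<noteq> 1"
    show "\<exists>y\<in>?S. y < x \<and> {x, y} \<in> T"
    proof (cases "x \<in> C")
      case True
      with par x show ?thesis by blast
    next
      case False
      then have xD: "x \<in> {1..n}" "x \<notin> ?D" using x by auto
      have "m < x" using False xD D(2) C(2) A by (metis Diff_iff IntE atLeastAtMost_iff not_le subsetD)
      from rtree_parent_exists[OF T xD(1) x(2)] obtain y
        where y: "y \<in> {1..n}" "y < x" "{x, y} \<in> T" by blast
      then have "y \<notin> ?D"
        using desc_edge[OF T A m, of y x] xD \<open>m < x\<close> by (simp add: insert_commute)
      with y show ?thesis by blast
    qed
  qed (use C m v in auto)
  moreover have "n - card ?D \<le> card ?S"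
  proof -
    have "n - card ?D = card ({1..n} - ?D)"
      using D(1) finite_subset[OF D(1)] by (simp add: card_Diff_subset)
    also have "\<dots> \<le> card ?S"
      by (rule card_mono) (use C(1) finite_subset[OF C(1)] in auto)
    finally show ?thesis .
  qed
  ultimately show ?thesis by (meson le_trans power2_nat_le_eq_le)
qed

section \<open>Two products\<close>

text \<open>
  This is the central binomial coefficient of \<open>2 * r\<close> over \<open>r\<close> divided by \<open>4 ^ r\<close>. It is the
  probability that a vertex of degree 1 at time 2 keeps this degree for \<open>r\<close> further steps, and it
  also gives the distribution of the sides of the first edge.
\<close>

definition half_prod :: "nat \<Rightarrow> real" where
  "half_prod r = (\<Prod>j\<in>{1..r}. 1 - 1 / (2 * real j))"

lemma half_prod_0 [simp]: "half_prod 0 = 1"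
  by (simp add: half_prod_def)

lemma half_prod_Suc: "half_prod (Suc r) = half_prod r * (1 - 1 / (2 * real (Suc r)))"
  by (simp add: half_prod_def)

lemma half_prod_pos: "0 < half_prod r"
  unfolding half_prod_def by (rule prod_pos) (auto simp: field_simps)

lemma half_prod_le: "half_prod r \<le> 1 / sqrt (real r + 1)"
proof -
  have "(half_prod r)\<^sup>2 * (real r + 1) \<le> 1"
  proof (induction r)
    case (Suc r)
    have "(1 - 1 / (2 * real (Suc r)))\<^sup>2 * (real (Suc r) + 1) \<le> real r + 1"
    proof -
      have "((2 * real r + 1) / (2 * (real r + 1)))\<^sup>2 * (real r + 2) \<le> real r + 1"
      proof -
        have "(2 * real r + 1)\<^sup>2 * (real r + 2) \<le> (real r + 1) * (2 * (real r + 1))\<^sup>2"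
          by (simp add: power2_eq_square algebra_simps)
        then show ?thesis by (simp add: power_divide field_simps)
      qed
      moreover have eq: "1 - 1 / (2 * real (Suc r)) = (2 * real r + 1) / (2 * (real r + 1))"
        by (simp add: field_simps)
      moreover have "real (Suc r) + 1 = real r + 2" by simp
      ultimately show ?thesis by (simp only:)
    qed
    then have "(half_prod r)\<^sup>2 * ((1 - 1 / (2 * real (Suc r)))\<^sup>2 * (real (Suc r) + 1)) \<le>
        (half_prod r)\<^sup>2 * (real r + 1)"
      by (rule mult_left_mono) simp
    then show ?case using Suc unfolding half_prod_Suc by (simp add: power_mult_distrib mult_ac)
  qed simp
  then have "(half_prod r * sqrt (real r + 1))\<^sup>2 \<le> 1\<^sup>2"
    by (simp add: power_mult_distrib)
  then have "half_prod r * sqrt (real r + 1) \<le> 1"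
    by (rule power2_le_imp_le) simp
  then show ?thesis by (simp add: field_simps)
qed

lemma prod_one_plus_half: "(\<Prod>j\<in>{1..r}. 1 + 1 / (2 * real j)) = (2 * real r + 1) * half_prod r"
proof (induction r)
  case (Suc r)
  have "(\<Prod>j\<in>{1..Suc r}. 1 + 1 / (2 * real j)) =
      (2 * real r + 1) * half_prod r * (1 + 1 / (2 * real (Suc r)))"
    using Suc by simp
  also have "\<dots> = half_prod r * ((2 * real r + 1) * (1 + 1 / (2 * real (Suc r))))" by simp
  also have "(2 * real r + 1) * (1 + 1 / (2 * real (Suc r))) =
      (2 * real (Suc r) + 1) * (1 - 1 / (2 * real (Suc r)))"
    by (simp add: field_simps)
  finally show ?case by (simp add: half_prod_Suc mult_ac)
qed simp

lemma prod_shift_pred: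
  fixes f :: "nat \<Rightarrow> real"
  assumes "2 \<le> n"
  shows "(\<Prod>j\<in>{2..<n}. f (j - 1)) = (\<Prod>j\<in>{1..n - 2}. f j)"
  by (rule prod.reindex_bij_witness[of _ Suc "\<lambda>j. j - 1"]) (use assms in auto)

section \<open>Symmetry of the attachment process\<close>

primrec evolve :: "nat \<Rightarrow> nat \<Rightarrow> nat set set \<Rightarrow> nat set set pmf" where
  "evolve m 0 T = return_pmf T"
| "evolve m (Suc r) T = evolve m r T \<bind> attach_leaf (m + r)"

lemma PA_evolve: "2 \<le> m \<Longrightarrow> PA (m + r) = PA m \<bind> evolve m r"
proof (induction r)
  case 0
  have "evolve m 0 = return_pmf" by (simp add: fun_eq_iff)
  then show ?case by (simp add: bind_return_pmf')
next
  case (Suc r)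
  have "PA (m + Suc r) = PA m \<bind> evolve m r \<bind> attach_leaf (m + r)"
    using PA_Suc[of "m + r"] Suc by simp
  then show ?case by (simp add: bind_assoc_pmf)
qed

lemma set_pmf_evolve: "rtree m T \<Longrightarrow> T' \<in> set_pmf (evolve m r T) \<Longrightarrow> rtree (m + r) T'"
proof (induction r arbitrary: T')
  case (Suc r)
  then obtain S where S: "S \<in> set_pmf (evolve m r T)" "T' \<in> set_pmf (attach_leaf (m + r) S)"
    by (auto simp: set_bind_pmf)
  then have "rtree (m + r) S" using Suc by blast
  with S(2) show ?case by (auto simp: attach_leaf_def set_pmf_attach intro: rtree.leaf)
qed simp

lemma finite_set_pmf_evolve: "rtree m T \<Longrightarrow> finite (set_pmf (evolve m r T))"
  by (rule finite_subset[OF _ finite_rtrees[of "m + r"]]) (use set_pmf_evolve in blast)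

lemma relabel_comp: "relabel \<sigma> (relabel \<tau> T) = relabel (\<sigma> \<circ> \<tau>) T"
  by (simp add: relabel_def image_image image_comp)

lemma relabel_id [simp]: "relabel id T = T"
  by (simp add: relabel_def)

lemma vertex_degree_relabel:
  assumes "inj \<sigma>"
  shows "vertex_degree (relabel \<sigma> T) (\<sigma> v) = vertex_degree T v"
proof -
  have "{e \<in> relabel \<sigma> T. \<sigma> v \<in> e} = (\<lambda>e. \<sigma> ` e) ` {e \<in> T. v \<in> e}"
    unfolding relabel_def using inj_image_mem_iff[OF assms] by blast
  moreover have "inj_on (\<lambda>e. \<sigma> ` e) {e \<in> T. v \<in> e}"
    using assms by (auto simp: inj_on_def inj_image_eq_iff)
  ultimately show ?thesis unfolding vertex_degree_def by (simp add: card_image)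
qed

lemma attach_relabel:
  assumes T: "rtree n T" and p: "\<pi> permutes {1..n}"
  shows "map_pmf \<pi> (attach n T) = attach n (relabel \<pi> T)"
proof (rule pmf_eqI)
  fix i
  let ?d = "\<lambda>T j. real (vertex_degree T j)"
  have inj: "inj \<pi>" using p by (rule permutes_inj)
  have "(\<Sum>j\<in>{1..n}. ?d (relabel \<pi> T) j) = (\<Sum>j\<in>{1..n}. ?d (relabel \<pi> T) (\<pi> j))"
    using sum.permute[OF p, of "?d (relabel \<pi> T)"] by simp
  also have "\<dots> = (\<Sum>j\<in>{1..n}. ?d T j)" by (simp add: vertex_degree_relabel[OF inj])
  finally have sum: "(\<Sum>j\<in>{1..n}. ?d (relabel \<pi> T) j) = 2 * (real n - 1)"
    using sum_vertex_degree_real[OF T] by simp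
  have pos: "(\<Sum>j\<in>{1..n}. ?d (relabel \<pi> T) j) > 0"
    unfolding sum using rtree_ge_2[OF T] by simp
  obtain j where j: "i = \<pi> j" using p by (metis permutes_surj surjD)
  have "pmf (map_pmf \<pi> (attach n T)) (\<pi> j) = pmf (attach n T) j"
    by (rule pmf_map_inj') (rule inj)
  also have "\<dots> = pmf (attach n (relabel \<pi> T)) (\<pi> j)"
    unfolding pmf_attach_rtree[OF T] pmf_attach[OF pos] sum vertex_degree_relabel[OF inj]
    using permutes_in_image[OF p] by simp
  finally show "pmf (map_pmf \<pi> (attach n T)) i = pmf (attach n (relabel \<pi> T)) i"
    by (simp add: j)
qed

lemma attach_leaf_relabel:
  assumes T: "rtree n T" and p: "\<pi> permutes {1..n}"
  shows "map_pmf (relabel \<pi>) (attach_leaf n T) = attach_leaf n (relabel \<pi> T)"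
proof -
  have "\<pi> (Suc n) = Suc n" using p by (simp add: permutes_def)
  then have "relabel \<pi> (insert {i, Suc n} T) = insert {\<pi> i, Suc n} (relabel \<pi> T)" for i
    by (simp add: relabel_def)
  then show ?thesis
    unfolding attach_leaf_def attach_relabel[OF assms, symmetric]
    by (simp add: pmf.map_comp o_def)
qed

text \<open>
  Attachment depends on degrees only, so it commutes with permutations of the initial vertices.
\<close>

lemma evolve_relabel:
  assumes T: "rtree m T" and p: "\<pi> permutes {1..m}"
  shows "map_pmf (relabel \<pi>) (evolve m r T) = evolve m r (relabel \<pi> T)"
proof (induction r)
  case (Suc r)
  have p': "\<pi> permutes {1..m + r}" by (rule permutes_subset[OF p]) auto
  have "map_pmf (relabel \<pi>) (evolve m (Suc r) T) =
      evolve m r T \<bind> (\<lambda>S. map_pmf (relabel \<pi>) (attach_leaf (m + r) S))"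
    by (simp add: map_bind_pmf)
  also have "\<dots> = evolve m r T \<bind> (\<lambda>S. attach_leaf (m + r) (relabel \<pi> S))"
    by (rule bind_pmf_cong[OF refl]) (rule attach_leaf_relabel[OF set_pmf_evolve[OF T] p'])
  also have "\<dots> = evolve m (Suc r) (relabel \<pi> T)"
    by (simp add: Suc[symmetric] bind_map_pmf)
  finally show ?case .
qed simp

lemma relabel_edge:
  assumes "inj \<sigma>"
  shows "{\<sigma> x, \<sigma> y} \<in> relabel \<sigma> T \<longleftrightarrow> {x, y} \<in> T"
proof -
  have "{\<sigma> x, \<sigma> y} = \<sigma> ` {x, y}" by simp
  then show ?thesis
    unfolding relabel_def using assms by (metis (no_types, lifting) image_iff inj_image_eq_iff)
qed

lemma labeled_tree_relabel:
  assumes T: "labeled_tree n T" and p: "\<sigma> permutes {1..n}"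
  shows "labeled_tree n (relabel \<sigma> T)"
proof -
  have inj: "inj \<sigma>" using p by (rule permutes_inj)
  note edge = relabel_edge[OF inj]
  have simple: "simple_graph n (relabel \<sigma> T)"
    unfolding simple_graph_def
  proof
    fix e assume "e \<in> relabel \<sigma> T"
    then obtain e' where e': "e' \<in> T" "e = \<sigma> ` e'" by (auto simp: relabel_def)
    then have "e' \<subseteq> {1..n}" "card e' = 2" using T by (auto simp: labeled_tree_def simple_graph_def)
    then have "\<sigma> ` e' \<subseteq> \<sigma> ` {1..n}" "card (\<sigma> ` e') = 2"
      using inj by (auto simp: card_image inj_on_subset)
    then show "e \<subseteq> {1..n} \<and> card e = 2" using e' permutes_image[OF p] by simp
  qed
  have conn: "connected_graph n (relabel \<sigma> T)"
    unfolding connected_graph_def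
  proof (intro ballI)
    fix u v assume uv: "u \<in> {1..n}" "v \<in> {1..n}"
    have path: "(\<sigma> x, \<sigma> y) \<in> {(x, y). {x, y} \<in> relabel \<sigma> T}\<^sup>*" if "(x, y) \<in> {(x, y). {x, y} \<in> T}\<^sup>*" for x y
      using that
    proof induction
      case (step y z)
      then have "(\<sigma> y, \<sigma> z) \<in> {(x, y). {x, y} \<in> relabel \<sigma> T}" using edge by simp
      with step(3) show ?case by (rule rtrancl.rtrancl_into_rtrancl)
    qed simp
    obtain x y where "u = \<sigma> x" "v = \<sigma> y" "x \<in> {1..n}" "y \<in> {1..n}"
      using uv permutes_image[OF p] by (metis (no_types, opaque_lifting) image_iff)
    moreover from this have "(x, y) \<in> {(x, y). {x, y} \<in> T}\<^sup>*"
      using T by (simp add: labeled_tree_def connected_graph_def)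
    ultimately show "(u, v) \<in> {(x, y). {x, y} \<in> relabel \<sigma> T}\<^sup>*" using path by simp
  qed
  have "\<not> is_cycle (relabel \<sigma> T) q" for q
  proof
    assume c: "is_cycle (relabel \<sigma> T) q"
    have s: "\<sigma> (inv \<sigma> x) = x" for x using p by (simp add: permutes_inverses)
    have edge': "{inv \<sigma> x, inv \<sigma> y} \<in> T \<longleftrightarrow> {x, y} \<in> relabel \<sigma> T" for x y
      using edge[of "inv \<sigma> x" "inv \<sigma> y"] by (simp add: s)
    have "q \<noteq> []" using c by (auto simp: is_cycle_def)
    moreover have "inj_on (inv \<sigma>) (set q)"
      by (rule inj_on_subset[OF permutes_inj[OF permutes_inv[OF p]]]) simp
    ultimately have "is_cycle T (map (inv \<sigma>) q)"
      using c by (auto simp: is_cycle_def distinct_map successively_map edge' last_map hd_map)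
    then show False using T by (auto simp: labeled_tree_def)
  qed
  then show ?thesis using T simple conn by (auto simp: labeled_tree_def)
qed

text \<open>
  Exchanging 1 and \<open>l\<close> preserves the joint law of the tree and the uniform labeling, so every vertex of
  \<open>S\<close> is found with the same probability. The sum of these probabilities is the expected number of
  vertices of \<open>S\<close> in the output, which is at most \<open>K\<close>.
\<close>

lemma card_orbit_times_found_prob_le:
  fixes H :: "nat \<Rightarrow> nat set set \<Rightarrow> nat set" and K m r :: nat and T0 :: "nat set set"
  defines "n \<equiv> m + r"
  defines "q \<equiv> pair_pmf (evolve m r T0) (pmf_of_set {\<sigma>. \<sigma> permutes {1..n}})"
  assumes T0: "rtree m T0" and S: "S \<subseteq> {1..m}"
    and sym: "\<And>l. l \<in> S \<Longrightarrow> relabel (Transposition.transpose 1 l) T0 = T0"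
    and H: "\<And>T. labeled_tree n T \<Longrightarrow> H n T \<subseteq> {1..n} \<and> card (H n T) = K"
  shows "real (card S) * measure_pmf.prob q {(T, \<sigma>). \<sigma> 1 \<in> H n (relabel \<sigma> T)} \<le> real K"
proof -
  let ?U = "pmf_of_set {\<sigma>. \<sigma> permutes {1..n}}"
  let ?E = "\<lambda>l. {(T, \<sigma>). \<sigma> l \<in> H n (relabel \<sigma> T)}"
  have perms: "finite {\<sigma>. \<sigma> permutes {1..n}}" "{\<sigma>. \<sigma> permutes {1..n}} \<noteq> {}"
    using permutes_id[of "{1..n}"] by (simp add: finite_permutations, blast)
  have m: "1 \<in> {1..m}" using rtree_ge_2[OF T0] by simp
  have eq: "measure_pmf.prob q (?E l) = measure_pmf.prob q (?E 1)" if l: "l \<in> S" for l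
  proof -
    let ?t = "Transposition.transpose 1 l"
    have t: "?t permutes {1..m}" using l S m by (intro permutes_swap_id) auto
    then have t': "?t permutes {1..n}" by (rule permutes_subset) (auto simp: n_def)
    have "bij_betw (\<lambda>\<sigma>. \<sigma> \<circ> ?t) {\<sigma>. \<sigma> permutes {1..n}} {\<sigma>. \<sigma> permutes {1..n}}"
      by (rule bij_betw_byWitness[where f' = "\<lambda>\<sigma>. \<sigma> \<circ> ?t"])
         (use t' in \<open>auto simp: comp_assoc intro: permutes_compose\<close>)
    then have U: "map_pmf (\<lambda>\<sigma>. \<sigma> \<circ> ?t) ?U = ?U"
      by (rule map_pmf_of_set_bij_betw) (rule perms)+
    have "map_pmf (\<lambda>(T, \<sigma>). (relabel ?t T, \<sigma> \<circ> ?t)) q =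
        pair_pmf (map_pmf (relabel ?t) (evolve m r T0)) (map_pmf (\<lambda>\<sigma>. \<sigma> \<circ> ?t) ?U)"
      unfolding q_def by (rule map_pair)
    also have "\<dots> = q"
      unfolding U evolve_relabel[OF T0 t] sym[OF l] q_def ..
    finally have inv: "map_pmf (\<lambda>(T, \<sigma>). (relabel ?t T, \<sigma> \<circ> ?t)) q = q" .
    have "measure_pmf.prob q (?E l) = measure_pmf.prob (map_pmf (\<lambda>(T, \<sigma>). (relabel ?t T, \<sigma> \<circ> ?t)) q) (?E l)"
      unfolding inv ..
    also have "\<dots> = measure_pmf.prob q ((\<lambda>(T, \<sigma>). (relabel ?t T, \<sigma> \<circ> ?t)) -` ?E l)" by simp
    also have "(\<lambda>(T, \<sigma>). (relabel ?t T, \<sigma> \<circ> ?t)) -` ?E l = ?E 1"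
      by (auto simp: relabel_comp comp_assoc)
    finally show ?thesis .
  qed
  have fin: "finite (set_pmf q)"
    unfolding q_def using finite_set_pmf_evolve[OF T0] perms by simp
  have "real (card S) * measure_pmf.prob q (?E 1) = (\<Sum>l\<in>S. measure_pmf.prob q (?E l))"
    by (simp add: eq)
  also have "\<dots> = (\<Sum>l\<in>S. expect q (indicator (?E l)))" by simp
  also have "\<dots> = expect q (\<lambda>x. \<Sum>l\<in>S. indicator (?E l) x)"
    by (rule Bochner_Integration.integral_sum[symmetric]) (rule integrable_measure_pmf_finite[OF fin])
  also have "\<dots> \<le> expect q (\<lambda>x. real K)"
  proof (rule integral_mono_AE)
    show "AE x in measure_pmf q. (\<Sum>l\<in>S. indicator (?E l) x) \<le> real K"
    proof (rule AE_pmfI)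
      fix x assume x: "x \<in> set_pmf q"
      obtain T \<sigma> where x': "x = (T, \<sigma>)" by fastforce
      with x have "T \<in> set_pmf (evolve m r T0)" "\<sigma> permutes {1..n}"
        unfolding q_def using perms by auto
      then have "labeled_tree n (relabel \<sigma> T)"
        using set_pmf_evolve[OF T0] rtree_labeled_tree labeled_tree_relabel unfolding n_def by blast
      note h = H[OF this]
      have finS: "finite S" using finite_subset[OF S] by simp
      have "(\<Sum>l\<in>S. indicator (?E l) x) = (\<Sum>l\<in>S. of_bool (\<sigma> l \<in> H n (relabel \<sigma> T)) :: real)"
        by (rule sum.cong) (auto simp: x' indicator_def)
      also have "\<dots> = real (card {l \<in> S. \<sigma> l \<in> H n (relabel \<sigma> T)})"
        using finS by (simp add: sum_of_bool_eq Int_def)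
      also have "card {l \<in> S. \<sigma> l \<in> H n (relabel \<sigma> T)} \<le> card (H n (relabel \<sigma> T))"
      proof (rule card_inj_on_le)
        show "inj_on \<sigma> {l \<in> S. \<sigma> l \<in> H n (relabel \<sigma> T)}"
          using permutes_inj[OF \<open>\<sigma> permutes {1..n}\<close>] by (rule inj_on_subset) simp
        show "finite (H n (relabel \<sigma> T))" using finite_subset[of _ "{1..n}"] h by simp
      qed auto
      finally show "(\<Sum>l\<in>S. indicator (?E l) x) \<le> real K" using h by simp
    qed
  qed (auto intro: integrable_measure_pmf_finite[OF fin])
  finally show ?thesis by simp
qed


section \<open>The root as one of many leaves\<close>

text \<open>
  The quantities of this section change only when the new vertex is attached to the root, to vertex 2,
  or to a leaf next to vertex 2.
\<close>

lemma expectation_attach_leaf_le: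
  fixes f :: "nat set set \<Rightarrow> real"
  assumes T: "rtree n T" and L: "L \<subseteq> {1..n}"
    and f: "\<And>i. i \<in> {1..n} \<Longrightarrow> f (insert {i, Suc n} T) \<le>
       a + b * of_bool (i = 1) + c * of_bool (i = 2) + d * of_bool (i \<in> L)"
  shows "expect (attach_leaf n T) f \<le>
       a + b * attach_prob n T 1 + c * attach_prob n T 2 + d * (\<Sum>i\<in>L. attach_prob n T i)"
proof -
  have n: "1 \<in> {1..n}" "2 \<in> {1..n}" using rtree_ge_2[OF T] by auto
  have nonneg: "0 \<le> attach_prob n T i" for i
    using rtree_ge_2[OF T] by (simp add: attach_prob_def)
  have "expect (attach_leaf n T) f \<le> (\<Sum>i\<in>{1..n}. attach_prob n T i *
      (a + b * of_bool (i = 1) + c * of_bool (i = 2) + d * of_bool (i \<in> L)))"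
    unfolding expectation_attach_leaf[OF T] by (rule sum_mono, rule mult_left_mono[OF f nonneg])
  also have "\<dots> = a * (\<Sum>i\<in>{1..n}. attach_prob n T i) + b * (\<Sum>i\<in>{1..n}. attach_prob n T i * of_bool (i = 1))
      + c * (\<Sum>i\<in>{1..n}. attach_prob n T i * of_bool (i = 2))
      + d * (\<Sum>i\<in>{1..n}. attach_prob n T i * of_bool (i \<in> L))"
    by (simp add: sum.distrib sum_distrib_left algebra_simps
        del: sum_mult_of_bool_eq sum_of_bool_mult_eq)
  also have "(\<Sum>i\<in>{1..n}. attach_prob n T i * of_bool (i = 1)) = attach_prob n T 1"
    using n by (subst sum.remove[OF _ n(1)]) auto
  also have "(\<Sum>i\<in>{1..n}. attach_prob n T i * of_bool (i = 2)) = attach_prob n T 2"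
    using n by (subst sum.remove[OF _ n(2)]) auto
  also have "(\<Sum>i\<in>{1..n}. attach_prob n T i * of_bool (i \<in> L)) = (\<Sum>i\<in>L. attach_prob n T i)"
    using L by (simp add: sum.If_cases of_bool_def if_distrib Int_absorb1 cong: if_cong)
  finally show ?thesis using sum_attach_prob[OF T] by simp
qed

abbreviation root_leaf :: "nat set set \<Rightarrow> real" where
  "root_leaf T \<equiv> of_bool (vertex_degree T 1 = 1)"

abbreviation deg2 :: "nat set set \<Rightarrow> real" where
  "deg2 T \<equiv> real (vertex_degree T 2)"

definition leaves2 :: "nat set set \<Rightarrow> nat set" where
  "leaves2 T = {v. {2, v} \<in> T \<and> vertex_degree T v = 1}"

lemma leaves2_subset: "rtree n T \<Longrightarrow> leaves2 T \<subseteq> {1..n} - {2}"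
  using rtree_edge[of n T] rtree_no_loop[of n T 2] by (auto simp: leaves2_def)

lemma finite_leaves2: "rtree n T \<Longrightarrow> finite (leaves2 T)"
  using finite_subset[OF leaves2_subset] by simp

lemma edge12_in_rtree: "rtree n T \<Longrightarrow> {2, 1} \<in> T"
  by (induction rule: rtree.induct) (auto simp: insert_commute)

lemma card_leaves2_le: "rtree n T \<Longrightarrow> card (leaves2 T) \<le> vertex_degree T 2"
  unfolding vertex_degree_def
proof (rule card_inj_on_le)
  show "inj_on (\<lambda>v. {2, v}) (leaves2 T)" by (auto simp: inj_on_def doubleton_eq_iff)
qed (auto simp: leaves2_def rtree_finite)

lemma vertex_degree_insert12:
  assumes "rtree n T" "i \<in> {1..n}"
  shows "vertex_degree (insert {i, Suc n} T) (Suc 0) = vertex_degree T (Suc 0) + of_bool (i = 1)"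
    "vertex_degree (insert {i, Suc n} T) 2 = vertex_degree T 2 + of_bool (i = 2)"
  using rtree_ge_2[OF assms(1)] vertex_degree_insert[OF assms] by auto

lemma card_leaves2_insert:
  assumes T: "rtree n T" and i: "i \<in> {1..n}"
  shows "real (card (leaves2 T)) + of_bool (i = 2) - of_bool (i \<in> leaves2 T) \<le>
     real (card (leaves2 (insert {i, Suc n} T)))"
proof -
  let ?T' = "insert {i, Suc n} T"
  have T': "rtree (Suc n) ?T'" using rtree.leaf[OF T i] .
  have new: "Suc n \<notin> leaves2 T" using leaves2_subset[OF T] by auto
  have one: "vertex_degree ?T' (Suc n) = 1" by (simp add: vertex_degree_insert[OF T i])
  have sub: "leaves2 T - {i} \<subseteq> leaves2 ?T'"
    using new by (auto simp: leaves2_def vertex_degree_insert[OF T i])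
  show ?thesis
  proof (cases "i = 2")
    case True
    then have "insert (Suc n) (leaves2 T) \<subseteq> leaves2 ?T'"
      using sub leaves2_subset[OF T] one by (auto simp: leaves2_def)
    then have "card (insert (Suc n) (leaves2 T)) \<le> card (leaves2 ?T')"
      by (rule card_mono[OF finite_leaves2[OF T']])
    moreover have "i \<notin> leaves2 T" using True leaves2_subset[OF T] by auto
    ultimately show ?thesis using True new finite_leaves2[OF T] by simp
  next
    case False
    have "card (leaves2 T - {i}) \<le> card (leaves2 ?T')"
      by (rule card_mono[OF finite_leaves2[OF T'] sub])
    moreover have "card (leaves2 T) \<le> card (leaves2 T - {i}) + (if i \<in> leaves2 T then 1 else 0)"
      using finite_leaves2[OF T] by (auto simp: card_Diff_singleton)
    ultimately show ?thesis using False by (simp add: of_bool_def split: if_splits)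
  qed
qed

lemma expectation_root_leaf:
  assumes "2 \<le> n"
  shows "expect (PA n) root_leaf \<le> half_prod (n - 2)"
proof -
  have "expect (PA n) root_leaf \<le>
      (\<Prod>j\<in>{2..<n}. 1 - 1 / (2 * real (j - 1))) * expect (PA 2) root_leaf"
  proof (rule expectation_growth[OF le_refl assms])
    fix j T assume j: "2 \<le> j" and T: "rtree j T"
    let ?W = "root_leaf T"
    have "expect (attach_leaf j T) root_leaf \<le>
        ?W + (- ?W) * attach_prob j T 1 + 0 * attach_prob j T 2 + 0 * (\<Sum>i\<in>{}. attach_prob j T i)"
      by (rule expectation_attach_leaf_le[OF T])
         (use vertex_degree_pos[OF T, of 1] j in \<open>auto simp: vertex_degree_insert12[OF T]\<close>)
    also have "\<dots> = (1 - 1 / (2 * real (j - 1))) * ?W"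
      using j by (auto simp: attach_prob_def of_nat_diff algebra_simps)
    finally show "expect (attach_leaf j T) root_leaf \<le>
        (1 - 1 / (2 * real (j - 1))) * ?W" .
  qed (auto simp: field_simps)
  also have "expect (PA 2) root_leaf = 1"
    unfolding PA_2 by (simp add: vertex_degree_edge)
  finally show ?thesis
    using prod_shift_pred[OF assms, of "\<lambda>j. 1 - 1 / (2 * real j)"] by (simp add: half_prod_def)
qed

text \<open>
  The product is a martingale: as long as the root is a leaf, the loss when it stops being one is
  exactly compensated by the growth of the degree of vertex 2.
\<close>

lemma expectation_root_leaf_deg2:
  assumes "2 \<le> n"
  shows "1 \<le> expect (PA n) (\<lambda>T. root_leaf T * deg2 T)"
proof -
  let ?f = "\<lambda>T. - (root_leaf T * deg2 T)"
  have "expect (PA n) ?f \<le>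
      (\<Prod>j\<in>{2..<n}. 1) * expect (PA 2) ?f"
  proof (rule expectation_growth[OF le_refl assms])
    fix j T assume j: "2 \<le> j" and T: "rtree j T"
    let ?W = "root_leaf T"
    have "expect (attach_leaf j T) ?f \<le>
        - (?W * deg2 T) + (?W * deg2 T) * attach_prob j T 1 + (- ?W) * attach_prob j T 2
        + 0 * (\<Sum>i\<in>{}. attach_prob j T i)"
      by (rule expectation_attach_leaf_le[OF T])
         (use vertex_degree_pos[OF T, of 1] j in \<open>auto simp: vertex_degree_insert12[OF T]\<close>)
    also have "\<dots> = 1 * ?f T"
      using j by (auto simp: attach_prob_def algebra_simps)
    finally show "expect (attach_leaf j T) ?f \<le> 1 * ?f T" .
  qed auto
  also have "expect (PA 2) ?f = - 1"
    unfolding PA_2 by (simp add: vertex_degree_edge)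
  finally show ?thesis by simp
qed

lemma expectation_root_leaf_deg2_sq:
  assumes "2 \<le> n"
  shows "expect (PA n) (\<lambda>T. root_leaf T * (deg2 T * (deg2 T + 1))) \<le>
    4 * sqrt (real n - 1)"
proof -
  let ?f = "\<lambda>T. root_leaf T * (deg2 T * (deg2 T + 1))"
  have "expect (PA n) ?f \<le>
      (\<Prod>j\<in>{2..<n}. 1 + 1 / (2 * real (j - 1))) * expect (PA 2) ?f"
  proof (rule expectation_growth[OF le_refl assms])
    fix j T assume j: "2 \<le> j" and T: "rtree j T"
    let ?W = "root_leaf T"
    have "expect (attach_leaf j T) ?f \<le>
        ?f T + (- ?f T) * attach_prob j T 1 + (?W * (2 * (deg2 T + 1))) * attach_prob j T 2
        + 0 * (\<Sum>i\<in>{}. attach_prob j T i)"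
      by (rule expectation_attach_leaf_le[OF T])
         (use vertex_degree_pos[OF T, of 1] j in \<open>auto simp: vertex_degree_insert12[OF T] algebra_simps\<close>)
    also have "\<dots> = (1 + 1 / (2 * real (j - 1))) * ?f T"
    proof -
      define u where "u = 1 / (2 * real (j - 1))"
      have p: "attach_prob j T i = real (vertex_degree T i) * u" for i
        using j by (simp add: attach_prob_def u_def of_nat_diff)
      show ?thesis
        unfolding p u_def[symmetric] by (simp add: algebra_simps)
    qed
    finally show "expect (attach_leaf j T) ?f \<le> (1 + 1 / (2 * real (j - 1))) * ?f T" .
  qed auto
  also have "expect (PA 2) ?f = 2"
    unfolding PA_2 by (simp add: vertex_degree_edge)
  also have "(\<Prod>j\<in>{2..<n}. 1 + 1 / (2 * real (j - 1))) \<le> 2 * sqrt (real n - 1)"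
  proof -
    define x where "x = real n - 1"
    have x: "0 < x" using assms by (simp add: x_def)
    have "(\<Prod>j\<in>{2..<n}. 1 + 1 / (2 * real (j - 1))) = (2 * real (n - 2) + 1) * half_prod (n - 2)"
      using prod_shift_pred[OF assms, of "\<lambda>j. 1 + 1 / (2 * real j)"] prod_one_plus_half[of "n - 2"] by simp
    also have "\<dots> \<le> (2 * x) * (1 / sqrt x)"
      by (rule mult_mono) (use half_prod_le[of "n - 2"] less_imp_le[OF half_prod_pos] assms x
        in \<open>auto simp: x_def of_nat_diff\<close>)
    also have "\<dots> = 2 * sqrt x" using x by (simp add: field_simps)
    finally show ?thesis by (simp add: x_def)
  qed
  finally show ?thesis by simp
qed

text \<open>
  While the root is a leaf, at least half of the neighbours of vertex 2 are leaves in the mean: the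
  conditional mean of half the degree minus the number of leaves (0 if the root is no leaf) is at most \<open>1 - 1 / (j - 1)\<close> times
  its present value, and it is negative at time 2, where the only neighbour of vertex 2 is a leaf.
\<close>

lemma expectation_root_leaf_leaves2:
  assumes "2 \<le> n"
  shows "expect (PA n) (\<lambda>T. root_leaf T * deg2 T) / 2 \<le>
     expect (PA n) (\<lambda>T. root_leaf T * real (card (leaves2 T)))"
proof -
  let ?f = "\<lambda>T. root_leaf T * (deg2 T / 2 - real (card (leaves2 T)))"
  have "expect (PA n) ?f \<le>
      (\<Prod>j\<in>{2..<n}. 1 - 1 / real (j - 1)) * expect (PA 2) ?f"
  proof (rule expectation_growth[OF le_refl assms])
    fix j T assume j: "2 \<le> j" and T: "rtree j T"
    let ?W = "root_leaf T" and ?L = "real (card (leaves2 T))"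
    have Lsub: "leaves2 T \<subseteq> {1..j}" using leaves2_subset[OF T] by blast
    have root: "?W = 1 \<Longrightarrow> 1 \<in> leaves2 T" using edge12_in_rtree[OF T] by (simp add: leaves2_def)
    have "expect (attach_leaf j T) ?f \<le>
        ?f T + (- ?f T - ?W) * attach_prob j T 1 + (- ?W / 2) * attach_prob j T 2
        + ?W * (\<Sum>i\<in>leaves2 T. attach_prob j T i)"
    proof (rule expectation_attach_leaf_le[OF T Lsub])
      fix i assume i: "i \<in> {1..j}"
      note ins = vertex_degree_insert12[OF T i] card_leaves2_insert[OF T i]
      show "?f (insert {i, Suc j} T) \<le> ?f T + (- ?f T - ?W) * of_bool (i = 1)
          + (- ?W / 2) * of_bool (i = 2) + ?W * of_bool (i \<in> leaves2 T)"
      proof (cases "vertex_degree T 1 = 1")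
        case True
        with ins root show ?thesis by (cases "i = 1") (auto simp: field_simps)
      next
        case False
        with vertex_degree_pos[OF T, of 1] j have "vertex_degree T 1 \<ge> 2" by auto
        with ins(1) show ?thesis by auto
      qed
    qed
    also have "(\<Sum>i\<in>leaves2 T. attach_prob j T i) = ?L / (2 * (real j - 1))"
      by (simp add: attach_prob_def leaves2_def)
    also have "?f T + (- ?f T - ?W) * attach_prob j T 1 + (- ?W / 2) * attach_prob j T 2
        + ?W * (?L / (2 * (real j - 1))) \<le> (1 - 1 / real (j - 1)) * ?f T"
    proof (cases "vertex_degree T 1 = 1")
      case True
      define u where "u = 1 / (2 * (real j - 1))"
      have u: "0 \<le> u" "1 / real (j - 1) = 2 * u" using j by (auto simp: u_def of_nat_diff divide_simps)
      have p: "attach_prob j T i = real (vertex_degree T i) * u" for i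
        by (simp add: attach_prob_def u_def)
      have L: "?L / (2 * (real j - 1)) = ?L * u" by (simp add: u_def)
      show ?thesis
        unfolding p L u(2) using True u(1) by (simp add: diff_divide_distrib algebra_simps)
    qed simp
    finally show "expect (attach_leaf j T) ?f \<le> (1 - 1 / real (j - 1)) * ?f T" .
  qed (auto simp: field_simps)
  also have "expect (PA 2) ?f = - 1 / 2"
  proof -
    have "leaves2 {{Suc 0, 2}} = {Suc 0}"
      by (auto simp: leaves2_def vertex_degree_edge doubleton_eq_iff)
    then show ?thesis unfolding PA_2 by (simp add: vertex_degree_edge)
  qed
  also have "(\<Prod>j\<in>{2..<n}. 1 - 1 / real (j - 1)) * (- 1 / 2) \<le> 0"
  proof -
    have "0 \<le> (\<Prod>j\<in>{2..<n}. 1 - 1 / real (j - 1))" by (rule prod_nonneg) auto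
    then show ?thesis by simp
  qed
  finally have "expect (PA n) ?f \<le> 0" .
  moreover have "expect (PA n) ?f =
      expect (PA n) (\<lambda>T. root_leaf T * deg2 T / 2 - root_leaf T * real (card (leaves2 T)))"
    by (simp add: right_diff_distrib)
  moreover have "\<dots> = expect (PA n) (\<lambda>T. root_leaf T * deg2 T) / 2 -
      expect (PA n) (\<lambda>T. root_leaf T * real (card (leaves2 T)))"
    by (subst Bochner_Integration.integral_diff) (simp_all add: integrable_PA[OF assms])
  ultimately show ?thesis by simp
qed

definition hidden_root :: "nat \<Rightarrow> nat set set \<Rightarrow> bool" where
  "hidden_root M T \<longleftrightarrow> vertex_degree T 1 = 1 \<and> M \<le> card (leaves2 T)"

text \<open>
  At this time the root is a leaf with probability at most \<open>1 / (4 * M)\<close>. So the event that it is a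
  leaf and vertex 2 has fewer than \<open>M\<close> leaves contributes at most \<open>1 / 4\<close> to the mean number of
  these leaves, which is at least \<open>1 / 2\<close>. The rest is carried by hidden roots, whose probability is
  then bounded below by means of the second moment, which is at most of order \<open>M\<close>.
\<close>

lemma prob_hidden_root:
  assumes M: "0 < M" and n: "n = 16 * M\<^sup>2 + 1"
  shows "1 / (256 * real M) \<le> measure_pmf.prob (PA n) {T. hidden_root M T}"
proof -
  have "1 \<le> M\<^sup>2" using M by simp
  then have n2: "2 \<le> n" using n by simp
  let ?E = "expect (PA n)"
  \<comment> \<open>The second moment is at most \<open>16 * M\<close>; this weight makes it contribute only \<open>1 / 8\<close>.\<close>
  let ?lam = "128 * real M"
  have sq: "sqrt (real n - 1) = 4 * real M"
    unfolding n by (simp add: real_sqrt_mult)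
  have "1 / 2 \<le> ?E (\<lambda>T. root_leaf T * real (card (leaves2 T)))"
    using expectation_root_leaf_leaves2[OF n2] expectation_root_leaf_deg2[OF n2] by linarith
  also have "\<dots> \<le> ?E (\<lambda>T. M * root_leaf T + root_leaf T * (deg2 T * (deg2 T + 1)) / ?lam +
      ?lam / 4 * indicator {T. hidden_root M T} T)"
  proof (rule expectation_PA_mono[OF n2])
    fix T assume T: "rtree n T"
    define l where "l = real (card (leaves2 T))"
    have "l \<le> l * l / ?lam + ?lam / 4"
    proof -
      have "0 \<le> (l - ?lam / 2)\<^sup>2" by simp
      then show ?thesis using M by (simp add: power2_eq_square field_simps)
    qed
    moreover have "l * l \<le> deg2 T * (deg2 T + 1)"
      using card_leaves2_le[OF T] by (intro mult_mono) (auto simp: l_def)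
    then have "l * l / ?lam \<le> deg2 T * (deg2 T + 1) / ?lam" by (rule divide_right_mono) simp
    moreover have "0 \<le> deg2 T * (deg2 T + 1) / ?lam" by simp
    ultimately show "root_leaf T * real (card (leaves2 T)) \<le> M * root_leaf T +
        root_leaf T * (deg2 T * (deg2 T + 1)) / ?lam + ?lam / 4 * indicator {T. hidden_root M T} T"
      unfolding hidden_root_def l_def[symmetric]
      by (cases "M \<le> card (leaves2 T)") (auto simp: l_def intro!: add_increasing2)
  qed
  also have "\<dots> = M * ?E root_leaf + ?E (\<lambda>T. root_leaf T * (deg2 T * (deg2 T + 1))) / ?lam +
      ?lam / 4 * measure_pmf.prob (PA n) {T. hidden_root M T}"
    by (simp add: integrable_PA[OF n2])
  also have "\<dots> \<le> M * (1 / (4 * real M)) + (4 * (4 * real M)) / ?lam +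
      ?lam / 4 * measure_pmf.prob (PA n) {T. hidden_root M T}"
  proof (intro add_mono mult_left_mono divide_right_mono)
    have "real (n - 2) + 1 = real n - 1" using n2 by (simp add: of_nat_diff)
    then show "?E root_leaf \<le> 1 / (4 * real M)"
      using expectation_root_leaf[OF n2] half_prod_le[of "n - 2"] sq by simp
    show "?E (\<lambda>T. root_leaf T * (deg2 T * (deg2 T + 1))) \<le> 4 * (4 * real M)"
      using expectation_root_leaf_deg2_sq[OF n2] sq by simp
  qed auto
  also have "\<dots> = 3 / 8 + 32 * real M * measure_pmf.prob (PA n) {T. hidden_root M T}"
    using M by simp
  finally show ?thesis using M by (simp add: field_simps)
qed

text \<open>
  The only edge at a leaf next to vertex 2 joins it to vertex 2.
\<close>

lemma relabel_swap_leaves: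
  assumes T: "rtree n T" and l: "x \<in> leaves2 T" "y \<in> leaves2 T"
  shows "relabel (Transposition.transpose x y) T = T"
proof -
  let ?t = "Transposition.transpose x y"
  have only: "e = {2, v}" if v: "v \<in> leaves2 T" and e: "e \<in> T" "v \<in> e" for v e
  proof -
    have "card {e \<in> T. v \<in> e} = 1" using v by (simp add: leaves2_def vertex_degree_def)
    then obtain e0 where "{e \<in> T. v \<in> e} = {e0}" by (auto simp: card_1_singleton_iff)
    moreover have "{2, v} \<in> {e \<in> T. v \<in> e}" using v by (simp add: leaves2_def)
    moreover have "e \<in> {e \<in> T. v \<in> e}" using e by simp
    ultimately show ?thesis by (metis singletonD)
  qed
  have ne: "x \<noteq> 2" "y \<noteq> 2" using leaves2_subset[OF T] l by auto
  have sub: "?t ` e \<in> T" if e: "e \<in> T" for e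
  proof (cases "x \<in> e \<or> y \<in> e")
    case True
    then have "e = {2, x} \<or> e = {2, y}" using only l e by blast
    then have "?t ` e = {2, y} \<or> ?t ` e = {2, x}" using ne by auto
    then show ?thesis using l by (auto simp: leaves2_def)
  next
    case False
    then have "?t ` e = e" by (force simp: Transposition.transpose_def image_iff)
    with e show ?thesis by simp
  qed
  then have le: "relabel ?t T \<subseteq> T" by (auto simp: relabel_def)
  then have "relabel ?t (relabel ?t T) \<subseteq> relabel ?t T" unfolding relabel_def by (rule image_mono)
  then have "T \<subseteq> relabel ?t T" by (simp add: relabel_comp)
  with le show ?thesis by (rule subset_antisym)
qed

lemma found_prob_le:
  assumes H: "\<And>T. labeled_tree n T \<Longrightarrow> H n T \<subseteq> {1..n} \<and> card (H n T) = K"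
    and K: "0 < K" and m: "m = 16 * (2 * K)\<^sup>2 + 1" "m \<le> n"
  shows "root_found_prob H n \<le> 1 - 1 / (1024 * real K)"
proof -
  have "1 \<le> K\<^sup>2" using K by simp
  then have m2: "2 \<le> m" using m by simp
  obtain r where n: "n = m + r" using m(2) le_Suc_ex by blast
  let ?U = "pmf_of_set {\<sigma>. \<sigma> permutes {1..n}}"
  let ?E = "{(T, \<sigma>). \<sigma> 1 \<in> H n (relabel \<sigma> T)}"
  let ?q = "\<lambda>T0. pair_pmf (evolve m r T0) ?U"
  let ?A = "{T. hidden_root (2 * K) T}"
  have perms: "finite {\<sigma>. \<sigma> permutes {1..n}}" "{\<sigma>. \<sigma> permutes {1..n}} \<noteq> {}"
    using permutes_id[of "{1..n}"] by (simp add: finite_permutations, blast)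
  have fin: "finite (set_pmf (PA m))" by (rule finite_set_pmf_PA[OF m2])
  have g: "measure_pmf.prob (?q T0) ?E \<le> 1 - 1 / 2 * indicator ?A T0" if T0: "rtree m T0" for T0
  proof (cases "hidden_root (2 * K) T0")
    case True
    have "1 \<in> leaves2 T0" using True edge12_in_rtree[OF T0] by (simp add: hidden_root_def leaves2_def)
    then have "real (card (leaves2 T0)) * measure_pmf.prob (?q T0) ?E \<le> real K"
      unfolding n using leaves2_subset[OF T0] H[unfolded n]
      by (intro card_orbit_times_found_prob_le[OF T0] relabel_swap_leaves[OF T0]) auto
    moreover have "real (2 * K) * measure_pmf.prob (?q T0) ?E \<le>
        real (card (leaves2 T0)) * measure_pmf.prob (?q T0) ?E"
      using True by (intro mult_right_mono) (auto simp: hidden_root_def)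
    ultimately have "real (2 * K) * measure_pmf.prob (?q T0) ?E \<le> real K" by linarith
    then show ?thesis using K True by (simp add: field_simps)
  qed simp
  have "root_found_prob H n = expect (PA m \<bind> ?q) (indicator ?E)"
    unfolding root_found_prob_def n PA_evolve[OF m2] pair_pmf_def by (simp add: bind_assoc_pmf)
  also have "\<dots> = (\<Sum>T0\<in>set_pmf (PA m). pmf (PA m) T0 *\<^sub>R expect (?q T0) (indicator ?E))"
    by (rule pmf_expectation_bind[OF fin])
       (use finite_set_pmf_evolve perms in \<open>auto simp: set_pmf_PA[OF m2]\<close>)
  also have "\<dots> = expect (PA m) (\<lambda>T0. expect (?q T0) (indicator ?E))"
    by (rule integral_measure_pmf[symmetric, OF fin]) auto
  also have "\<dots> \<le> expect (PA m) (\<lambda>T0. 1 - 1 / 2 * indicator ?A T0)"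
    by (rule expectation_PA_mono[OF m2]) (use g in simp)
  also have "\<dots> = 1 - 1 / 2 * measure_pmf.prob (PA m) ?A"
    by (simp add: integrable_PA[OF m2])
  also have "\<dots> \<le> 1 - 1 / (1024 * real K)"
    using prob_hidden_root[of "2 * K" m] K m by simp
  finally show ?thesis .
qed

theorem root_finding_lower_bound:
  assumes "root_finding_procedure H K \<epsilon>" "0 < K" "0 < \<epsilon>"
  shows "1 / 1024 / \<epsilon> \<le> real K"
proof -
  let ?m = "16 * (2 * K)\<^sup>2 + 1"
  have H: "H n T \<subseteq> {1..n} \<and> card (H n T) = K" if "labeled_tree n T" "K \<le> n" for n T
    using assms(1) that by (simp add: root_finding_procedure_def)
  have Km: "K \<le> ?m" 
  proof -
    have "(2 * K)\<^sup>2 = 4 * (K * K)" by (simp add: power2_eq_square)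
    with le_square[of K] show ?thesis by linarith
  qed
  have "root_found_prob H n \<le> 1 - 1 / (1024 * real K)" if "?m \<le> n" for n
  proof (rule found_prob_le[OF _ assms(2) refl that])
    show "H n T \<subseteq> {1..n} \<and> card (H n T) = K" if "labeled_tree n T" for T
      by (rule H[OF that]) (use Km \<open>?m \<le> n\<close> in linarith)
  qed
  then have "\<forall>\<^sub>F n in sequentially. ereal (root_found_prob H n) \<le> ereal (1 - 1 / (1024 * real K))"
    by (intro eventually_sequentiallyI[of ?m]) simp
  then have "liminf (\<lambda>n. ereal (root_found_prob H n)) \<le> liminf (\<lambda>n. ereal (1 - 1 / (1024 * real K)))"
    by (rule Liminf_mono)
  moreover have "ereal (1 - \<epsilon>) \<le> liminf (\<lambda>n. ereal (root_found_prob H n))"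
    using assms(1) by (simp add: root_finding_procedure_def)
  ultimately have "ereal (1 - \<epsilon>) \<le> liminf (\<lambda>n. ereal (1 - 1 / (1024 * real K)))"
    by (rule order_trans[rotated])
  then have "ereal (1 - \<epsilon>) \<le> ereal (1 - 1 / (1024 * real K))"
    by (simp only: Liminf_const[OF sequentially_bot])
  then have "1 / (1024 * real K) \<le> \<epsilon>" by simp
  then show ?thesis using assms(2,3) by (simp add: field_simps)
qed

section \<open>The total degree of a group is a Polya urn\<close>

definition urn :: "nat \<Rightarrow> nat set \<Rightarrow> nat \<Rightarrow> nat set set \<Rightarrow> nat" where
  "urn m A n T = (\<Sum>v\<in>desc m A n T. vertex_degree T v)"

lemma finite_desc: "A \<subseteq> {1..m} \<Longrightarrow> m \<le> n \<Longrightarrow> finite (desc m A n T)"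
  using finite_subset[OF desc_subset] by simp

lemma Suc_notin_desc: "A \<subseteq> {1..m} \<Longrightarrow> m \<le> n \<Longrightarrow> Suc n \<notin> desc m A n T"
  using desc_subset[of A m n T] by (meson Suc_n_not_le_n atLeastAtMost_iff subsetD)

lemma urn_insert:
  assumes T: "rtree n T" and A: "A \<subseteq> {1..m}" "m \<le> n" and i: "i \<in> {1..n}"
  shows "urn m A (Suc n) (insert {i, Suc n} T) = urn m A n T + 2 * of_bool (i \<in> desc m A n T)"
proof -
  let ?D = "desc m A n T"
  have sub: "?D \<subseteq> {1..n}" by (rule desc_subset[OF A])
  have fin: "finite ?D" by (rule finite_desc[OF A])
  have new: "Suc n \<notin> ?D" using sub by auto
  have "(\<Sum>v\<in>?D. vertex_degree (insert {i, Suc n} T) v) =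
      (\<Sum>v\<in>?D. vertex_degree T v + (if v = i then 1 else 0))"
    by (rule sum.cong) (use new in \<open>auto simp: vertex_degree_insert[OF T i]\<close>)
  also have "\<dots> = urn m A n T + of_bool (i \<in> ?D)"
    using fin by (simp add: sum_delta_add urn_def)
  finally show ?thesis
    unfolding urn_def desc_insert[OF T A] using new fin vertex_degree_insert[OF T i, of "Suc n"] by simp
qed

text \<open>
  The group is a forest with one tree for each vertex of \<open>A\<close>. The edges of the forest count twice in
  the total degree, and each vertex of \<open>A\<close> has a further edge among the first \<open>m\<close> vertices.
\<close>

lemma card_desc_le_urn:
  "rtree n T \<Longrightarrow> A \<subseteq> {1..m} \<Longrightarrow> 2 \<le> m \<Longrightarrow> m \<le> n \<Longrightarrow>
     2 * card (desc m A n T) \<le> urn m A n T + card A"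
proof (induction rule: rtree.induct)
  case edge
  then have m: "m = 2" by simp
  have "(\<Sum>v\<in>A. 1) \<le> (\<Sum>v\<in>A. vertex_degree {{1, 2}} v)"
    by (rule sum_mono) (use edge m vertex_degree_pos[OF rtree.edge] in auto)
  then show ?case using m by (simp add: urn_def desc_base)
next
  case (leaf n T i)
  show ?case
  proof (cases "m \<le> n")
    case True
    have "Suc n \<notin> desc m A n T" by (rule Suc_notin_desc[OF leaf(4) True])
    then have "card (desc m A (Suc n) (insert {i, Suc n} T)) = card (desc m A n T) + of_bool (i \<in> desc m A n T)"
      unfolding desc_insert[OF leaf(1,4) True] using finite_desc[OF leaf(4) True] by simp
    then show ?thesis
      using leaf(3)[OF leaf(4,5) True] urn_insert[OF leaf(1,4) True leaf(2)] by simp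
  next
    case False
    then have m: "m = Suc n" using leaf(6) by linarith
    have "(\<Sum>v\<in>A. 1) \<le> (\<Sum>v\<in>A. vertex_degree (insert {i, Suc n} T) v)"
      by (rule sum_mono) (use leaf(4) m vertex_degree_pos[OF rtree.leaf[OF leaf(1,2)]] in auto)
    then show ?thesis using m by (simp add: urn_def desc_base)
  qed
qed

lemma urn_root_half:
  "rtree n T \<Longrightarrow> urn 2 {1} n T + 1 = 2 * card (desc 2 {1} n T)"
proof (induction rule: rtree.induct)
  case edge
  show ?case by (simp add: urn_def desc_base vertex_degree_edge)
next
  case (leaf n T i)
  have A: "{1} \<subseteq> {1..2::nat}" "2 \<le> n" using rtree_ge_2[OF leaf(1)] by auto
  have "Suc n \<notin> desc 2 {1} n T" by (rule Suc_notin_desc[OF A])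
  then have "card (desc 2 {1} (Suc n) (insert {i, Suc n} T)) = card (desc 2 {1} n T) + of_bool (i \<in> desc 2 {1} n T)"
    unfolding desc_insert[OF leaf(1) A] using finite_desc[OF A] by simp
  then show ?case using leaf(3) urn_insert[OF leaf(1) A leaf(2)] by simp
qed

lemma expectation_attach_leaf_urn:
  fixes f :: "nat \<Rightarrow> real"
  assumes T: "rtree n T" and A: "A \<subseteq> {1..m}" "m \<le> n"
  defines "p \<equiv> real (urn m A n T) / (2 * (real n - 1))"
  shows "expect (attach_leaf n T) (\<lambda>T'. f (urn m A (Suc n) T')) =
     p * f (urn m A n T + 2) + (1 - p) * f (urn m A n T)"
proof -
  let ?D = "desc m A n T" and ?w = "urn m A n T"
  have sub: "?D \<subseteq> {1..n}" by (rule desc_subset[OF A])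
  have "expect (attach_leaf n T) (\<lambda>T'. f (urn m A (Suc n) T')) =
      (\<Sum>i\<in>{1..n}. attach_prob n T i * (f ?w + (if i \<in> ?D then f (?w + 2) - f ?w else 0)))"
    unfolding expectation_attach_leaf[OF T]
    by (rule sum.cong) (auto simp: urn_insert[OF T A])
  also have "\<dots> = (\<Sum>i\<in>{1..n}. f ?w * attach_prob n T i +
      (f (?w + 2) - f ?w) * (if i \<in> ?D then attach_prob n T i else 0))"
    by (rule sum.cong) (auto simp: algebra_simps)
  also have "\<dots> = f ?w * (\<Sum>i\<in>{1..n}. attach_prob n T i) +
      (f (?w + 2) - f ?w) * (\<Sum>i\<in>{1..n}. if i \<in> ?D then attach_prob n T i else 0)"
    by (simp only: sum.distrib sum_distrib_left)
  also have "(\<Sum>i\<in>{1..n}. if i \<in> ?D then attach_prob n T i else 0) = (\<Sum>i\<in>?D. attach_prob n T i)"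
    using sub by (simp add: sum.If_cases Int_absorb1)
  also have "\<dots> = p"
    by (simp add: attach_prob_def p_def urn_def sum_divide_distrib[symmetric])
  finally show ?thesis using sum_attach_prob[OF T] by (simp add: algebra_simps)
qed

section \<open>Moments of urns and degrees\<close>

text \<open>
  Rising factorials turn an urn into a product: if \<open>x\<close> moves to \<open>x + 1\<close> with probability \<open>x / s\<close>, then
  the mean of \<open>pochhammer x p\<close> is multiplied by exactly \<open>1 + p / s\<close>.
\<close>

lemma pochhammer_growth:
  fixes x :: real
  shows "x * pochhammer (x + 1) p = (x + real p) * pochhammer x p"
  using pochhammer_rec[of x p] pochhammer_Suc[of x p] by (simp add: mult.commute)

lemma pochhammer_nonneg: "0 \<le> x \<Longrightarrow> 0 \<le> pochhammer (x::real) p"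
  unfolding pochhammer_prod by (rule prod_nonneg) auto

lemma power_le_pochhammer: "0 \<le> x \<Longrightarrow> x ^ p \<le> pochhammer (x::real) p"
proof -
  assume "0 \<le> x"
  then have "(\<Prod>i\<in>{0..<p}. x) \<le> (\<Prod>i\<in>{0..<p}. x + real i)" by (intro prod_mono) auto
  then show ?thesis by (simp add: pochhammer_prod)
qed

lemma pochhammer_mono: "0 \<le> x \<Longrightarrow> x \<le> y \<Longrightarrow> pochhammer (x::real) p \<le> pochhammer y p"
  unfolding pochhammer_prod by (rule prod_mono) auto

lemma one_plus_div_le_power:
  assumes "2 \<le> j"
  shows "1 + real p / (real j - 1) \<le> (real j / (real j - 1)) ^ p"
proof -
  have "1 + real p * (1 / (real j - 1)) \<le> (1 + 1 / (real j - 1)) ^ p"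
    by (rule Bernoulli_inequality) (use assms in \<open>auto simp: field_simps\<close>)
  moreover have "1 + 1 / (real j - 1) = real j / (real j - 1)" using assms by (simp add: field_simps)
  ultimately show ?thesis by simp
qed

lemma prod_ratio_telescope:
  assumes "2 \<le> m" "m \<le> n"
  shows "(\<Prod>j\<in>{m..<n}. (real j / (real j - 1)) ^ p) = ((real n - 1) / (real m - 1)) ^ p"
  using assms(2)
proof (induction n rule: dec_induct)
  case (step n)
  then have "(\<Prod>j\<in>{m..<Suc n}. (real j / (real j - 1)) ^ p) =
      ((real n - 1) / (real m - 1)) ^ p * (real n / (real n - 1)) ^ p" by simp
  also have "\<dots> = (real n / (real m - 1)) ^ p"
    using step assms by (simp add: power_mult_distrib[symmetric])
  finally show ?case by simp
qed (use assms in simp)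

text \<open>
  The tree at time \<open>m\<close>, as a function of a later tree.
\<close>

definition restr :: "nat \<Rightarrow> nat set set \<Rightarrow> nat set set" where
  "restr m T = {e \<in> T. e \<subseteq> {1..m}}"

lemma restr_insert: "m \<le> n \<Longrightarrow> restr m (insert {i, Suc n} T) = restr m T"
  by (auto simp: restr_def)

lemma restr_self: "rtree n T \<Longrightarrow> restr n T = T"
  using rtree_edge by (auto simp: restr_def)

text \<open>
  Half the total degree of a group moves up by 1 with probability proportional to itself. The factor
  \<open>g (restr m T)\<close> allows conditioning on the tree at time \<open>m\<close>.
\<close>

lemma expectation_urn_le:
  assumes m: "2 \<le> m" "m \<le> n" and A: "A \<subseteq> {1..m}" and g: "\<And>T. 0 \<le> g T"
  shows "expect (PA n) (\<lambda>T. g (restr m T) * pochhammer (real (urn m A n T) / 2) p) \<le>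
     ((real n - 1) / (real m - 1)) ^ p *
     expect (PA m) (\<lambda>T. g T * pochhammer (real (urn m A m T) / 2) p)"
proof -
  let ?P = "\<lambda>w. pochhammer (real w / 2) p"
  let ?f = "\<lambda>n T. g (restr m T) * ?P (urn m A n T)"
  have "expect (PA n) (?f n) \<le>
      (\<Prod>j\<in>{m..<n}. (real j / (real j - 1)) ^ p) * expect (PA m) (?f m)"
  proof (rule expectation_growth[OF m])
    fix j T assume j: "m \<le> j" and T: "rtree j T"
    define x where "x = real (urn m A j T) / 2"
    have x: "0 \<le> x" by (simp add: x_def)
    have j2: "2 \<le> j" using j m by simp
    have "expect (attach_leaf j T) (?f (Suc j)) =
        expect (attach_leaf j T) (\<lambda>T'. g (restr m T) * ?P (urn m A (Suc j) T'))"
      unfolding expectation_attach_leaf[OF T] by (simp add: restr_insert[OF j])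
    also have "\<dots> = g (restr m T) * expect (attach_leaf j T) (\<lambda>T'. ?P (urn m A (Suc j) T'))"
      by simp
    finally have eq: "expect (attach_leaf j T) (?f (Suc j)) = \<dots>" .
    have "expect (attach_leaf j T) (\<lambda>T'. ?P (urn m A (Suc j) T')) =
        x / (real j - 1) * pochhammer (x + 1) p + (1 - x / (real j - 1)) * pochhammer x p"
      unfolding expectation_attach_leaf_urn[OF T A j, of ?P] by (simp add: x_def add_divide_distrib add.commute)
    also have "\<dots> = (x * pochhammer (x + 1) p) / (real j - 1) + (1 - x / (real j - 1)) * pochhammer x p"
      by simp
    also have "\<dots> = (1 + real p / (real j - 1)) * pochhammer x p"
      unfolding pochhammer_growth by (simp add: algebra_simps add_divide_distrib)
    also have "\<dots> \<le> (real j / (real j - 1)) ^ p * pochhammer x p"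
      by (rule mult_right_mono[OF one_plus_div_le_power[OF j2] pochhammer_nonneg[OF x]])
    finally have "expect (attach_leaf j T) (\<lambda>T'. ?P (urn m A (Suc j) T')) \<le>
        (real j / (real j - 1)) ^ p * ?P (urn m A j T)" by (simp only: x_def)
    from mult_left_mono[OF this g] show "expect (attach_leaf j T) (?f (Suc j)) \<le>
        (real j / (real j - 1)) ^ p * ?f j T"
      unfolding eq by (simp only: mult.left_commute)
  qed (use m in auto)
  also have "expect (PA m) (?f m) =
      expect (PA m) (\<lambda>T. g T * ?P (urn m A m T))"
    by (rule integral_cong_AE) (use m in \<open>auto simp: AE_measure_pmf_iff set_pmf_PA restr_self\<close>)
  finally show ?thesis unfolding prod_ratio_telescope[OF m] .
qed

text \<open>
  Degrees grow at half the rate of urns, so even moments grow with half the exponent. The maximum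
  reflects that the process starts at time 2, when vertex 1 has degree 1 as well.
\<close>

lemma expectation_degree_le:
  assumes k: "1 \<le> k" "k \<le> m" and m: "2 \<le> m"
  shows "expect (PA m) (\<lambda>T. pochhammer (real (vertex_degree T k)) (2 * q)) \<le>
     ((real m - 1) / (real (max k 2) - 1)) ^ q * fact (2 * q)"
proof -
  let ?k = "max k 2"
  let ?f = "\<lambda>T. pochhammer (real (vertex_degree T k)) (2 * q)"
  have k': "2 \<le> ?k" "?k \<le> m" using k m by auto
  have "expect (PA m) ?f \<le>
      (\<Prod>j\<in>{?k..<m}. (real j / (real j - 1)) ^ q) * expect (PA ?k) ?f"
  proof (rule expectation_growth[OF k'])
    fix j T assume j: "?k \<le> j" and T: "rtree j T"
    define x where "x = real (vertex_degree T k)"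
    have x: "0 \<le> x" by (simp add: x_def)
    have j2: "2 \<le> j" using j by simp
    have kj: "k \<in> {1..j}" using k j by auto
    define p where "p = x / (2 * (real j - 1))"
    have p: "attach_prob j T k = p" by (simp add: attach_prob_def p_def x_def)
    have "expect (attach_leaf j T) ?f = (\<Sum>i\<in>{1..j}. attach_prob j T i *
        (pochhammer x (2 * q) + (if i = k then pochhammer (x + 1) (2 * q) - pochhammer x (2 * q) else 0)))"
      unfolding expectation_attach_leaf[OF T]
      by (rule sum.cong) (use kj in \<open>auto simp: vertex_degree_insert[OF T] x_def add.commute\<close>)
    also have "\<dots> = pochhammer x (2 * q) * (\<Sum>i\<in>{1..j}. attach_prob j T i) +
        p * (pochhammer (x + 1) (2 * q) - pochhammer x (2 * q))"
      using kj by (simp add: sum.distrib sum_distrib_left distrib_left mult.commute p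
        if_distrib[of "\<lambda>y. y * _"] if_distrib[of "\<lambda>y. _ * y"] cong: if_cong)
    also have "\<dots> = (x * pochhammer (x + 1) (2 * q)) / (2 * (real j - 1)) + (1 - p) * pochhammer x (2 * q)"
      unfolding sum_attach_prob[OF T] by (simp add: p_def algebra_simps)
    also have "\<dots> = (1 + real (2 * q) / (2 * (real j - 1))) * pochhammer x (2 * q)"
      unfolding pochhammer_growth p_def by (simp add: algebra_simps add_divide_distrib)
    also have "real (2 * q) / (2 * (real j - 1)) = real q / (real j - 1)"
      using j2 by (simp add: divide_simps)
    also have "(1 + real q / (real j - 1)) * pochhammer x (2 * q) \<le>
        (real j / (real j - 1)) ^ q * pochhammer x (2 * q)"
      by (rule mult_right_mono[OF one_plus_div_le_power[OF j2] pochhammer_nonneg[OF x]])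
    finally show "expect (attach_leaf j T) ?f \<le> (real j / (real j - 1)) ^ q * ?f T"
      by (simp add: x_def)
  qed auto
  also have "expect (PA ?k) ?f = expect (PA ?k) (\<lambda>T. fact (2 * q))"
  proof (rule integral_cong_AE)
    have "vertex_degree T k = 1" if T: "rtree ?k T" for T
    proof (cases "2 \<le> k")
      case True
      then have "?k = k" by simp
      then show ?thesis using vertex_degree_last T by metis
    next
      case False
      then have k1: "k = 1" and k2: "?k = 2" using k by auto
      from T have "T = {{1, 2}}" unfolding k2 rtree_2 .
      then show ?thesis by (simp add: k1 vertex_degree_edge)
    qed
    then show "AE T in measure_pmf (PA ?k). ?f T = fact (2 * q)"
      using k' by (auto simp: AE_measure_pmf_iff set_pmf_PA pochhammer_fact)
  qed auto
  finally show ?thesis unfolding prod_ratio_telescope[OF k'] by simp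
qed

lemma prob_le_expectation:
  assumes "2 \<le> n" "\<And>T. rtree n T \<Longrightarrow> P T \<Longrightarrow> 1 \<le> f T" "\<And>T. rtree n T \<Longrightarrow> 0 \<le> f T"
  shows "measure_pmf.prob (PA n) {T. P T} \<le> expect (PA n) f"
proof -
  have "expect (PA n) (indicator {T. P T}) \<le> expect (PA n) f"
    by (rule expectation_PA_mono) (use assms in \<open>auto simp: indicator_def\<close>)
  then show ?thesis by simp
qed

text \<open>
  Markov's inequality for the rising factorial of order \<open>2 * q\<close>, where the moments up to time \<open>m\<close> are
  those of the degree of \<open>k\<close> and the moments after time \<open>m\<close> are those of the urn.
\<close>

lemma prob_large_branch:
  fixes x :: real
  assumes k: "1 \<le> k" "k \<le> m" and m: "2 \<le> m" "m \<le> n" and x: "0 < x"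
  shows "measure_pmf.prob (PA n) {T. x * real n \<le> card (desc m {k} n T)} \<le>
     (16 * (real q)\<^sup>2 / (x\<^sup>2 * (real m - 1) * (real (max k 2) - 1))) ^ q"
proof -
  let ?p = "2 * q" and ?k = "real (max k 2) - 1"
  let ?y = "x * real n / 2"
  have A: "{k} \<subseteq> {1..m}" using k by simp
  have n2: "2 \<le> n" using m by simp
  have y: "0 < ?y" using x n2 by simp
  have k0: "0 < ?k" "0 < real m - 1" using m by auto
  have "measure_pmf.prob (PA n) {T. x * real n \<le> card (desc m {k} n T)} \<le>
      expect (PA n) (\<lambda>T. pochhammer (real (urn m {k} n T) / 2) ?p / ?y ^ ?p)"
  proof (rule prob_le_expectation[OF n2])
    fix T assume T: "rtree n T" and le: "x * real n \<le> card (desc m {k} n T)"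
    have fin: "finite (desc m {k} n T)" by (rule finite_desc[OF A m(2)])
    have "k \<in> desc m {k} n T" using desc_inter_base[OF T A m] by blast
    then have "card (desc m {k} n T) \<noteq> 0" using fin by (auto simp: card_eq_0_iff)
    then have "1 \<le> card (desc m {k} n T)" by simp
    then have "card (desc m {k} n T) \<le> urn m {k} n T"
      using card_desc_le_urn[OF T A m] by simp
    then have "?y \<le> real (urn m {k} n T) / 2" using le by simp
    then have "?y ^ ?p \<le> (real (urn m {k} n T) / 2) ^ ?p" using y by (intro power_mono) auto
    also have "\<dots> \<le> pochhammer (real (urn m {k} n T) / 2) ?p" by (rule power_le_pochhammer) simp
    finally show "1 \<le> pochhammer (real (urn m {k} n T) / 2) ?p / ?y ^ ?p" using y by simp
  qed (use y in \<open>auto intro!: divide_nonneg_pos pochhammer_nonneg zero_less_power\<close>)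
  also have "\<dots> = expect (PA n) (\<lambda>T. 1 * pochhammer (real (urn m {k} n T) / 2) ?p) / ?y ^ ?p"
    by simp
  also have "\<dots> \<le> (((real n - 1) / (real m - 1)) ^ ?p *
      expect (PA m) (\<lambda>T. 1 * pochhammer (real (urn m {k} m T) / 2) ?p)) / ?y ^ ?p"
    by (rule divide_right_mono[OF expectation_urn_le[OF m A]]) (use y in auto)
  also have "\<dots> \<le> ((real n / (real m - 1)) ^ ?p * (((real m - 1) / ?k) ^ q * fact ?p)) / ?y ^ ?p"
  proof (rule divide_right_mono[OF mult_mono])
    show "((real n - 1) / (real m - 1)) ^ ?p \<le> (real n / (real m - 1)) ^ ?p"
      by (rule power_mono) (use n2 k0 in \<open>auto intro: divide_right_mono\<close>)
    have "expect (PA m) (\<lambda>T. 1 * pochhammer (real (urn m {k} m T) / 2) ?p) \<le>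
        expect (PA m) (\<lambda>T. pochhammer (real (vertex_degree T k)) ?p)"
      by (rule expectation_PA_mono[OF m(1)]) (auto simp: urn_def desc_base intro: pochhammer_mono)
    also have "\<dots> \<le> ((real m - 1) / ?k) ^ q * fact ?p"
      by (rule expectation_degree_le[OF k m(1)])
    finally show "expect (PA m) (\<lambda>T. 1 * pochhammer (real (urn m {k} m T) / 2) ?p) \<le>
        ((real m - 1) / ?k) ^ q * fact ?p" .
  qed (use y k0 in \<open>auto intro!: integral_nonneg_AE pochhammer_nonneg\<close>)
  also have "\<dots> \<le> ((real n / (real m - 1)) ^ ?p * (((real m - 1) / ?k) ^ q * (real ?p) ^ ?p)) / ?y ^ ?p"
    using fact_le_power[of ?p, where 'a = real] y k0
    by (intro divide_right_mono mult_left_mono) auto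
  also have "\<dots> = (16 * (real q)\<^sup>2 / (x\<^sup>2 * (real m - 1) * ?k)) ^ q"
  proof -
    have "(n' / M) ^ ?p * ((M / K) ^ q * (2 * Q) ^ ?p) / (x * n' / 2) ^ ?p = (16 * Q\<^sup>2 / (x\<^sup>2 * M * K)) ^ q"
      if "0 < n'" "0 < M" "0 < K" for n' M K Q :: real
    proof -
      have "(n' / M) ^ ?p * ((M / K) ^ q * (2 * Q) ^ ?p) / (x * n' / 2) ^ ?p =
          ((n' / M)\<^sup>2 * (M / K) * (2 * Q)\<^sup>2 / (x * n' / 2)\<^sup>2) ^ q"
        by (simp only: power_mult power_mult_distrib[symmetric] power_divide[symmetric] mult.assoc)
      also have "(n' / M)\<^sup>2 * (M / K) * (2 * Q)\<^sup>2 / (x * n' / 2)\<^sup>2 = 16 * Q\<^sup>2 / (x\<^sup>2 * M * K)"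
        using that x by (simp add: power2_eq_square field_simps)
      finally show ?thesis .
    qed
    from this[of "real n" "real m - 1" ?k "real q"] k0 n2 show ?thesis by simp
  qed
  finally show ?thesis .
qed

lemma sum_inverse_squares_le: "(\<Sum>i\<in>{1..N}. 1 / (real i)\<^sup>2) \<le> 2"
proof -
  have "(\<Sum>i\<in>{1..Suc N}. 1 / (real i)\<^sup>2) \<le> 2 - 1 / (real N + 1)" for N
  proof (induction N)
    case (Suc N)
    have "1 / (real N + 2)\<^sup>2 \<le> 1 / ((real N + 1) * (real N + 2))"
      by (rule divide_left_mono) (auto simp: power2_eq_square intro: mult_right_mono)
    also have "\<dots> = 1 / (real N + 1) - 1 / (real N + 2)" by (simp add: field_simps)
    finally have "1 / (real (Suc (Suc N)))\<^sup>2 \<le> 1 / (real N + 1) - 1 / (real (Suc N) + 1)"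
      by (simp add: add.commute)
    then show ?case using Suc by simp
  qed simp
  then have *: "(\<Sum>i\<in>{1..Suc N}. 1 / (real i)\<^sup>2) \<le> 2" for N
    by (rule order_trans) simp
  show ?thesis using *[of "N - 1"] by (cases N) auto
qed

text \<open>
  A union bound over the groups: \<open>q \<ge> 2\<close> makes the bounds summable in \<open>k\<close>, and \<open>big\<close> extracts
  the factor \<open>1 / 3\<close> from each of the \<open>q\<close> powers.
\<close>

lemma prob_some_large_branch:
  fixes x :: real
  assumes m: "2 \<le> m" "m \<le> n" and x: "0 < x" and q: "2 \<le> q"
    and big: "48 * (real q)\<^sup>2 \<le> x\<^sup>2 * (real m - 1)"
  shows "measure_pmf.prob (PA n) {T. \<exists>k\<in>{1..m}. x * real n \<le> card (desc m {k} n T)} \<le> 3 * (1 / 3) ^ q"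
proof -
  let ?B = "\<lambda>k. {T. x * real n \<le> card (desc m {k} n T)}"
  have one: "measure_pmf.prob (PA n) (?B k) \<le> (1 / 3) ^ q * (1 / (real (max k 2) - 1)\<^sup>2)"
    if k: "k \<in> {1..m}" for k
  proof -
    let ?k = "real (max k 2) - 1"
    have k1: "1 \<le> ?k" by simp
    have xm: "0 < x\<^sup>2 * (real m - 1)" using x m by simp
    have "measure_pmf.prob (PA n) (?B k) \<le> (16 * (real q)\<^sup>2 / (x\<^sup>2 * (real m - 1) * ?k)) ^ q"
      by (rule prob_large_branch[OF _ _ m x]) (use k in auto)
    also have "16 * (real q)\<^sup>2 / (x\<^sup>2 * (real m - 1) * ?k) = (16 * (real q)\<^sup>2 / (x\<^sup>2 * (real m - 1))) * (1 / ?k)"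
      by simp
    also have "((16 * (real q)\<^sup>2 / (x\<^sup>2 * (real m - 1))) * (1 / ?k)) ^ q \<le> (1 / 3 * (1 / ?k)) ^ q"
      by (intro power_mono mult_right_mono) (use big xm k1 in \<open>auto simp: divide_simps\<close>)
    also have "\<dots> = (1 / 3) ^ q * (1 / ?k) ^ q" by (rule power_mult_distrib)
    also have "\<dots> \<le> (1 / 3) ^ q * (1 / ?k) ^ 2"
      by (intro mult_left_mono power_decreasing) (use q k1 in auto)
    finally show ?thesis by (simp add: power_divide)
  qed
  have "measure_pmf.prob (PA n) {T. \<exists>k\<in>{1..m}. x * real n \<le> card (desc m {k} n T)} =
      measure_pmf.prob (PA n) (\<Union>k\<in>{1..m}. ?B k)"
    by (rule arg_cong[of _ _ "measure_pmf.prob (PA n)"]) auto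
  also have "\<dots> \<le> (\<Sum>k\<in>{1..m}. measure_pmf.prob (PA n) (?B k))"
    by (rule measure_pmf.finite_measure_subadditive_finite) auto
  also have "\<dots> \<le> (\<Sum>k\<in>{1..m}. (1 / 3) ^ q * (1 / (real (max k 2) - 1)\<^sup>2))"
    by (rule sum_mono[OF one])
  also have "\<dots> = (1 / 3) ^ q * (\<Sum>k\<in>{1..m}. 1 / (real (max k 2) - 1)\<^sup>2)"
    by (simp only: sum_distrib_left)
  also have "(\<Sum>k\<in>{1..m}. 1 / (real (max k 2) - 1)\<^sup>2) = 1 + (\<Sum>k\<in>{2..m}. 1 / (real (max k 2) - 1)\<^sup>2)"
    using m by (subst sum.atLeast_Suc_atMost) (auto simp: numeral_2_eq_2)
  also have "(\<Sum>k\<in>{2..m}. 1 / (real (max k 2) - 1)\<^sup>2) = (\<Sum>i\<in>{1..m - 1}. 1 / (real i)\<^sup>2)"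
    by (rule sum.reindex_bij_witness[of _ Suc "\<lambda>j. j - 1"]) (auto simp: of_nat_diff)
  also have "(1 / 3) ^ q * (1 + (\<Sum>i\<in>{1..m - 1}. 1 / (real i)\<^sup>2)) \<le> (1 / 3) ^ q * 3"
    by (rule mult_left_mono) (use sum_inverse_squares_le[of "m - 1"] in auto)
  finally show ?thesis by simp
qed

section \<open>The two sides of the first edge\<close>

text \<open>
  The number of vertices on the side of 1 when the edge between 1 and 2 is removed.
\<close>

abbreviation half_size :: "nat \<Rightarrow> nat set set \<Rightarrow> nat" where
  "half_size n T \<equiv> card (desc 2 {1} n T)"

lemma half_size_bounds:
  assumes T: "rtree n T"
  shows "1 \<le> half_size n T" "half_size n T < n"
proof -
  have A: "{1} \<subseteq> {1..2::nat}" "2 \<le> n" using rtree_ge_2[OF T] by auto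
  have i: "desc 2 {1} n T \<inter> {1..2} = {1}" by (rule desc_inter_base[OF T A(1) le_refl A(2)])
  then have "1 \<in> desc 2 {1} n T" by blast
  then have "half_size n T \<noteq> 0" using finite_desc[OF A] by (auto simp: card_eq_0_iff)
  then show "1 \<le> half_size n T" by simp
  have "2 \<notin> desc 2 {1} n T"
  proof
    assume "2 \<in> desc 2 {1} n T"
    then have "2 \<in> desc 2 {1} n T \<inter> {1..2}" by simp
    then show False unfolding i by simp
  qed
  moreover have "2 \<in> {1..n}" using A(2) by simp
  ultimately have "desc 2 {1} n T \<noteq> {1..n}" by metis
  with desc_subset[OF A] have "desc 2 {1} n T \<subset> {1..n}" by (rule psubsetI)
  from psubset_card_mono[OF finite_atLeastAtMost this] show "half_size n T < n" by simp
qed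

text \<open>
  The right-hand side is the distribution of a Polya urn that starts with one half-edge on each
  side and adds two at each step. It satisfies the recursion of the urn exactly, by the ratio of successive
  values of \<open>half_prod\<close>.
\<close>

lemma prob_half_size_le:
  assumes "2 \<le> n"
  shows "1 \<le> c \<Longrightarrow> c \<le> n - 1 \<Longrightarrow>
    measure_pmf.prob (PA n) {T. half_size n T = c} \<le> half_prod (c - 1) * half_prod (n - 1 - c)"
  using assms
proof (induction n arbitrary: c rule: dec_induct)
  case base
  then have "c = 1" by simp
  then show ?case by simp
next
  case (step n)
  let ?P = "\<lambda>n c. measure_pmf.prob (PA n) {T. half_size n T = c}"
  define s where "s = 2 * (real n - 1)"
  have s: "0 < s" using step by (simp add: s_def)
  have A: "{1} \<subseteq> {1..2::nat}" by simp
  have "?P (Suc n) c = expect (PA (Suc n)) (indicator {T. half_size (Suc n) T = c})"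
    by simp
  also have "\<dots> = expect (PA (Suc n))
      (\<lambda>T. of_bool (urn 2 {1} (Suc n) T + 1 = 2 * c))"
  proof (rule integral_cong_AE)
    have "indicator {T. half_size (Suc n) T = c} T = (of_bool (urn 2 {1} (Suc n) T + 1 = 2 * c) :: real)"
      if "rtree (Suc n) T" for T
      unfolding urn_root_half[OF that] by (simp add: indicator_def)
    moreover have "2 \<le> Suc n" using step(1) by simp
    ultimately show "AE T in measure_pmf (PA (Suc n)). indicator {T. half_size (Suc n) T = c} T =
        (of_bool (urn 2 {1} (Suc n) T + 1 = 2 * c) :: real)"
      unfolding AE_measure_pmf_iff set_pmf_PA[OF \<open>2 \<le> Suc n\<close>] by blast
  qed auto
  also have "\<dots> = expect (PA n) (\<lambda>T.
      (2 * (real c - 1) - 1) / s * indicator {T. half_size n T = c - 1} T +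
      (1 - (2 * real c - 1) / s) * indicator {T. half_size n T = c} T)"
    unfolding expectation_PA_Suc[OF step(1)]
  proof (rule integral_cong_AE)
    have "expect (attach_leaf n T) (\<lambda>T. of_bool (urn 2 {1} (Suc n) T + 1 = 2 * c)) =
      (2 * (real c - 1) - 1) / s * indicator {T. half_size n T = c - 1} T +
      (1 - (2 * real c - 1) / s) * indicator {T. half_size n T = c} T" if T: "rtree n T" for T
    proof -
      define h where "h = half_size n T"
      have u: "urn 2 {1} n T = 2 * h - 1" and h: "1 \<le> h"
        using urn_root_half[OF T] half_size_bounds[OF T] by (auto simp: h_def)
      have "expect (attach_leaf n T) (\<lambda>T. of_bool (urn 2 {1} (Suc n) T + 1 = 2 * c)) =
          (2 * real h - 1) / s * of_bool (Suc h = c) + (1 - (2 * real h - 1) / s) * of_bool (h = c)"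
        unfolding expectation_attach_leaf_urn[OF T A step(1), of "\<lambda>w. of_bool (w + 1 = 2 * c)"]
        unfolding u s_def[symmetric] using h by (auto simp: of_nat_diff of_bool_def)
      also have "\<dots> = (2 * (real c - 1) - 1) / s * of_bool (h = c - 1) + (1 - (2 * real c - 1) / s) * of_bool (h = c)"
        using step(4) by (cases c) auto
      finally show ?thesis by (simp add: indicator_def h_def)
    qed
    then show "AE T in measure_pmf (PA n). expect (attach_leaf n T)
        (\<lambda>T. of_bool (urn 2 {1} (Suc n) T + 1 = 2 * c)) =
      (2 * (real c - 1) - 1) / s * indicator {T. half_size n T = c - 1} T +
      (1 - (2 * real c - 1) / s) * indicator {T. half_size n T = c} T"
      using step by (auto simp: AE_measure_pmf_iff set_pmf_PA)
  qed auto
  also have "\<dots> = (2 * (real c - 1) - 1) / s * ?P n (c - 1) + (1 - (2 * real c - 1) / s) * ?P n c"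
    by (simp add: integrable_PA[OF step(1)])
  finally have rec: "?P (Suc n) c =
      (2 * (real c - 1) - 1) / s * ?P n (c - 1) + (1 - (2 * real c - 1) / s) * ?P n c" .
  have zero: "?P n c = 0" if "c = 0 \<or> c = n" for c
  proof -
    have "\<not> half_size n T = c" if "rtree n T" for T
      using half_size_bounds[OF that] \<open>c = 0 \<or> c = n\<close> by auto
    then show ?thesis using step(1) by (auto simp: measure_pmf_zero_iff set_pmf_PA)
  qed
  have first: "(2 * (real c - 1) - 1) / s * ?P n (c - 1) \<le>
      2 * (real c - 1) / s * (half_prod (c - 1) * half_prod (n - c))"
  proof (cases "c = 1")
    case True
    then show ?thesis using zero[of 0] by simp
  next
    case False
    define d where "d = c - 2"
    have c: "c = Suc (Suc d)" using False step(4) by (simp add: d_def)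
    have hp: "(2 * (real c - 1) - 1) * half_prod d = 2 * (real c - 1) * half_prod (Suc d)"
      unfolding half_prod_Suc c by (simp add: field_simps)
    have "?P n (c - 1) \<le> half_prod d * half_prod (n - c)"
      using step(3)[of "c - 1"] step(1,4,5) c by simp
    then have "(2 * (real c - 1) - 1) / s * ?P n (c - 1) \<le>
        (2 * (real c - 1) - 1) / s * (half_prod d * half_prod (n - c))"
      using s c by (intro mult_left_mono) auto
    also have "\<dots> = ((2 * (real c - 1) - 1) * half_prod d) * half_prod (n - c) / s" by simp
    also have "\<dots> = 2 * (real c - 1) / s * (half_prod (c - 1) * half_prod (n - c))"
      unfolding hp by (simp add: c)
    finally show ?thesis .
  qed
  have second: "(1 - (2 * real c - 1) / s) * ?P n c \<le>
      2 * (real n - real c) / s * (half_prod (c - 1) * half_prod (n - c))"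
  proof (cases "c = n")
    case True
    then show ?thesis using zero[of n] by simp
  next
    case False
    then have "c < n" using step(5) by simp
    define d where "d = n - c - 1"
    have d: "n - c = Suc d" "n = c + Suc d" using \<open>c < n\<close> by (auto simp: d_def)
    have hp: "(2 * (real n - real c) - 1) * half_prod d = 2 * (real n - real c) * half_prod (Suc d)"
      unfolding half_prod_Suc d(2) by (simp add: field_simps)
    have eq: "1 - (2 * real c - 1) / s = (2 * (real n - real c) - 1) / s"
      using s by (simp add: s_def field_simps)
    have "n - 1 - c = d" using d by simp
    then have "?P n c \<le> half_prod (c - 1) * half_prod d"
      using step(3)[of c] step(1,4) \<open>c < n\<close> by simp
    then have "(1 - (2 * real c - 1) / s) * ?P n c \<le>
        (2 * (real n - real c) - 1) / s * (half_prod (c - 1) * half_prod d)"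
      unfolding eq using s d by (intro mult_left_mono) auto
    also have "\<dots> = half_prod (c - 1) * ((2 * (real n - real c) - 1) * half_prod d) / s" by simp
    also have "\<dots> = 2 * (real n - real c) / s * (half_prod (c - 1) * half_prod (n - c))"
      unfolding hp by (simp add: d(1))
    finally show ?thesis .
  qed
  have "?P (Suc n) c \<le> (2 * (real c - 1) / s + 2 * (real n - real c) / s) * (half_prod (c - 1) * half_prod (n - c))"
    unfolding rec distrib_right using first second by (rule add_mono)
  also have "2 * (real c - 1) / s + 2 * (real n - real c) / s = 1"
  proof -
    have "2 * (real c - 1) + 2 * (real n - real c) = s" by (simp add: s_def)
    then show ?thesis using s by (simp only: add_divide_distrib[symmetric]) simp
  qed
  finally show ?case by simp
qed

lemma sum_inverse_sqrt_le: "(\<Sum>c\<in>{1..M}. 1 / sqrt (real c)) \<le> 2 * sqrt (real M)"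
proof (induction M)
  case (Suc M)
  define a where "a = sqrt (real M)"
  define b where "b = sqrt (real M + 1)"
  have ab: "0 \<le> a" "0 < b" "a\<^sup>2 = real M" "b\<^sup>2 = real M + 1" by (auto simp: a_def b_def)
  have "0 \<le> (b - a)\<^sup>2" by simp
  then have "1 \<le> 2 * (b - a) * b" using ab(3,4) by (simp add: power2_eq_square algebra_simps)
  then have "1 / b \<le> 2 * b - 2 * a" using ab(2) by (simp add: divide_simps algebra_simps)
  then show ?case using Suc by (simp add: a_def b_def add.commute)
qed simp

text \<open>
  A side of size \<open>c < x * n\<close> has probability at most \<open>sqrt (2 / (c * n))\<close>, and these values sum to
  \<open>O(sqrt x)\<close>. Large sides are complements of small ones, and the bound is symmetric.
\<close>

lemma prob_unbalanced_halves:
  fixes x :: real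
  assumes n: "2 \<le> n" and x: "0 < x" "x \<le> 1 / 2"
  shows "measure_pmf.prob (PA n) {T. half_size n T < x * real n \<or> (1 - x) * real n < half_size n T} \<le> 6 * sqrt x"
proof -
  let ?P = "\<lambda>c. measure_pmf.prob (PA n) {T. half_size n T = c}"
  define C where "C = {c \<in> {1..n - 1}. real c < x * real n}"
  have fin: "finite C" by (simp add: C_def)
  have bound: "half_prod (c - 1) * half_prod (n - 1 - c) \<le> 1 / sqrt (real c) * sqrt (2 / real n)"
    if "c \<in> C" for c
  proof (rule mult_mono)
    from that have c: "1 \<le> c" "c \<le> n - 1" "real c < x * real n" by (auto simp: C_def)
    show "half_prod (c - 1) \<le> 1 / sqrt (real c)"
      using half_prod_le[of "c - 1"] c by (simp add: of_nat_diff)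
    have "x * real n \<le> 1 / 2 * real n" by (rule mult_right_mono) (use x in auto)
    then have "real c \<le> real n / 2" using c(3) by linarith
    then have "real n / 2 \<le> real (n - c)" using c n by (simp add: of_nat_diff)
    then have "1 / sqrt (real (n - c)) \<le> 1 / sqrt (real n / 2)"
      using n by (intro divide_left_mono) auto
    moreover have "real (n - 1 - c) + 1 = real (n - c)" using c n by (simp add: of_nat_diff)
    ultimately show "half_prod (n - 1 - c) \<le> sqrt (2 / real n)"
      using half_prod_le[of "n - 1 - c"] by (simp add: real_sqrt_divide)
  qed (use half_prod_pos in \<open>auto intro: less_imp_le\<close>)
  have sum: "(\<Sum>c\<in>C. half_prod (c - 1) * half_prod (n - 1 - c)) \<le> 3 * sqrt x"
  proof -
    define M where "M = nat \<lfloor>x * real n\<rfloor>"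
    have M: "real M \<le> x * real n" using x by (simp add: M_def)
    have "C \<subseteq> {1..M}"
    proof
      fix c assume "c \<in> C"
      then have "1 \<le> c" "real c < x * real n" by (auto simp: C_def)
      then show "c \<in> {1..M}" by (simp add: M_def le_nat_iff le_floor_iff)
    qed
    have "(\<Sum>c\<in>C. half_prod (c - 1) * half_prod (n - 1 - c)) \<le> (\<Sum>c\<in>C. 1 / sqrt (real c) * sqrt (2 / real n))"
      by (rule sum_mono[OF bound])
    also have "\<dots> = (\<Sum>c\<in>C. 1 / sqrt (real c)) * sqrt (2 / real n)" by (simp only: sum_distrib_right)
    also have "\<dots> \<le> (\<Sum>c\<in>{1..M}. 1 / sqrt (real c)) * sqrt (2 / real n)"
      by (intro mult_right_mono sum_mono2) (use \<open>C \<subseteq> {1..M}\<close> in auto)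
    also have "\<dots> \<le> (2 * sqrt (x * real n)) * sqrt (2 / real n)"
      using sum_inverse_sqrt_le[of M] real_sqrt_le_mono[OF M] by (intro mult_right_mono) (linarith, simp)
    also have "\<dots> = sqrt 8 * sqrt x"
    proof -
      have "sqrt (x * real n) * sqrt (2 / real n) = sqrt (2 * x)"
        using n by (simp add: real_sqrt_mult[symmetric] mult_ac)
      moreover have "2 * sqrt (2 * x) = sqrt 8 * sqrt x"
      proof -
        have "sqrt 8 = sqrt (4 * 2)" by simp
        then have "sqrt 8 = 2 * sqrt 2" unfolding real_sqrt_mult by simp
        then show ?thesis by (simp add: real_sqrt_mult)
      qed
      ultimately show ?thesis by simp
    qed
    also have "\<dots> \<le> 3 * sqrt x"
      by (rule mult_right_mono) (use x real_sqrt_le_mono[of 8 9] in auto)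
    finally show ?thesis .
  qed
  have "measure_pmf.prob (PA n) {T. half_size n T < x * real n \<or> (1 - x) * real n < half_size n T} =
      measure_pmf.prob (PA n) ({T. half_size n T < x * real n \<or> (1 - x) * real n < half_size n T} \<inter> set_pmf (PA n))"
    by (rule measure_Int_set_pmf[symmetric])
  also have "\<dots> \<le> measure_pmf.prob (PA n) ((\<Union>c\<in>C. {T. half_size n T = c}) \<union> (\<Union>c\<in>C. {T. half_size n T = n - c}))"
  proof (rule measure_pmf.finite_measure_mono)
    show "{T. half_size n T < x * real n \<or> (1 - x) * real n < half_size n T} \<inter> set_pmf (PA n) \<subseteq>
       (\<Union>c\<in>C. {T. half_size n T = c}) \<union> (\<Union>c\<in>C. {T. half_size n T = n - c})"
    proof
      fix T assume "T \<in> {T. half_size n T < x * real n \<or> (1 - x) * real n < half_size n T} \<inter> set_pmf (PA n)"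
      then have T: "rtree n T" and h: "half_size n T < x * real n \<or> (1 - x) * real n < half_size n T"
        using set_pmf_PA[OF n] by auto
      note b = half_size_bounds[OF T]
      from h show "T \<in> (\<Union>c\<in>C. {T. half_size n T = c}) \<union> (\<Union>c\<in>C. {T. half_size n T = n - c})"
      proof
        assume "half_size n T < x * real n"
        then have "half_size n T \<in> C" using b by (auto simp: C_def)
        then show ?thesis by blast
      next
        assume "(1 - x) * real n < half_size n T"
        then have "real (n - half_size n T) < x * real n" using b by (simp add: of_nat_diff algebra_simps)
        then have "n - half_size n T \<in> C" using b by (auto simp: C_def)
        moreover have "half_size n T = n - (n - half_size n T)" using b by simp
        ultimately show ?thesis by blast
      qed
    qed
  qed simp
  also have "\<dots> \<le> measure_pmf.prob (PA n) (\<Union>c\<in>C. {T. half_size n T = c}) +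
      measure_pmf.prob (PA n) (\<Union>c\<in>C. {T. half_size n T = n - c})"
    by (rule measure_Un_le) auto
  also have "\<dots> \<le> (\<Sum>c\<in>C. ?P c) + (\<Sum>c\<in>C. ?P (n - c))"
    by (intro add_mono measure_pmf.finite_measure_subadditive_finite) (auto simp: fin)
  also have "\<dots> \<le> (\<Sum>c\<in>C. half_prod (c - 1) * half_prod (n - 1 - c)) +
      (\<Sum>c\<in>C. half_prod (c - 1) * half_prod (n - 1 - c))"
  proof (intro add_mono sum_mono)
    fix c assume "c \<in> C"
    then have c: "1 \<le> c" "c \<le> n - 1" by (auto simp: C_def)
    show "?P c \<le> half_prod (c - 1) * half_prod (n - 1 - c)"
      by (rule prob_half_size_le[OF n c])
    have "n - 1 - (n - c) = c - 1" "n - c - 1 = n - 1 - c" using c n by auto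
    then show "?P (n - c) \<le> half_prod (c - 1) * half_prod (n - 1 - c)"
      using prob_half_size_le[OF n, of "n - c"] c n by (simp add: mult.commute)
  qed
  also have "\<dots> \<le> 3 * sqrt x + 3 * sqrt x" by (rule add_mono[OF sum sum])
  finally show ?thesis by simp
qed

definition beats :: "(nat \<Rightarrow> nat) \<Rightarrow> nat \<Rightarrow> nat \<Rightarrow> bool" where
  "beats f u v \<longleftrightarrow> f u < f v \<or> f u = f v \<and> u < v"

definition lowest :: "nat \<Rightarrow> nat \<Rightarrow> nat set set \<Rightarrow> nat set" where
  "lowest K n T = {v \<in> {1..n}. card {u \<in> {1..n}. beats (score n T) u v} < K}"

section \<open>The selected vertices\<close>

text \<open>
  Ties are broken by the label, so the ranks of the vertices are \<open>0, \<dots>, n - 1\<close>, each taken once.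
\<close>

lemma card_lowest:
  assumes "K \<le> n"
  shows "card (lowest K n T) = K"
proof -
  define f where "f = score n T"
  define rank where "rank v = card {u \<in> {1..n}. beats f u v}" for v
  have mono: "rank u < rank v" if "beats f u v" "u \<in> {1..n}" for u v
    unfolding rank_def
  proof (rule psubset_card_mono)
    have "{w \<in> {1..n}. beats f w u} \<subseteq> {w \<in> {1..n}. beats f w v}"
      using that(1) by (auto simp: beats_def)
    moreover have "u \<in> {w \<in> {1..n}. beats f w v}" "u \<notin> {w \<in> {1..n}. beats f w u}"
      using that by (auto simp: beats_def)
    ultimately show "{w \<in> {1..n}. beats f w u} \<subset> {w \<in> {1..n}. beats f w v}" by blast
  qed simp
  have inj: "inj_on rank {1..n}"
  proof (rule inj_onI)
    fix u v assume uv: "u \<in> {1..n}" "v \<in> {1..n}" "rank u = rank v"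
    have "beats f u v \<or> beats f v u" if "u \<noteq> v" using that by (auto simp: beats_def)
    then show "u = v" using mono[of u v] mono[of v u] uv by fastforce
  qed
  have sub: "rank ` {1..n} \<subseteq> {..<n}"
  proof
    fix r assume "r \<in> rank ` {1..n}"
    then obtain v where v: "v \<in> {1..n}" "r = rank v" by blast
    have "{u \<in> {1..n}. beats f u v} \<subseteq> {1..n} - {v}" by (auto simp: beats_def)
    then have "rank v \<le> card ({1..n} - {v})" unfolding rank_def by (rule card_mono[rotated]) simp
    also have "\<dots> < n" using v by simp
    finally show "r \<in> {..<n}" using v by simp
  qed
  have img: "rank ` {1..n} = {..<n}"
    by (rule card_subset_eq[OF _ sub]) (use card_image[OF inj] in simp_all)
  have low: "lowest K n T = {v \<in> {1..n}. rank v < K}" by (simp add: lowest_def rank_def f_def)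
  have "rank ` lowest K n T = {..<K}"
  proof
    show "{..<K} \<subseteq> rank ` lowest K n T"
    proof
      fix r assume "r \<in> {..<K}"
      then have "r \<in> rank ` {1..n}" "r < K" unfolding img using assms by auto
      then show "r \<in> rank ` lowest K n T" unfolding low by blast
    qed
  qed (auto simp: low)
  moreover have "inj_on rank (lowest K n T)" by (rule inj_on_subset[OF inj]) (auto simp: low)
  ultimately show ?thesis by (metis card_image card_lessThan)
qed

text \<open>
  Although ties are broken by labels, the score itself does not depend on them; this is all that the
  analysis uses, because it compares the root with strictly worse vertices.
\<close>

lemma score_relabel:
  assumes p: "\<sigma> permutes {1..n}"
  shows "score n (relabel \<sigma> T) (\<sigma> v) = score n T v"
proof -
  have inj: "inj \<sigma>" and surj: "surj \<sigma>" using p by (auto simp: permutes_inj permutes_surj)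
  have step: "(\<sigma> x, \<sigma> y) \<in> avoid (relabel \<sigma> T) (\<sigma> v) \<longleftrightarrow> (x, y) \<in> avoid T v" for x y
    by (simp add: avoid_def relabel_edge[OF inj] inj_eq[OF inj])
  have R: "(avoid (relabel \<sigma> T) (\<sigma> v))\<^sup>* `` {\<sigma> u} = \<sigma> ` ((avoid T v)\<^sup>* `` {u})" for u
  proof
    show "(avoid (relabel \<sigma> T) (\<sigma> v))\<^sup>* `` {\<sigma> u} \<subseteq> \<sigma> ` ((avoid T v)\<^sup>* `` {u})"
    proof (rule rtrancl_Image_least)
      show "avoid (relabel \<sigma> T) (\<sigma> v) `` (\<sigma> ` ((avoid T v)\<^sup>* `` {u})) \<subseteq> \<sigma> ` ((avoid T v)\<^sup>* `` {u})"
      proof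
        fix z assume "z \<in> avoid (relabel \<sigma> T) (\<sigma> v) `` (\<sigma> ` ((avoid T v)\<^sup>* `` {u}))"
        then obtain x where x: "(u, x) \<in> (avoid T v)\<^sup>*" "(\<sigma> x, z) \<in> avoid (relabel \<sigma> T) (\<sigma> v)" by blast
        obtain y where y: "z = \<sigma> y" using surj by (metis surjD)
        with x have "(u, y) \<in> (avoid T v)\<^sup>*" using step by (blast intro: rtrancl.rtrancl_into_rtrancl)
        then show "z \<in> \<sigma> ` ((avoid T v)\<^sup>* `` {u})" using y by blast
      qed
    qed auto
    have "(\<sigma> u, \<sigma> y) \<in> (avoid (relabel \<sigma> T) (\<sigma> v))\<^sup>*" if "(u, y) \<in> (avoid T v)\<^sup>*" for y
      using that by induction (auto simp: step intro: rtrancl.rtrancl_into_rtrancl)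
    then show "\<sigma> ` ((avoid T v)\<^sup>* `` {u}) \<subseteq> (avoid (relabel \<sigma> T) (\<sigma> v))\<^sup>* `` {\<sigma> u}" by blast
  qed
  have "score n (relabel \<sigma> T) (\<sigma> v) = (\<Sum>u\<in>{1..n}. card ((avoid (relabel \<sigma> T) (\<sigma> v))\<^sup>* `` {\<sigma> u}))"
    unfolding score_def using sum.permute[OF p, of "\<lambda>u. card ((avoid (relabel \<sigma> T) (\<sigma> v))\<^sup>* `` {u})"]
    by (simp add: o_def)
  also have "\<dots> = score n T v"
    unfolding score_def R using inj by (simp add: card_image inj_on_subset)
  finally show ?thesis .
qed

text \<open>
  A condition on the labeled tree that forces the root into the output, whatever the relabeling.
\<close>

definition root_wins :: "nat \<Rightarrow> nat \<Rightarrow> nat set set \<Rightarrow> bool" where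
  "root_wins K n T \<longleftrightarrow> (\<forall>i\<in>{1..n}. K < i \<longrightarrow> score n T 1 < score n T i)"

text \<open>
  Only the vertices \<open>2, \<dots>, K\<close> can be ranked before the root.
\<close>

lemma root_in_lowest:
  assumes w: "root_wins K n T" and p: "\<sigma> permutes {1..n}" and K: "0 < K" "1 \<le> n"
  shows "\<sigma> 1 \<in> lowest K n (relabel \<sigma> T)"
proof -
  let ?f = "score n (relabel \<sigma> T)"
  have "{u \<in> {1..n}. beats ?f u (\<sigma> 1)} \<subseteq> \<sigma> ` {2..K}"
  proof
    fix u assume u: "u \<in> {u \<in> {1..n}. beats ?f u (\<sigma> 1)}"
    then obtain i where i: "i \<in> {1..n}" "u = \<sigma> i"
      using permutes_image[OF p] by (metis (no_types, lifting) image_iff mem_Collect_eq)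
    have le: "score n T i \<le> score n T 1" "i \<noteq> 1"
      using u i by (auto simp: beats_def score_relabel[OF p])
    then have "\<not> K < i" using w i unfolding root_wins_def by (meson not_le)
    then have "i \<in> {2..K}" using i(1) le(2) by auto
    then show "u \<in> \<sigma> ` {2..K}" using i(2) by blast
  qed
  then have "card {u \<in> {1..n}. beats ?f u (\<sigma> 1)} \<le> card (\<sigma> ` {2..K})"
    by (rule card_mono[rotated]) simp
  also have "\<dots> \<le> card {2..K}" by (rule card_image_le) simp
  also have "\<dots> < K" using K by simp
  finally show ?thesis
    using permutes_in_image[OF p, of 1] K by (simp add: lowest_def)
qed

lemma root_found_prob_lowest_ge:
  assumes "2 \<le> n" "0 < K"
  shows "measure_pmf.prob (PA n) {T. root_wins K n T} \<le> root_found_prob (lowest K) n"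
proof -
  let ?U = "pmf_of_set {\<sigma>. \<sigma> permutes {1..n}}"
  let ?q = "pair_pmf (PA n) ?U"
  have perms: "finite {\<sigma>. \<sigma> permutes {1..n}}" "{\<sigma>. \<sigma> permutes {1..n}} \<noteq> {}"
    using permutes_id[of "{1..n}"] by (simp add: finite_permutations, blast)
  have "measure_pmf.prob (PA n) {T. root_wins K n T} = measure_pmf.prob (map_pmf fst ?q) {T. root_wins K n T}"
    by (simp only: map_fst_pair_pmf)
  also have "\<dots> = measure_pmf.prob ?q ((fst -` {T. root_wins K n T}) \<inter> set_pmf ?q)"
    by (subst measure_Int_set_pmf) simp
  also have "\<dots> \<le> measure_pmf.prob ?q {(T, \<sigma>). \<sigma> 1 \<in> lowest K n (relabel \<sigma> T)}"
  proof (rule measure_pmf.finite_measure_mono)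
    show "(fst -` {T. root_wins K n T}) \<inter> set_pmf ?q \<subseteq> {(T, \<sigma>). \<sigma> 1 \<in> lowest K n (relabel \<sigma> T)}"
      using perms root_in_lowest[of K n] assms by auto
  qed simp
  finally show ?thesis unfolding root_found_prob_def .
qed

lemma root_finding_procedure_lowest:
  assumes "0 < K" and ev: "\<forall>\<^sub>F n in sequentially. 1 - \<epsilon> \<le> measure_pmf.prob (PA n) {T. root_wins K n T}"
  shows "root_finding_procedure (lowest K) K \<epsilon>"
  unfolding root_finding_procedure_def
proof (intro conjI allI impI)
  fix n T assume "labeled_tree n T \<and> K \<le> n"
  then show "card (lowest K n T) = K" by (simp add: card_lowest)
next
  have "\<forall>\<^sub>F n in sequentially. ereal (1 - \<epsilon>) \<le> ereal (root_found_prob (lowest K) n)"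
    using ev eventually_ge_at_top[of 2]
  proof eventually_elim
    case (elim n)
    then show ?case using root_found_prob_lowest_ge[of n K] assms(1) by simp
  qed
  then show "ereal (1 - \<epsilon>) \<le> liminf (\<lambda>n. ereal (root_found_prob (lowest K) n))"
    by (rule Liminf_bounded)
qed (auto simp: lowest_def)

section \<open>The root among many selected vertices\<close>

text \<open>
  The root has score at most \<open>n + (1 - 3 * y) * n\<^sup>2\<close>, and a vertex later than \<open>m\<close> has score greater than
  \<open>(1 - y)\<^sup>2 * n\<^sup>2\<close>, which is larger by more than the positive number \<open>y * n\<^sup>2 - n\<close>.
\<close>

lemma root_wins_if_balanced:
  fixes y :: real
  assumes T: "rtree n T" and m: "2 \<le> m" "m \<le> n" and y: "0 < y" "y \<le> 1 / 3" "1 < y * real n"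
    and half: "3 * y * real n \<le> half_size n T" "half_size n T \<le> (1 - 3 * y) * real n"
    and branch: "\<And>k. k \<in> {1..m} \<Longrightarrow> card (desc m {k} n T) < y * real n"
  shows "root_wins m n T"
  unfolding root_wins_def
proof (intro ballI impI)
  fix i assume i: "i \<in> {1..n}" "m < i"
  have n2: "2 \<le> n" using m by simp
  define b where "b = max (half_size n T) (n - half_size n T)"
  have hn: "half_size n T < n" by (rule half_size_bounds[OF T])
  have b: "real b \<le> (1 - 3 * y) * real n"
    using half hn by (simp add: b_def max_def of_nat_diff algebra_simps)
  have "score n T 1 \<le> n + n * b"
  proof (rule score_root_le[OF T le_refl n2, of "{{1}, {2}}"])
    show "\<Union>{{1}, {2}} = {1..2::nat}" by auto
    have "{1..2} - {1} = {2::nat}" by auto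
    then have "desc 2 {2} n T = {1..n} - desc 2 {1} n T"
      using desc_compl[OF T _ le_refl n2, of "{1}"] by simp
    moreover have "desc 2 {1} n T \<subseteq> {1..n}" by (rule desc_subset[OF _ n2]) simp
    ultimately have "card (desc 2 {2} n T) = n - half_size n T"
      by (simp add: card_Diff_subset finite_subset)
    then show "card (desc 2 A n T) \<le> b" if "A \<in> {{1}, {2}}" for A
      using that by (auto simp: b_def)
  qed auto
  then have "real (score n T 1) \<le> real n + real n * real b" by (metis of_nat_le_iff of_nat_add of_nat_mult)
  also have "\<dots> \<le> real n + real n * ((1 - 3 * y) * real n)"
    by (intro add_left_mono mult_left_mono b) simp
  also have "\<dots> < ((1 - y) * real n)\<^sup>2"
  proof -
    have "real n < y * real n * real n" using y n2 by simp
    moreover have "((1 - y) * real n)\<^sup>2 = real n * ((1 - 3 * y) * real n) + y * real n * real n + (y * real n)\<^sup>2"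
      by (simp add: power2_eq_square algebra_simps)
    ultimately show ?thesis using zero_le_power2[of "y * real n"] by linarith
  qed
  also have "\<dots> \<le> real (score n T i)"
  proof -
    have "\<Union>((\<lambda>k. {k}) ` {1..m}) = {1..m}" by auto
    from desc_cover[OF T this m i(1)] obtain k where k: "k \<in> {1..m}" "i \<in> desc m {k} n T" by auto
    have "(n - card (desc m {k} n T))\<^sup>2 \<le> score n T i"
    proof (rule score_ge_compl[OF T m _ k(2), of "{1..m}"])
      fix x assume "x \<in> {1..m}" "x \<noteq> 1"
      then show "\<exists>y\<in>{1..m}. y < x \<and> {x, y} \<in> T"
        using rtree_parent_exists[OF T, of x] m by fastforce
    qed (use k i m in auto)
    then have "(real (n - card (desc m {k} n T)))\<^sup>2 \<le> real (score n T i)"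
      by (simp only: of_nat_power[symmetric] of_nat_le_iff)
    moreover have "((1 - y) * real n)\<^sup>2 \<le> (real (n - card (desc m {k} n T)))\<^sup>2"
    proof (rule power_mono)
      have "y * real n \<le> real n" using y by (simp add: mult_left_le_one_le)
      then show "(1 - y) * real n \<le> real (n - card (desc m {k} n T))"
        using branch[OF k(1)] by (simp add: of_nat_diff algebra_simps)
    qed (use y in auto)
    ultimately show ?thesis by (rule order_trans[rotated])
  qed
  finally show "score n T 1 < score n T i" by simp
qed

lemma prob_root_wins:
  fixes \<epsilon> :: real
  assumes m: "2 \<le> m" and e: "0 < \<epsilon>" "\<epsilon> < 1" and q: "2 \<le> q" "(1 / 3) ^ q \<le> \<epsilon> / 6"
    and big: "48 * (real q)\<^sup>2 \<le> (\<epsilon>\<^sup>2 / 432)\<^sup>2 * (real m - 1)"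
  shows "\<forall>\<^sub>F n in sequentially. 1 - \<epsilon> \<le> measure_pmf.prob (PA n) {T. root_wins m n T}"
proof -
  \<comment> \<open>With this choice unbalanced halves, of probability at most \<open>6 * sqrt (3 * y)\<close>, cost \<open>\<epsilon> / 2\<close>.\<close>
  define y where "y = \<epsilon>\<^sup>2 / 432"
  have e2: "\<epsilon>\<^sup>2 < 1" using e by (simp add: power_less_one_iff)
  have y: "0 < y" "y \<le> 1 / 6" "sqrt (3 * y) = \<epsilon> / 12"
    using e e2 by (auto simp: y_def real_sqrt_divide)
  have "\<forall>\<^sub>F n in sequentially. 1 / y < real n"
    using filterlim_real_sequentially by (simp add: filterlim_at_top_dense)
  then show ?thesis using eventually_ge_at_top[of m]
  proof eventually_elim
    case (elim n)
    have n2: "2 \<le> n" using m elim by simp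
    have yn: "1 < y * real n" using elim(1) y by (simp add: field_simps)
    let ?A = "{T. half_size n T < (3 * y) * real n \<or> (1 - 3 * y) * real n < half_size n T}"
    let ?B = "{T. \<exists>k\<in>{1..m}. y * real n \<le> card (desc m {k} n T)}"
    have A: "measure_pmf.prob (PA n) ?A \<le> \<epsilon> / 2"
      using prob_unbalanced_halves[OF n2, of "3 * y"] y by simp
    have B: "measure_pmf.prob (PA n) ?B \<le> \<epsilon> / 2"
      using prob_some_large_branch[OF m elim(2) y(1) q(1) big[folded y_def]] q(2) by simp
    have "1 - measure_pmf.prob (PA n) {T. root_wins m n T} = measure_pmf.prob (PA n) (- {T. root_wins m n T})"
      using measure_pmf.prob_compl[of "{T. root_wins m n T}" "PA n"] by (simp add: Compl_eq_Diff_UNIV)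
    also have "\<dots> = measure_pmf.prob (PA n) (- {T. root_wins m n T} \<inter> set_pmf (PA n))"
      by (rule measure_Int_set_pmf[symmetric])
    also have "\<dots> \<le> measure_pmf.prob (PA n) (?A \<union> ?B)"
    proof (rule measure_pmf.finite_measure_mono)
      show "- {T. root_wins m n T} \<inter> set_pmf (PA n) \<subseteq> ?A \<union> ?B"
      proof (rule subsetI, rule ccontr)
        fix T assume T: "T \<in> - {T. root_wins m n T} \<inter> set_pmf (PA n)" and not: "T \<notin> ?A \<union> ?B"
        have "root_wins m n T"
          by (rule root_wins_if_balanced[OF _ m elim(2) y(1) _ yn])
             (use T not y set_pmf_PA[OF n2] in \<open>auto simp: not_less not_le\<close>)
        with T show False by simp
      qed
    qed simp
    also have "\<dots> \<le> measure_pmf.prob (PA n) ?A + measure_pmf.prob (PA n) ?B"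
      by (rule measure_Un_le) auto
    finally show ?case using A B by simp
  qed
qed

section \<open>The root as the only selected vertex\<close>

text \<open>
  Every choice of smaller parents is a possible outcome of the attachment process.
\<close>

lemma rtree_of_parents:
  assumes "2 \<le> n" "\<And>j. j \<in> {2..n} \<Longrightarrow> par j \<in> {1..<j}"
  shows "rtree n ((\<lambda>j. {par j, j}) ` {2..n})"
  using assms
proof (induction n rule: dec_induct)
  case base
  then have "par 2 = 1" by fastforce
  then show ?case using rtree.edge by simp
next
  case (step n)
  have "{2..Suc n} = insert (Suc n) {2..n}" using step(1) by auto
  moreover have "par (Suc n) \<in> {1..n}" using step(4)[of "Suc n"] step(1) by auto
  ultimately show ?case using rtree.leaf[OF step(3)] step(4) by simp
qed

text \<open>
  The root with \<open>k\<close> legs of length two, where \<open>j\<close> and \<open>j + k\<close> form a leg for \<open>2 \<le> j \<le> k + 1\<close>. The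
  root carries only a quarter of the total degree and each leg a negligible part of it. Hence after
  this start the group of the root and all groups of legs stay below a third of the tree with
  probability bounded away from 0. A star would not do: its centre carries half of the total degree.
\<close>

definition spider :: "nat \<Rightarrow> nat set set" where
  "spider k = (\<lambda>j. {if j \<le> k + 1 then 1 else j - k, j}) ` {2..2 * k + 1}"

lemma spider_edges: "e \<in> spider k \<longleftrightarrow> (\<exists>j\<in>{2..k + 1}. e = {1, j} \<or> e = {j, j + k})"
proof
  assume "e \<in> spider k"
  then obtain j where j: "j \<in> {2..2 * k + 1}" "e = {if j \<le> k + 1 then 1 else j - k, j}"
    by (auto simp: spider_def)
  show "\<exists>j\<in>{2..k + 1}. e = {1, j} \<or> e = {j, j + k}"
  proof (cases "j \<le> k + 1")
    case True
    with j show ?thesis by (intro bexI[of _ j]) auto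
  next
    case False
    with j show ?thesis by (intro bexI[of _ "j - k"]) auto
  qed
next
  assume "\<exists>j\<in>{2..k + 1}. e = {1, j} \<or> e = {j, j + k}"
  then obtain j where j: "j \<in> {2..k + 1}" "e = {1, j} \<or> e = {j, j + k}" by blast
  from j(2) show "e \<in> spider k"
  proof
    assume "e = {1, j}"
    then show ?thesis unfolding spider_def using j(1) by (intro image_eqI[of _ _ j]) auto
  next
    assume "e = {j, j + k}"
    then show ?thesis unfolding spider_def using j(1) by (intro image_eqI[of _ _ "j + k"]) auto
  qed
qed

lemma rtree_spider: "0 < k \<Longrightarrow> rtree (2 * k + 1) (spider k)"
  unfolding spider_def by (rule rtree_of_parents) auto

lemma spider_degrees:
  assumes j: "j \<in> {2..k + 1}"
  shows "vertex_degree (spider k) 1 \<le> k" "vertex_degree (spider k) j \<le> 2"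
    "vertex_degree (spider k) (j + k) \<le> 1"
proof -
  have "{e \<in> spider k. 1 \<in> e} \<subseteq> (\<lambda>j. {1, j}) ` {2..k + 1}" by (auto simp: spider_edges)
  then have "vertex_degree (spider k) 1 \<le> card ((\<lambda>j. {1, j}) ` {2..k + 1})"
    unfolding vertex_degree_def by (rule card_mono[rotated]) simp
  also have "\<dots> \<le> card {2..k + 1}" by (rule card_image_le) simp
  finally show "vertex_degree (spider k) 1 \<le> k" by simp
  have "{e \<in> spider k. j \<in> e} \<subseteq> {{1, j}, {j, j + k}}" using j by (auto simp: spider_edges)
  then have "vertex_degree (spider k) j \<le> card {{1, j}, {j, j + k}}"
    unfolding vertex_degree_def by (rule card_mono[rotated]) simp
  also have "\<dots> \<le> 2" by (simp add: card_insert_if)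
  finally show "vertex_degree (spider k) j \<le> 2" .
  have "{e \<in> spider k. j + k \<in> e} \<subseteq> {{j, j + k}}" using j by (auto simp: spider_edges)
  then have "vertex_degree (spider k) (j + k) \<le> card {{j, j + k}}"
    unfolding vertex_degree_def by (rule card_mono[rotated]) simp
  then show "vertex_degree (spider k) (j + k) \<le> 1" by simp
qed

definition legs :: "nat \<Rightarrow> nat set set" where
  "legs k = (\<lambda>j. {j, j + k}) ` {2..k + 1}"

lemma Union_legs: "\<Union>(insert {1} (legs k)) = {1..2 * k + 1}"
proof
  show "{1..2 * k + 1} \<subseteq> \<Union>(insert {1} (legs k))"
  proof
    fix x assume x: "x \<in> {1..2 * k + 1}"
    consider "x = 1" | "x \<in> {2..k + 1}" | "x - k \<in> {2..k + 1}" "x = x - k + k" using x by fastforce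
    then show "x \<in> \<Union>(insert {1} (legs k))"
    proof cases
      case 3
      then have "x \<in> {x - k, x - k + k}" "{x - k, x - k + k} \<in> legs k" by (auto simp: legs_def)
      then show ?thesis by blast
    qed (auto simp: legs_def)
  qed
qed (auto simp: legs_def)

text \<open>
  If all groups are at most a third of the tree, then the root has score at most \<open>n + n\<^sup>2 / 3\<close>, and any
  other vertex leaves at least two thirds of the tree connected, so it has score at least
  \<open>4 * n\<^sup>2 / 9\<close>.
\<close>

lemma root_wins_if_spider:
  assumes T: "rtree n T" and k: "0 < k" "2 * k + 1 \<le> n" and r: "restr (2 * k + 1) T = spider k" and n: "9 < n"
    and small: "\<And>A. A \<in> insert {1} (legs k) \<Longrightarrow> 3 * card (desc (2 * k + 1) A n T) \<le> n"
  shows "root_wins 1 n T"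
  unfolding root_wins_def
proof (intro ballI impI)
  let ?m = "2 * k + 1" and ?A = "insert {1} (legs k)"
  fix i assume i: "i \<in> {1..n}" "1 < i"
  have m: "2 \<le> ?m" "?m \<le> n" using k by auto
  have inT: "e \<in> T \<longleftrightarrow> e \<in> spider k" if "e \<subseteq> {1..?m}" for e
    using that unfolding r[symmetric] restr_def by simp
  have sub: "A \<subseteq> {1..?m}" if "A \<in> ?A" for A using that Union_legs[of k] by blast
  have "score n T 1 \<le> n + n * (n div 3)"
  proof (rule score_root_le[OF T m Union_legs])
    fix A x y assume h: "A \<in> ?A" "x \<in> A" "x \<noteq> 1" "y \<in> {1..?m}" "y \<noteq> 1" "{x, y} \<in> T"
    from h(1-3) obtain j where j: "j \<in> {2..k + 1}" "A = {j, j + k}" by (auto simp: legs_def)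
    have "{x, y} \<in> spider k" using inT[of "{x, y}"] sub[OF h(1)] h by auto
    then obtain l where l: "l \<in> {2..k + 1}" "{x, y} = {1, l} \<or> {x, y} = {l, l + k}"
      unfolding spider_edges by blast
    then have xy: "{x, y} = {l, l + k}" using h(3,5) by (auto simp: doubleton_eq_iff)
    have "l = j" using xy h(2) j l(1) by (auto simp: doubleton_eq_iff)
    then show "y \<in> A" using xy j by (auto simp: doubleton_eq_iff)
  next
    fix A assume "A \<in> ?A"
    from small[OF this] show "card (desc ?m A n T) \<le> n div 3" by simp
  qed
  also have "\<dots> < (n - n div 3)\<^sup>2"
  proof -
    define d where "d = n div 3"
    have d: "3 * d \<le> n" "3 \<le> d" "n < 3 * d + 3" using n by (auto simp: d_def)
    obtain c where c: "n = 3 * d + c" using d(1) le_Suc_ex by blast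
    have "n + n * d < (2 * d + c) * (2 * d + c)"
    proof -
      have "(2 * d + c) * (2 * d + c) = n * d + d * d + 3 * (c * d) + c * c" by (simp add: c algebra_simps)
      moreover have "n < d * d + 3 * (c * d)"
      proof (cases "c = 0")
        case True
        then have "4 * d \<le> d * d" using n c by (intro mult_right_mono) auto
        then show ?thesis using True c d(2) by linarith
      next
        case False
        have "3 * d \<le> d * d" "c * 1 \<le> c * d" using d(2) by (auto intro!: mult_left_mono)
        then show ?thesis using False c by linarith
      qed
      ultimately show ?thesis by linarith
    qed
    moreover have "n - d = 2 * d + c" using c by linarith
    ultimately show ?thesis unfolding d_def[symmetric] power2_eq_square by (simp only:)
  qed
  also have "\<dots> \<le> score n T i"
  proof -
    from desc_cover[OF T Union_legs m i(1)] obtain A where A: "A \<in> ?A" "i \<in> desc ?m A n T" by blast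
    have par: "\<exists>y. y < x \<and> {x, y} \<in> T \<and> (y = 1 \<or> y \<in> {2..k + 1} \<and> x = y + k)" if x: "x \<in> {1..?m}" "x \<noteq> 1" for x
    proof (cases "x \<le> k + 1")
      case True
      then have "x \<in> {2..k + 1}" using x by auto
      then have "{x, 1} \<in> spider k" unfolding spider_edges by (intro bexI[of _ x]) auto
      then have "{x, 1} \<in> T" using inT[of "{x, 1}"] x by auto
      then show ?thesis using x by (intro exI[of _ 1]) auto
    next
      case False
      then have "x - k \<in> {2..k + 1}" "x = x - k + k" using x by auto
      then have "{x, x - k} \<in> spider k" unfolding spider_edges
        by (intro bexI[of _ "x - k"]) (auto simp: insert_commute)
      then have "{x, x - k} \<in> T" using inT[of "{x, x - k}"] x \<open>x - k \<in> {2..k + 1}\<close> by auto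
      then show ?thesis using \<open>x - k \<in> {2..k + 1}\<close> \<open>x = x - k + k\<close> k
        by (intro exI[of _ "x - k"]) auto
    qed
    \<comment> \<open>A vertex in the group of the root is later than the spider, so the whole spider avoids it.\<close>
    define C where "C = (if A = {1} then {1..?m} else {1..?m} - A)"
    have "(n - card (desc ?m A n T))\<^sup>2 \<le> score n T i"
    proof (rule score_ge_compl[OF T m sub[OF A(1)] A(2), of C])
      have base: "desc ?m A n T \<inter> {1..?m} = A" by (rule desc_inter_base[OF T sub[OF A(1)] m])
      have "i \<in> A" if "i \<in> {1..?m}" using A(2) that base by blast
      then show "i \<notin> C" using i by (auto simp: C_def)
      show "C \<subseteq> {1..?m}" "{1..?m} - A \<subseteq> C" by (auto simp: C_def)
      show "1 \<in> C" using A(1) by (auto simp: C_def legs_def)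
      fix x assume x: "x \<in> C" "x \<noteq> 1"
      then have "x \<in> {1..?m}" by (auto simp: C_def split: if_splits)
      from par[OF this x(2)] obtain y where y: "y < x" "{x, y} \<in> T" "y = 1 \<or> y \<in> {2..k + 1} \<and> x = y + k"
        by blast
      have "y \<in> C"
      proof (cases "y = 1")
        case True
        then show ?thesis using \<open>1 \<in> C\<close> by simp
      next
        case False
        then have yk: "y \<in> {2..k + 1}" "x = y + k" using y(3) by auto
        show ?thesis
        proof (cases "A = {1}")
          case True
          then show ?thesis using yk by (auto simp: C_def)
        next
          case ne: False
          then have "A \<in> legs k" using A(1) by simp
          then obtain j where j: "j \<in> {2..k + 1}" "A = {j, j + k}" unfolding legs_def by blast
          have "y \<noteq> j" using x(1) yk ne j by (auto simp: C_def)
          then have "y \<notin> A" using yk j by auto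
          then show ?thesis using ne yk by (auto simp: C_def)
        qed
      qed
      then show "\<exists>y\<in>C. y < x \<and> {x, y} \<in> T" using y by blast
    qed
    moreover have "n - n div 3 \<le> n - card (desc ?m A n T)" using small[OF A(1)] by auto
    ultimately show ?thesis by (meson le_trans power_mono zero_le)
  qed
  finally show "score n T 1 < score n T i" .
qed

text \<open>
  The tree at time \<open>m\<close> no longer changes.
\<close>

lemma prob_restr_ge:
  assumes "2 \<le> m" "m \<le> n"
  shows "pmf (PA m) T0 \<le> measure_pmf.prob (PA n) {T. restr m T = T0}"
proof -
  let ?f = "\<lambda>T. - (of_bool (restr m T = T0) :: real)"
  have "expect (PA n) ?f \<le> (\<Prod>j\<in>{m..<n}. 1) * expect (PA m) ?f"
  proof (rule expectation_growth[OF assms])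
    fix j T assume j: "m \<le> j" and T: "rtree j T"
    show "expect (attach_leaf j T) ?f \<le> 1 * ?f T"
      unfolding expectation_attach_leaf[OF T] restr_insert[OF j] sum_distrib_right[symmetric]
      using sum_attach_prob[OF T] by simp
  qed simp
  then have "expect (PA m) (\<lambda>T. of_bool (restr m T = T0) :: real) \<le>
      expect (PA n) (\<lambda>T. of_bool (restr m T = T0) :: real)" by simp
  moreover have "expect (PA m) (\<lambda>T. of_bool (restr m T = T0) :: real) =
      expect (PA m) (indicator {T0})"
    by (rule integral_cong_AE) (use assms in \<open>auto simp: AE_measure_pmf_iff set_pmf_PA restr_self\<close>)
  moreover have "expect (PA n) (\<lambda>T. of_bool (restr m T = T0) :: real) =
      expect (PA n) (indicator {T. restr m T = T0})"
    by (rule Bochner_Integration.integral_cong) (auto simp: indicator_def)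
  ultimately show ?thesis by (simp add: measure_pmf_single)
qed

text \<open>
  The second moment bound for the urn of \<open>A\<close>, started from the total degree of \<open>A\<close> in \<open>T0\<close>.
\<close>

lemma prob_restr_large_group:
  fixes x :: real
  assumes m: "2 \<le> m" "m \<le> n" and A: "A \<subseteq> {1..m}" and x: "0 < x"
    and n: "x * real n \<le> 2 * real n / 3 - card A"
    and w: "(\<Sum>v\<in>A. vertex_degree T0 v) \<le> w"
  shows "measure_pmf.prob (PA n) {T. restr m T = T0 \<and> n < 3 * card (desc m A n T)} \<le>
    pmf (PA m) T0 * (real w * (real w + 2) / (x * (real m - 1))\<^sup>2)"
proof -
  let ?g = "\<lambda>T. of_bool (T = T0) :: real"
  let ?y = "x * real n / 2"
  have n2: "2 \<le> n" using m by simp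
  have y: "0 < ?y" using x n2 by simp
  have m1: "0 < real m - 1" using m by simp
  have "measure_pmf.prob (PA n) {T. restr m T = T0 \<and> n < 3 * card (desc m A n T)} \<le>
      expect (PA n) (\<lambda>T. ?g (restr m T) * pochhammer (real (urn m A n T) / 2) 2 / ?y\<^sup>2)"
  proof (rule prob_le_expectation[OF n2])
    fix T assume T: "rtree n T" and h: "restr m T = T0 \<and> n < 3 * card (desc m A n T)"
    have "2 * card (desc m A n T) \<le> urn m A n T + card A" by (rule card_desc_le_urn[OF T A m])
    then have "2 * real (card (desc m A n T)) \<le> real (urn m A n T) + real (card A)" by linarith
    moreover have "real n < 3 * real (card (desc m A n T))" using h by linarith
    ultimately have "?y \<le> real (urn m A n T) / 2" using n by linarith
    then have "?y\<^sup>2 \<le> (real (urn m A n T) / 2)\<^sup>2" using y by (intro power_mono) auto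
    also have "\<dots> \<le> pochhammer (real (urn m A n T) / 2) 2" by (rule power_le_pochhammer) simp
    finally have "1 \<le> pochhammer (real (urn m A n T) / 2) 2 / ?y\<^sup>2"
      using zero_less_power[OF y, of 2] by (subst le_divide_eq_1_pos)
    then show "1 \<le> ?g (restr m T) * pochhammer (real (urn m A n T) / 2) 2 / ?y\<^sup>2" using h by simp
  qed (use y in \<open>auto intro!: divide_nonneg_pos pochhammer_nonneg zero_less_power\<close>)
  also have "\<dots> = expect (PA n) (\<lambda>T. ?g (restr m T) * pochhammer (real (urn m A n T) / 2) 2) / ?y\<^sup>2"
    by simp
  also have "\<dots> \<le> (((real n - 1) / (real m - 1)) ^ 2 *
      expect (PA m) (\<lambda>T. ?g T * pochhammer (real (urn m A m T) / 2) 2)) / ?y\<^sup>2"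
    by (rule divide_right_mono[OF expectation_urn_le[OF m A]]) auto
  also have "\<dots> \<le> ((real n / (real m - 1)) ^ 2 * (pmf (PA m) T0 * (real w * (real w + 2) / 4))) / ?y\<^sup>2"
  proof (rule divide_right_mono[OF mult_mono])
    show "((real n - 1) / (real m - 1)) ^ 2 \<le> (real n / (real m - 1)) ^ 2"
      by (rule power_mono) (use n2 m1 in \<open>auto intro: divide_right_mono\<close>)
    have "expect (PA m) (\<lambda>T. ?g T * pochhammer (real (urn m A m T) / 2) 2) \<le>
        expect (PA m) (\<lambda>T. indicator {T0} T * (real w * (real w + 2) / 4))"
    proof (rule expectation_PA_mono[OF m(1)])
      fix T
      have "pochhammer (real (urn m A m T) / 2) 2 \<le> real w * (real w + 2) / 4" if "T = T0"
      proof -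
        have "urn m A m T \<le> w" using w that by (simp add: urn_def desc_base)
        then have "pochhammer (real (urn m A m T) / 2) 2 \<le> pochhammer (real w / 2) 2"
          by (intro pochhammer_mono) auto
        also have "\<dots> = real w * (real w + 2) / 4"
          by (simp add: numeral_2_eq_2 pochhammer_Suc field_simps)
        finally show ?thesis .
      qed
      then show "?g T * pochhammer (real (urn m A m T) / 2) 2 \<le> indicator {T0} T * (real w * (real w + 2) / 4)"
        by (simp add: indicator_def)
    qed
    also have "\<dots> = pmf (PA m) T0 * (real w * (real w + 2) / 4)"
      by (simp add: measure_pmf_single)
    finally show "expect (PA m) (\<lambda>T. ?g T * pochhammer (real (urn m A m T) / 2) 2) \<le>
        pmf (PA m) T0 * (real w * (real w + 2) / 4)" .
  qed (auto intro!: integral_nonneg_AE pochhammer_nonneg mult_nonneg_nonneg)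
  also have "\<dots> = pmf (PA m) T0 * (real w * (real w + 2) / (x * (real m - 1))\<^sup>2)"
  proof -
    have "(N / M)\<^sup>2 * (P * (W / 4)) / (x * N / 2)\<^sup>2 = P * (W / (x * M)\<^sup>2)"
      if "0 < N" "0 < M" for N M P W :: real
      using that x by (simp add: power2_eq_square field_simps)
    then show ?thesis using n2 m1 by simp
  qed
  finally show ?thesis .
qed

text \<open>
  A union bound over the group of the root and the groups of the legs, given that the tree starts as a
  spider. With legs of total degree 3 and the root of degree \<open>k\<close> it bounds the conditional failure
  probability by \<open>25 / 36 + O(1 / k)\<close>.
\<close>

lemma prob_root_wins_alone:
  "\<exists>\<delta>>0. \<forall>\<^sub>F n in sequentially. \<delta> \<le> measure_pmf.prob (PA n) {T. root_wins 1 n T}"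
proof -
  \<comment> \<open>Large enough for the sum of the failure probabilities to be at most \<open>19 / 20\<close>.\<close>
  define k :: nat where "k = 100"
  let ?m = "2 * k + 1"
  let ?A = "insert {1} (legs k)"
  let ?T0 = "spider k"
  have k0: "0 < k" and m2: "2 \<le> ?m" by (auto simp: k_def)
  define p where "p = pmf (PA ?m) ?T0"
  have "?T0 \<in> set_pmf (PA ?m)" using set_pmf_PA[OF m2] rtree_spider[OF k0] by simp
  then have p: "0 < p" by (simp add: p_def pmf_positive)
  have "\<forall>\<^sub>F n in sequentially. p / 20 \<le> measure_pmf.prob (PA n) {T. root_wins 1 n T}"
    using eventually_ge_at_top[of "3 * 10 * ?m"]
  proof eventually_elim
    case (elim n)
    have mn: "?m \<le> n" "9 < n" using elim by auto
    have n2: "2 \<le> n" using mn by simp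
    let ?R = "{T. restr ?m T = ?T0}"
    let ?L = "\<lambda>A. {T. restr ?m T = ?T0 \<and> n < 3 * card (desc ?m A n T)}"
    have large: "measure_pmf.prob (PA n) (?L A) \<le> p * (real w * (real w + 2) / (3 / 5 * real (2 * k))\<^sup>2)"
      if A: "A \<subseteq> {1..?m}" "card A \<le> 2" and w: "(\<Sum>v\<in>A. vertex_degree ?T0 v) \<le> w" for A w
    proof -
      have "3 / 5 * real n \<le> 2 * real n / 3 - card A" using A(2) elim by (simp add: k_def)
      from prob_restr_large_group[OF m2 mn(1) A(1) _ this w] show ?thesis by (simp add: p_def)
    qed
    have root: "measure_pmf.prob (PA n) (?L {1}) \<le> p * (real k * (real k + 2) / (3 / 5 * real (2 * k))\<^sup>2)"
      by (rule large) (use spider_degrees(1)[of 2 k] k0 in auto)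
    have leg: "measure_pmf.prob (PA n) (?L A) \<le> p * (real 3 * (real 3 + 2) / (3 / 5 * real (2 * k))\<^sup>2)"
      if "A \<in> legs k" for A
    proof -
      from that obtain j where j: "j \<in> {2..k + 1}" "A = {j, j + k}" by (auto simp: legs_def)
      show ?thesis
        by (rule large) (use j spider_degrees[OF j(1)] k0 in \<open>auto simp: card_insert_if\<close>)
    qed
    have card_legs: "card (legs k) \<le> k"
      unfolding legs_def using card_image_le[of "{2..k + 1}" "\<lambda>j. {j, j + k}"] by simp
    have fin: "finite (legs k)" by (simp add: legs_def)
    have "measure_pmf.prob (PA n) (\<Union>A\<in>?A. ?L A) \<le> (\<Sum>A\<in>?A. measure_pmf.prob (PA n) (?L A))"
      by (rule measure_pmf.finite_measure_subadditive_finite) (auto simp: fin)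
    also have "\<dots> = measure_pmf.prob (PA n) (?L {1}) + (\<Sum>A\<in>legs k. measure_pmf.prob (PA n) (?L A))"
    proof -
      have "{1} \<notin> legs k" by (auto simp: legs_def)
      then show ?thesis using fin by simp
    qed
    also have "\<dots> \<le> p * (real k * (real k + 2) / (3 / 5 * real (2 * k))\<^sup>2) +
        real k * (p * (real 3 * (real 3 + 2) / (3 / 5 * real (2 * k))\<^sup>2))"
    proof (rule add_mono[OF root])
      have "(\<Sum>A\<in>legs k. measure_pmf.prob (PA n) (?L A)) \<le>
          real (card (legs k)) * (p * (real 3 * (real 3 + 2) / (3 / 5 * real (2 * k))\<^sup>2))"
        by (rule sum_bounded_above[OF leg])
      also have "\<dots> \<le> real k * (p * (real 3 * (real 3 + 2) / (3 / 5 * real (2 * k))\<^sup>2))"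
        by (rule mult_right_mono) (use card_legs p in auto)
      finally show "(\<Sum>A\<in>legs k. measure_pmf.prob (PA n) (?L A)) \<le>
          real k * (p * (real 3 * (real 3 + 2) / (3 / 5 * real (2 * k))\<^sup>2))" .
    qed
    also have "\<dots> \<le> p * (19 / 20)" using p by (simp add: k_def power2_eq_square field_simps)
    finally have bad: "measure_pmf.prob (PA n) (\<Union>A\<in>?A. ?L A) \<le> p * (19 / 20)" .
    have "p \<le> measure_pmf.prob (PA n) ?R" unfolding p_def by (rule prob_restr_ge[OF m2 mn(1)])
    also have "\<dots> = measure_pmf.prob (PA n) (?R \<inter> set_pmf (PA n))" by (rule measure_Int_set_pmf[symmetric])
    also have "\<dots> \<le> measure_pmf.prob (PA n) ({T. root_wins 1 n T} \<union> (\<Union>A\<in>?A. ?L A))"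
    proof (rule measure_pmf.finite_measure_mono)
      show "?R \<inter> set_pmf (PA n) \<subseteq> {T. root_wins 1 n T} \<union> (\<Union>A\<in>?A. ?L A)"
      proof
        fix T assume "T \<in> ?R \<inter> set_pmf (PA n)"
        then have T: "rtree n T" and r: "restr ?m T = ?T0" using set_pmf_PA[OF n2] by auto
        show "T \<in> {T. root_wins 1 n T} \<union> (\<Union>A\<in>?A. ?L A)"
        proof (cases "\<forall>A\<in>?A. 3 * card (desc ?m A n T) \<le> n")
          case True
          then have "root_wins 1 n T" by (intro root_wins_if_spider[OF T k0 mn(1) r mn(2)]) blast
          then show ?thesis by simp
        next
          case False
          then obtain A where "A \<in> ?A" "n < 3 * card (desc ?m A n T)" by (auto simp: not_le)
          with r show ?thesis by blast
        qed
      qed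
    qed simp
    also have "\<dots> \<le> measure_pmf.prob (PA n) {T. root_wins 1 n T} + measure_pmf.prob (PA n) (\<Union>A\<in>?A. ?L A)"
      by (rule measure_Un_le) auto
    finally show ?case using bad by linarith
  qed
  then show ?thesis using p by (intro exI[of _ "p / 20"]) simp
qed

section \<open>Choice of the output size\<close>

text \<open>
  If \<open>1 - \<epsilon> > \<delta>\<close>, then \<open>ln (1 / \<epsilon>) \<ge> \<delta>\<close>, so the additive constants of the rounded quantities are
  absorbed by the constant \<open>c'\<close>. Otherwise the success probability \<open>\<delta>\<close> of a single vertex suffices.
\<close>

theorem lowest_root_finding:
  "\<exists>c'>0. \<exists>K :: real \<Rightarrow> nat. \<forall>\<epsilon>::real. 0 < \<epsilon> \<and> \<epsilon> < 1 \<longrightarrow>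
     root_finding_procedure (lowest (K \<epsilon>)) (K \<epsilon>) \<epsilon> \<and>
     real (K \<epsilon>) \<le> max 1 (c' * (ln (1 / \<epsilon>))\<^sup>2 / \<epsilon> ^ 4)"
proof -
  obtain \<delta> :: real where d: "0 < \<delta>" and
    alone: "\<forall>\<^sub>F n in sequentially. \<delta> \<le> measure_pmf.prob (PA n) {T. root_wins 1 n T}"
    using prob_root_wins_alone by blast
  define Q where "Q \<epsilon> = nat \<lceil>ln (1 / \<epsilon>)\<rceil> + 2" for \<epsilon> :: real
  define M where "M \<epsilon> = nat \<lceil>48 * (real (Q \<epsilon>))\<^sup>2 / (\<epsilon>\<^sup>2 / 432)\<^sup>2\<rceil> + 2" for \<epsilon> :: real
  define K where "K \<epsilon> = (if 1 - \<epsilon> \<le> \<delta> then 1 else M \<epsilon>)" for \<epsilon> :: real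
  define c' where "c' = (48 * 432\<^sup>2 + 3) * (1 + 3 / \<delta>)\<^sup>2"
  have "root_finding_procedure (lowest (K \<epsilon>)) (K \<epsilon>) \<epsilon> \<and>
     real (K \<epsilon>) \<le> max 1 (c' * (ln (1 / \<epsilon>))\<^sup>2 / \<epsilon> ^ 4)" if e: "0 < \<epsilon>" "\<epsilon> < 1" for \<epsilon>
  proof (cases "1 - \<epsilon> \<le> \<delta>")
    case True
    have "\<forall>\<^sub>F n in sequentially. 1 - \<epsilon> \<le> measure_pmf.prob (PA n) {T. root_wins 1 n T}"
      using alone by eventually_elim (use True in linarith)
    then show ?thesis using True root_finding_procedure_lowest[of 1 \<epsilon>] by (simp add: K_def)
  next
    case False
    define l where "l = ln (1 / \<epsilon>)"
    have "ln \<epsilon> \<le> \<epsilon> - 1" by (rule ln_le_minus_one[OF e(1)])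
    then have l: "\<delta> \<le> l" using False e by (simp add: l_def ln_div)
    let ?q = "Q \<epsilon>"
    have q2: "2 \<le> ?q" by (simp add: Q_def)
    have ql: "l + 2 \<le> real ?q" "real ?q \<le> l + 3"
      using l d by (auto simp: Q_def l_def[symmetric]) linarith
    have "(1 / 3 :: real) ^ ?q \<le> (1 / 9) * \<epsilon>"
    proof -
      have "(1 / 3 :: real) ^ ?q = (1 / 9) * (1 / 3) ^ (?q - 2)"
      proof -
        have "?q = 2 + (?q - 2)" using q2 by simp
        then have "(1 / 3 :: real) ^ ?q = (1 / 3) ^ (2 + (?q - 2))" by (rule arg_cong)
        also have "\<dots> = (1 / 3)\<^sup>2 * (1 / 3) ^ (?q - 2)" by (rule power_add)
        finally show ?thesis by (simp add: power2_eq_square)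
      qed
      also have "(1 / 3 :: real) ^ (?q - 2) \<le> \<epsilon>"
      proof -
        have "1 / \<epsilon> = exp l" using e by (simp add: l_def)
        also have "\<dots> \<le> exp (real (?q - 2))" using ql q2 by (simp add: of_nat_diff)
        also have "\<dots> = exp 1 ^ (?q - 2)" by (simp add: exp_of_nat_mult[symmetric])
        also have "\<dots> \<le> 3 ^ (?q - 2)" by (rule power_mono[OF exp_le]) simp
        finally show ?thesis using e by (simp add: power_divide field_simps)
      qed
      finally show ?thesis by simp
    qed
    then have q3: "(1 / 3 :: real) ^ ?q \<le> \<epsilon> / 6" using e by linarith
    define z where "z = 48 * (real ?q)\<^sup>2 / (\<epsilon>\<^sup>2 / 432)\<^sup>2"
    have z: "0 \<le> z" by (simp add: z_def)
    have Mz: "z \<le> real (M \<epsilon>) - 1" "real (M \<epsilon>) \<le> z + 3"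
      using z by (auto simp: M_def z_def[symmetric]) linarith+
    have big: "48 * (real ?q)\<^sup>2 \<le> (\<epsilon>\<^sup>2 / 432)\<^sup>2 * (real (M \<epsilon>) - 1)"
    proof -
      have "48 * (real ?q)\<^sup>2 = (\<epsilon>\<^sup>2 / 432)\<^sup>2 * z" using e by (simp add: z_def)
      also have "\<dots> \<le> (\<epsilon>\<^sup>2 / 432)\<^sup>2 * (real (M \<epsilon>) - 1)" by (rule mult_left_mono[OF Mz(1)]) simp
      finally show ?thesis .
    qed
    have M2: "2 \<le> M \<epsilon>" by (simp add: M_def)
    have "root_finding_procedure (lowest (M \<epsilon>)) (M \<epsilon>) \<epsilon>"
      by (rule root_finding_procedure_lowest[OF _ prob_root_wins[OF M2 e q2 q3 big]]) (use M2 in simp)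
    moreover have "real (M \<epsilon>) \<le> c' * l\<^sup>2 / \<epsilon> ^ 4"
    proof -
      have e4: "0 < \<epsilon> ^ 4" "\<epsilon> ^ 4 \<le> 1" using e by (auto intro: power_le_one)
      have "real ?q \<le> l * (1 + 3 / \<delta>)"
      proof -
        have "3 \<le> l * (3 / \<delta>)" using l d by (simp add: field_simps)
        then show ?thesis using ql(2) by (simp add: distrib_left)
      qed
      then have qq: "(real ?q)\<^sup>2 \<le> (l * (1 + 3 / \<delta>))\<^sup>2" by (rule power_mono) simp
      have q1: "1 \<le> (real ?q)\<^sup>2" using q2 by simp
      have "z = 48 * 432\<^sup>2 * (real ?q)\<^sup>2 / \<epsilon> ^ 4"
        by (simp add: z_def power_divide power_mult[symmetric] mult.commute)
      moreover have "3 \<le> 3 * (real ?q)\<^sup>2 / \<epsilon> ^ 4"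
      proof -
        have "\<epsilon> ^ 4 \<le> (real ?q)\<^sup>2" using e4 q1 by linarith
        then show ?thesis using e4 by (simp add: field_simps)
      qed
      ultimately have "real (M \<epsilon>) \<le> (48 * 432\<^sup>2 + 3) * (real ?q)\<^sup>2 / \<epsilon> ^ 4"
        using Mz(2) by (simp add: distrib_right add_divide_distrib)
      also have "\<dots> \<le> (48 * 432\<^sup>2 + 3) * (l * (1 + 3 / \<delta>))\<^sup>2 / \<epsilon> ^ 4"
        by (intro divide_right_mono mult_left_mono qq) (use e4 in auto)
      also have "\<dots> = c' * l\<^sup>2 / \<epsilon> ^ 4" by (simp add: c'_def power_mult_distrib mult_ac)
      finally show ?thesis .
    qed
    ultimately show ?thesis using False by (simp add: K_def l_def)
  qed
  moreover have "0 < c'"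
    unfolding c'_def by (intro mult_pos_pos zero_less_power add_pos_pos divide_pos_pos) (use d in auto)
  ultimately show ?thesis by blast
qed

section \<open>Total correctness with running times\<close>

definition runs :: "prog \<Rightarrow> state \<Rightarrow> nat \<Rightarrow> (state \<Rightarrow> bool) \<Rightarrow> bool" where
  "runs P s B Q \<longleftrightarrow> (\<exists>t s'. exec P s t s' \<and> t \<le> B \<and> Q s')"

lemma runs_mono: "runs P s B Q \<Longrightarrow> B \<le> B' \<Longrightarrow> (\<And>s'. Q s' \<Longrightarrow> Q' s') \<Longrightarrow> runs P s B' Q'"
  unfolding runs_def by (meson order_trans)

lemma runs_Skip: "Q s \<Longrightarrow> 1 \<le> B \<Longrightarrow> runs Skip s B Q"
  unfolding runs_def by (blast intro: exec.Skip)

lemma runs_Assign: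
  "Q ((fst s)(x := eval_expr e s), snd s) \<Longrightarrow> 1 \<le> B \<Longrightarrow> runs (Assign x e) s B Q"
  unfolding runs_def by (blast intro: exec.Assign)

lemma runs_Write:
  "Q (fst s, (snd s)(a := (snd s a)(eval_expr e s := eval_expr f s))) \<Longrightarrow> 1 \<le> B \<Longrightarrow>
     runs (Write a e f) s B Q"
  unfolding runs_def by (blast intro: exec.Write)

lemma runs_Seq:
  assumes "runs P s B (\<lambda>s'. runs R s' C Q)"
  shows "runs (Seq P R) s (B + C) Q"
  using assms unfolding runs_def by (metis exec.Seq add_mono)

lemma runs_IfLess:
  assumes "eval_expr e s < eval_expr f s \<Longrightarrow> runs P s B Q"
    and "\<not> eval_expr e s < eval_expr f s \<Longrightarrow> runs R s B Q"
  shows "runs (IfLess e f P R) s (Suc B) Q"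
  using assms unfolding runs_def by (metis exec.IfTrue exec.IfFalse Suc_le_mono)

primrec assigned :: "prog \<Rightarrow> nat set" where
  "assigned Skip = {}"
| "assigned (Assign x e) = {x}"
| "assigned (Write a e f) = {}"
| "assigned (Seq P Q) = assigned P \<union> assigned Q"
| "assigned (IfLess e f P Q) = assigned P \<union> assigned Q"
| "assigned (WhileLess e f P) = assigned P"

primrec written :: "prog \<Rightarrow> nat set" where
  "written Skip = {}"
| "written (Assign x e) = {}"
| "written (Write a e f) = {a}"
| "written (Seq P Q) = written P \<union> written Q"
| "written (IfLess e f P Q) = written P \<union> written Q"
| "written (WhileLess e f P) = written P"

text \<open>
  A syntactic frame rule. It spares loop invariants any mention of what a loop leaves unchanged.
\<close>

lemma exec_frame:
  "exec P s t s' \<Longrightarrow> (\<forall>x. x \<notin> assigned P \<longrightarrow> fst s' x = fst s x) \<and>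
     (\<forall>a. a \<notin> written P \<longrightarrow> snd s' a = snd s a)"
  by (induction rule: exec.induct) auto

definition frame :: "prog \<Rightarrow> state \<Rightarrow> state \<Rightarrow> bool" where
  "frame P s s' \<longleftrightarrow> (\<forall>x. x \<notin> assigned P \<longrightarrow> fst s' x = fst s x) \<and>
     (\<forall>a. a \<notin> written P \<longrightarrow> snd s' a = snd s a)"

lemma runs_frame:
  assumes "runs P s B Q"
  shows "runs P s B (\<lambda>s'. Q s' \<and> frame P s s')"
  using assms exec_frame unfolding runs_def frame_def by blast

text \<open>
  The loop variable runs from 1 to the number of vertices, which is kept in variable 0.
\<close>

definition For :: "nat \<Rightarrow> prog \<Rightarrow> prog" where
  "For x P = Seq (Assign x (Const 1))
     (WhileLess (Var x) (Plus (Var 0) (Const 1)) (Seq P (Assign x (Plus (Var x) (Const 1)))))"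

definition for_time :: "nat \<Rightarrow> nat \<Rightarrow> nat" where
  "for_time n B = 2 + n * (B + 2)"

lemma assigned_For [simp]: "assigned (For x P) = insert x (assigned P)"
  and written_For [simp]: "written (For x P) = written P"
  by (auto simp: For_def)

lemma runs_While_aux:
  fixes Inv :: "nat \<Rightarrow> state \<Rightarrow> bool"
  assumes x: "0 \<notin> assigned P" "x \<notin> assigned P" "x \<noteq> 0"
    and insens: "\<And>i s c. Inv i s \<Longrightarrow> Inv i ((fst s)(x := c), snd s)"
    and body: "\<And>i s. 1 \<le> i \<Longrightarrow> i \<le> fst z 0 \<Longrightarrow> frame (For x P) z s \<Longrightarrow> fst s x = i \<Longrightarrow>
       Inv i s \<Longrightarrow> runs P s B (Inv (Suc i))"
  shows "1 \<le> i \<Longrightarrow> i + r = fst z 0 + 1 \<Longrightarrow> frame (For x P) z s \<Longrightarrow> fst s x = i \<Longrightarrow> Inv i s \<Longrightarrow>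
     runs (WhileLess (Var x) (Plus (Var 0) (Const 1)) (Seq P (Assign x (Plus (Var x) (Const 1))))) s
       (1 + r * (B + 2)) (Inv (fst z 0 + 1))"
proof (induction r arbitrary: i s)
  case 0
  have s0: "fst s 0 = fst z 0" using 0(3) x by (simp add: frame_def)
  let ?W = "WhileLess (Var x) (Plus (Var 0) (Const 1)) (Seq P (Assign x (Plus (Var x) (Const 1))))"
  have "exec ?W s 1 s"
    by (rule exec.WhileFalse) (use 0 s0 in simp)
  moreover have "Inv (fst z 0 + 1) s" using 0 by simp
  ultimately show ?case unfolding runs_def by (metis add_0_right le_refl mult_0)
next
  case (Suc r)
  have s0: "fst s 0 = fst z 0" using Suc.prems x by (simp add: frame_def)
  let ?W = "WhileLess (Var x) (Plus (Var 0) (Const 1)) (Seq P (Assign x (Plus (Var x) (Const 1))))"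
  have "runs P s B (\<lambda>s'. Inv (Suc i) s' \<and> frame P s s')"
    by (rule runs_frame, rule body) (use Suc.prems in auto)
  then obtain t s' where e: "exec P s t s'" "t \<le> B" "Inv (Suc i) s'" "frame P s s'"
    unfolding runs_def by blast
  let ?s = "((fst s')(x := Suc i), snd s')"
  have x': "fst s' x = i" using e(4) x Suc.prems by (simp add: frame_def)
  have e2: "exec (Seq P (Assign x (Plus (Var x) (Const 1)))) s (t + 1) ?s"
    using exec.Seq[OF e(1) exec.Assign[of x "Plus (Var x) (Const 1)" s']] x' by simp
  have "frame (For x P) z ?s"
    using Suc.prems(3) e(4) by (auto simp: frame_def)
  then have "runs ?W ?s (1 + r * (B + 2)) (Inv (fst z 0 + 1))"
    using Suc.prems insens[OF e(3)] by (intro Suc.IH[of "Suc i"]) auto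
  then obtain u s'' where w: "exec ?W ?s u s''" "u \<le> 1 + r * (B + 2)" "Inv (fst z 0 + 1) s''"
    unfolding runs_def by blast
  have "exec ?W s (Suc ((t + 1) + u)) s''"
    by (rule exec.WhileTrue[OF _ e2 w(1)]) (use Suc.prems s0 in simp)
  moreover have "Suc ((t + 1) + u) \<le> 1 + Suc r * (B + 2)"
    using w(2) e(2) by simp
  ultimately show ?case using w(3) unfolding runs_def by blast
qed

text \<open>
  The loop invariant must not depend on the loop variable itself, which is given separately; the
  invariant \<open>Inv i\<close> holds before the \<open>i\<close>-th round.
\<close>

lemma runs_For:
  fixes Inv :: "nat \<Rightarrow> state \<Rightarrow> bool"
  assumes x: "0 \<notin> assigned P" "x \<notin> assigned P" "x \<noteq> 0"
    and n: "fst s 0 = n"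
    and init: "Inv 1 s"
    and insens: "\<And>i s c. Inv i s \<Longrightarrow> Inv i ((fst s)(x := c), snd s)"
    and body: "\<And>i s'. 1 \<le> i \<Longrightarrow> i \<le> n \<Longrightarrow> frame (For x P) s s' \<Longrightarrow> fst s' x = i \<Longrightarrow>
       Inv i s' \<Longrightarrow> runs P s' B (Inv (Suc i))"
  shows "runs (For x P) s (for_time n B) (\<lambda>s'. Inv (Suc n) s' \<and> frame (For x P) s s')"
proof (rule runs_frame)
  have "runs (Assign x (Const 1)) s 1 (\<lambda>s'. runs (WhileLess (Var x) (Plus (Var 0) (Const 1))
        (Seq P (Assign x (Plus (Var x) (Const 1))))) s' (1 + n * (B + 2)) (Inv (fst s 0 + 1)))"
    by (rule runs_Assign, rule runs_While_aux[where Inv = Inv and z = s, OF x insens body[folded n]])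
       (use n x insens[OF init] in \<open>auto simp: frame_def\<close>)
  from runs_Seq[OF this] show "runs (For x P) s (for_time n B) (Inv (Suc n))"
    unfolding For_def for_time_def using n by (simp add: algebra_simps)
qed

section \<open>The algorithm\<close>

text \<open>
  Variables: 0 number of vertices, 1 output size, 2 \<open>v\<close>, 3 \<open>u\<close>, 4 round, 5 \<open>i\<close>, 6 \<open>j\<close>,
  7 offset \<open>i * n\<close>, 8 rank of \<open>v\<close>.
  Arrays: 0 adjacency matrix, 1 output, 2 marks, 3 scores.
\<close>

definition clear_marks :: prog where
  "clear_marks = For 5 (Write 2 (Var 5) (Const 0))"

definition scan_row :: prog where
  "scan_row = For 6
     (IfLess (Const 0) (Read 2 (Var 5))
       (IfLess (Const 0) (Read 0 (Plus (Var 7) (Var 6)))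
         (IfLess (Const 0) (Plus (Minus (Var 6) (Var 2)) (Minus (Var 2) (Var 6)))
           (Write 2 (Var 6) (Const 1)) Skip) Skip) Skip)"

definition spread_marks :: prog where
  "spread_marks = Seq (Assign 7 (Const 0))
     (For 5 (Seq (Assign 7 (Plus (Var 7) (Var 0))) scan_row))"

definition add_marks :: prog where
  "add_marks = For 5 (Write 3 (Var 2) (Plus (Read 3 (Var 2)) (Read 2 (Var 5))))"

definition compute_scores :: prog where
  "compute_scores = For 2 (For 3
     (Seq clear_marks (Seq (Write 2 (Var 3) (Const 1)) (Seq (For 4 spread_marks) add_marks))))"

definition compute_rank :: prog where
  "compute_rank = For 3
     (IfLess (Read 3 (Var 3)) (Read 3 (Var 2)) (Assign 8 (Plus (Var 8) (Const 1)))
       (IfLess (Read 3 (Var 2)) (Read 3 (Var 3)) Skip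
         (IfLess (Var 3) (Var 2) (Assign 8 (Plus (Var 8) (Const 1))) Skip)))"

definition select_lowest :: prog where
  "select_lowest = For 2 (Seq (Assign 8 (Const 0)) (Seq compute_rank
     (IfLess (Var 8) (Var 1) (Write 1 (Var 2) (Const 1)) Skip)))"

definition root_finder :: prog where
  "root_finder = Seq compute_scores select_lowest"

definition marks :: "nat set \<Rightarrow> nat \<Rightarrow> nat" where
  "marks M = (\<lambda>x. if x \<in> M then 1 else 0)"

lemma marks_insert: "(marks M)(j := Suc 0) = marks (insert j M)"
  by (auto simp: marks_def)

lemma marks_remove: "(marks M)(j := 0) = marks (M - {j})"
  by (auto simp: marks_def)

definition adjacency :: "nat \<Rightarrow> nat set set \<Rightarrow> nat \<Rightarrow> nat" where
  "adjacency n T k = (if \<exists>i\<in>{1..n}. \<exists>j\<in>{1..n}. k = i * n + j \<and> {i, j} \<in> T then 1 else 0)"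

lemma row_col_unique:
  fixes n :: nat
  assumes "i * n + j = i' * n + j'" "j \<in> {1..n}" "j' \<in> {1..n}"
  shows "i = i' \<and> j = j'"
proof -
  have *: False if "a * n + b = a' * n + b'" "b \<in> {1..n}" "b' \<in> {1..n}" "a < a'" for a b a' b'
  proof -
    have "Suc a * n \<le> a' * n" using that(4) by (intro mult_right_mono) auto
    with that show False by auto
  qed
  have "i = i'"
    using *[OF assms] *[OF assms(1)[symmetric] assms(3,2)] by (meson linorder_neqE_nat)
  with assms show ?thesis by simp
qed

lemma adjacency_pos:
  assumes "i \<in> {1..n}" "j \<in> {1..n}"
  shows "0 < adjacency n T (i * n + j) \<longleftrightarrow> {i, j} \<in> T"
  using assms row_col_unique[OF _ assms(2)] unfolding adjacency_def
  by (smt (verit, best) zero_less_one less_numeral_extra(3))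

lemma runs_clear_marks:
  assumes "fst s 0 = n" "snd s 2 = marks M" "M \<subseteq> {1..n}"
  shows "runs clear_marks s (for_time n 1)
     (\<lambda>s'. snd s' 2 = marks {} \<and> frame clear_marks s s')"
proof -
  have "runs clear_marks s (for_time n 1)
     (\<lambda>s'. snd s' 2 = marks (M - {1..<Suc n}) \<and> frame clear_marks s s')"
    unfolding clear_marks_def
  proof (rule runs_For[where Inv = "\<lambda>i s'. snd s' 2 = marks (M - {1..<i})"])
    fix i and s' :: state
    assume "1 \<le> i" "i \<le> n" "fst s' 5 = i" "snd s' 2 = marks (M - {1..<i})"
    moreover from this have "M - {1..<i} - {i} = M - {1..<Suc i}" by auto
    ultimately show "runs (Write 2 (Var 5) (Const 0)) s' 1 (\<lambda>s'. snd s' 2 = marks (M - {1..<Suc i}))"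
      by (intro runs_Write) (simp_all add: marks_remove)
  qed (use assms in auto)
  moreover have "M - {1..<Suc n} = {}" using assms(3) by auto
  ultimately show ?thesis by (simp only:)
qed

lemma runs_scan_row:
  assumes s: "fst s 0 = n" "fst s 2 = v" "fst s 5 = i" "fst s 7 = i * n"
      "snd s 0 = adjacency n T" "snd s 2 = marks M"
    and i: "i \<in> {1..n}" and T: "simple_graph n T"
  shows "runs scan_row s (for_time n 4)
     (\<lambda>s'. snd s' 2 = marks (M \<union> (if i \<in> M then avoid T v `` {i} else {})) \<and> frame scan_row s s')"
proof -
  define N where "N j = M \<union> (if i \<in> M then avoid T v `` {i} \<inter> {1..<j} else {})" for j
  have loop: "{j, j} \<notin> T" for j using T unfolding simple_graph_def by fastforce
  have "runs scan_row s (for_time n 4)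
     (\<lambda>s'. snd s' 2 = marks (N (Suc n)) \<and> frame scan_row s s')"
    unfolding scan_row_def
  proof (rule runs_For[where Inv = "\<lambda>j s'. snd s' 2 = marks (N j)"], goal_cases)
    case (7 j s')
    have f: "fst s' 0 = n" "fst s' 2 = v" "fst s' 5 = i" "fst s' 7 = i * n"
        "snd s' 0 = adjacency n T"
      using 7(3) s by (auto simp: frame_def)
    have iN: "i \<in> N j \<longleftrightarrow> i \<in> M" using loop by (auto simp: N_def avoid_def)
    have NS: "N (Suc j) = (if i \<in> M \<and> {i, j} \<in> T \<and> j \<noteq> v then insert j (N j) else N j)"
      using 7(1) by (auto simp: N_def avoid_def less_Suc_eq)
    have 4: "(4::nat) = Suc (Suc (Suc 1))" by simp
    have adj: "0 < adjacency n T (i * n + j) \<longleftrightarrow> {i, j} \<in> T"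
      by (rule adjacency_pos) (use i 7 in auto)
    show ?case unfolding 4
      apply (intro runs_IfLess runs_Skip runs_Write)
      using 7 f adj iN by (auto simp: NS marks_insert split: if_splits) (auto simp: marks_def iN)
  qed (use s in \<open>auto simp: N_def\<close>)
  moreover have "N (Suc n) = M \<union> (if i \<in> M then avoid T v `` {i} else {})"
    using T unfolding N_def avoid_def simple_graph_def by (auto simp: less_Suc_eq_le)
  ultimately show ?thesis by simp
qed


text \<open>
  One round marks at least all successors of the vertices marked before it. It may mark more, since
  marks set in a round are used in the same round, but only vertices reachable from \<open>u\<close>.
\<close>

lemma runs_spread_marks:
  assumes s: "fst s 0 = n" "fst s 2 = v" "snd s 0 = adjacency n T" "snd s 2 = marks M"
    and M: "M \<subseteq> (avoid T v)\<^sup>* `` {u}" and T: "simple_graph n T"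
  shows "runs spread_marks s (2 + for_time n (1 + for_time n 4))
     (\<lambda>s'. (\<exists>M'. snd s' 2 = marks M' \<and> M \<union> avoid T v `` (M \<inter> {1..n}) \<subseteq> M' \<and>
        M' \<subseteq> (avoid T v)\<^sup>* `` {u}))"
proof -
  define R where "R = (avoid T v)\<^sup>* `` {u}"
  have R: "avoid T v `` R \<subseteq> R" unfolding R_def by (auto intro: rtrancl.rtrancl_into_rtrancl)
  define Inv where "Inv i s' \<longleftrightarrow> fst s' 7 = (i - 1) * n \<and> (\<exists>M'. snd s' 2 = marks M' \<and>
      M \<union> avoid T v `` (M \<inter> {1..<i}) \<subseteq> M' \<and> M' \<subseteq> R)" for i and s' :: state
  show ?thesis unfolding spread_marks_def
  proof (rule runs_mono[OF runs_Seq[OF runs_Assign[where B = 1 and Q = "\<lambda>s'. runs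
       (For 5 (Seq (Assign 7 (Plus (Var 7) (Var 0))) scan_row)) s' (for_time n (1 + for_time n 4))
       (\<lambda>s'. Inv (Suc n) s' \<and> frame (For 5 (Seq (Assign 7 (Plus (Var 7) (Var 0))) scan_row))
          ((fst s)(7 := 0), snd s) s')"]]], goal_cases)
    case 1
    show ?case
      unfolding eval_expr.simps
    proof (rule runs_For[where Inv = Inv], goal_cases)
      case (7 i s')
      from 7(5) obtain M' where M': "snd s' 2 = marks M'"
          "M \<union> avoid T v `` (M \<inter> {1..<i}) \<subseteq> M'" "M' \<subseteq> R" and off: "fst s' 7 = (i - 1) * n"
        unfolding Inv_def by blast
      have f: "fst s' 0 = n" "fst s' 2 = v" "snd s' 0 = adjacency n T"
        using 7(3) s by (auto simp: frame_def scan_row_def)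
      have off': "fst s' 7 + fst s' 0 = i * n"
        using off f 7(1) by (cases i) auto
      let ?s = "((fst s')(7 := fst s' 7 + fst s' 0), snd s')"
      have "runs scan_row ?s (for_time n 4)
          (\<lambda>s'. snd s' 2 = marks (M' \<union> (if i \<in> M' then avoid T v `` {i} else {})) \<and> frame scan_row ?s s')"
        by (rule runs_scan_row[where v = v and i = i]) (use f off' M' 7 T in auto)
      then have "runs scan_row ?s (for_time n 4) (Inv (Suc i))"
      proof (rule runs_mono[OF _ le_refl], goal_cases)
        case (1 s'')
        let ?M = "M' \<union> (if i \<in> M' then avoid T v `` {i} else {})"
        have "fst s'' 7 = i * n"
          using 1 off' by (simp add: frame_def scan_row_def)
        moreover have "M \<union> avoid T v `` (M \<inter> {1..<Suc i}) \<subseteq> ?M"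
        proof -
          have "avoid T v `` (M \<inter> {1..<Suc i}) \<subseteq>
              avoid T v `` (M \<inter> {1..<i}) \<union> (if i \<in> M then avoid T v `` {i} else {})"
            by (auto simp: less_Suc_eq)
          then show ?thesis using M'(2) by (cases "i \<in> M"; cases "i \<in> M'"; simp; blast)
        qed
        moreover have "?M \<subseteq> R" using M'(3) R by (auto split: if_splits)
        moreover have "snd s'' 2 = marks ?M" using 1 by simp
        ultimately show ?case unfolding Inv_def by (intro conjI exI[of _ ?M]) simp_all
      qed
      then show ?case by (intro runs_Seq runs_Assign) auto
    qed (use s M in \<open>auto simp: scan_row_def Inv_def R_def\<close>)
  qed (auto simp: Inv_def R_def atLeastLessThanSuc_atLeastAtMost)
qed

text \<open>
  A round either leaves the marked set closed under the edges or enlarges it, so after \<open>n\<close> rounds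
  it is closed.
\<close>

lemma runs_rounds:
  assumes s: "fst s 0 = n" "fst s 2 = v" "snd s 0 = adjacency n T" "snd s 2 = marks {u}"
    and u: "u \<in> {1..n}" and T: "simple_graph n T"
  shows "runs (For 4 spread_marks) s (for_time n (2 + for_time n (1 + for_time n 4)))
     (\<lambda>s'. snd s' 2 = marks ((avoid T v)\<^sup>* `` {u}) \<and> frame (For 4 spread_marks) s s')"
proof -
  define E where "E = avoid T v"
  define R where "R = E\<^sup>* `` {u}"
  have "E `` {1..n} \<subseteq> {1..n}"
    using T unfolding E_def avoid_def simple_graph_def by auto
  from rtrancl_Image_least[OF u this] have Rn: "R \<subseteq> {1..n}" unfolding R_def .
  define Inv where "Inv r s' \<longleftrightarrow> (\<exists>M. snd s' 2 = marks M \<and> u \<in> M \<and> M \<subseteq> R \<and>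
      (E `` M \<subseteq> M \<or> r \<le> card M))" for r and s' :: state
  have "runs (For 4 spread_marks) s (for_time n (2 + for_time n (1 + for_time n 4)))
     (\<lambda>s'. Inv (Suc n) s' \<and> frame (For 4 spread_marks) s s')"
  proof (rule runs_For[where Inv = Inv], goal_cases)
    case (7 r s')
    from 7(5) obtain M where M: "snd s' 2 = marks M" "u \<in> M" "M \<subseteq> R" "E `` M \<subseteq> M \<or> r \<le> card M"
      unfolding Inv_def by blast
    have f: "fst s' 0 = n" "fst s' 2 = v" "snd s' 0 = adjacency n T"
      using 7(3) s by (auto simp: frame_def spread_marks_def scan_row_def)
    have Mn: "M \<inter> {1..n} = M" using M(3) Rn by auto
    have "runs spread_marks s' (2 + for_time n (1 + for_time n 4))
     (\<lambda>s'. (\<exists>M'. snd s' 2 = marks M' \<and> M \<union> avoid T v `` (M \<inter> {1..n}) \<subseteq> M' \<and>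
        M' \<subseteq> (avoid T v)\<^sup>* `` {u}))"
      by (rule runs_spread_marks[OF f M(1) M(3)[unfolded R_def E_def] T])
    then show ?case
    proof (rule runs_mono[OF _ le_refl], goal_cases)
      case (1 s'')
      then obtain M' where M': "snd s'' 2 = marks M'" "M \<subseteq> M'" "E `` M \<subseteq> M'" "M' \<subseteq> R"
        unfolding Mn E_def R_def by blast
      have "E `` M' \<subseteq> M' \<or> Suc r \<le> card M'"
      proof (cases "E `` M \<subseteq> M")
        case True
        then have "R \<subseteq> M" unfolding R_def using M(2) by (intro rtrancl_Image_least)
        from subset_antisym[OF subset_trans[OF M'(4) this] M'(2)] have "M' = M" .
        then show ?thesis using True by simp
      next
        case False
        then have "M \<subset> M'" using M'(2,3) by blast
        moreover have "finite M'" using finite_subset[OF subset_trans[OF M'(4) Rn]] by simp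
        ultimately have "card M < card M'" by (rule psubset_card_mono[rotated])
        moreover have "r \<le> card M" using False M(4) by blast
        ultimately show ?thesis by linarith
      qed
      then show ?case unfolding Inv_def using M' M(2) by blast
    qed
  next
    case 5
    show ?case unfolding Inv_def using s(4) by (intro exI[of _ "{u}"]) (simp add: R_def)
  qed (use s in \<open>simp_all add: Inv_def spread_marks_def scan_row_def\<close>)
  then show ?thesis
  proof (rule runs_mono[OF _ le_refl], goal_cases)
    case (1 s')
    then obtain M where M: "snd s' 2 = marks M" "u \<in> M" "M \<subseteq> R" "E `` M \<subseteq> M \<or> Suc n \<le> card M"
      unfolding Inv_def by blast
    have "card M \<le> n" using card_mono[of "{1..n}" M] M(3) Rn by auto
    with M(4) have "E `` M \<subseteq> M" by linarith
    then have "R \<subseteq> M" unfolding R_def using M(2) by (intro rtrancl_Image_least)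
    then have "M = R" using M(3) by (rule subset_antisym[rotated])
    then show ?case using 1 M by (simp add: R_def E_def)
  qed
qed

lemma runs_add_marks:
  assumes s: "fst s 0 = n" "fst s 2 = v" "snd s 2 = marks M" "snd s 3 = f" and M: "M \<subseteq> {1..n}"
  shows "runs add_marks s (for_time n 1)
     (\<lambda>s'. snd s' 3 = f(v := f v + card M) \<and> frame add_marks s s')"
proof -
  have "runs add_marks s (for_time n 1)
     (\<lambda>s'. snd s' 3 = f(v := f v + card (M \<inter> {1..<Suc n})) \<and> frame add_marks s s')"
    unfolding add_marks_def
  proof (rule runs_For[where Inv = "\<lambda>i s'. snd s' 3 = f(v := f v + card (M \<inter> {1..<i}))"], goal_cases)
    case (7 i s')
    have g: "fst s' 0 = n" "fst s' 2 = v" "snd s' 2 = marks M"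
      using 7(3) s by (auto simp: frame_def)
    have "{1..<Suc i} = insert i {1..<i}" using 7(1) by auto
    then have "card (M \<inter> {1..<Suc i}) = card (M \<inter> {1..<i}) + marks M i"
      by (simp add: marks_def Int_insert_right)
    then show ?case using 7 g by (intro runs_Write) auto
  qed (use s in auto)
  moreover have "M \<inter> {1..<Suc n} = M" using M by auto
  ultimately show ?thesis by simp
qed

definition scores_time :: "nat \<Rightarrow> nat" where
  "scores_time n = for_time n (for_time n (for_time n 1 + (1 +
     (for_time n (2 + for_time n (1 + for_time n 4)) + for_time n 1))))"

text \<open>
  For each \<open>v\<close> and each start \<open>u\<close> the reachable vertices are marked and their number is added to the
  score of \<open>v\<close>.
\<close>

lemma runs_compute_scores:
  assumes s: "fst s 0 = n" "snd s 0 = adjacency n T" "snd s 2 = marks {}" "snd s 3 = (\<lambda>_. 0)"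
    and T: "simple_graph n T"
  shows "runs compute_scores s (scores_time n)
     (\<lambda>s'. (\<forall>v\<in>{1..n}. snd s' 3 v = score n T v) \<and> frame compute_scores s s')"
proof -
  define R where "R v u = (avoid T v)\<^sup>* `` {u}" for v u
  have Rn: "R v u \<subseteq> {1..n}" if "u \<in> {1..n}" for v u
  proof -
    have "avoid T v `` {1..n} \<subseteq> {1..n}"
      using T unfolding avoid_def simple_graph_def by auto
    from rtrancl_Image_least[OF that this] show ?thesis unfolding R_def .
  qed
  define g where "g v = (\<lambda>x. if 1 \<le> x \<and> x < v then score n T x else 0)" for v :: nat
  define Inv where "Inv v s' \<longleftrightarrow> (\<exists>M\<subseteq>{1..n}. snd s' 2 = marks M) \<and> snd s' 3 = g v"
    for v and s' :: state
  let ?body = "Seq clear_marks (Seq (Write 2 (Var 3) (Const 1)) (Seq (For 4 spread_marks) add_marks))"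
  let ?B = "for_time n 1 + (1 + (for_time n (2 + for_time n (1 + for_time n 4)) + for_time n 1))"
  have [simp]: "assigned clear_marks = {5}" "assigned spread_marks = {5, 6, 7}" "assigned add_marks = {5}"
    "written clear_marks = {2}" "written spread_marks = {2}" "written add_marks = {3}"
    by (auto simp: clear_marks_def spread_marks_def scan_row_def add_marks_def)
  have "runs compute_scores s (scores_time n) (\<lambda>s'. Inv (Suc n) s' \<and> frame compute_scores s s')"
    unfolding compute_scores_def scores_time_def
  proof (rule runs_For[where Inv = Inv], goal_cases)
    case (7 v s')
    have f: "fst s' 0 = n" "fst s' 2 = v" "snd s' 0 = adjacency n T"
      using 7(3,4) s by (auto simp: frame_def)
    define J where "J u s'' \<longleftrightarrow> (\<exists>M\<subseteq>{1..n}. snd s'' 2 = marks M) \<and>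
        snd s'' 3 = (g v)(v := (\<Sum>u'\<in>{1..<u}. card (R v u')))" for u and s'' :: state
    have "runs (For 3 ?body) s' (for_time n ?B) (\<lambda>s''. J (Suc n) s'' \<and> frame (For 3 ?body) s' s'')"
    proof (rule runs_For[where Inv = J], goal_cases)
      case (7 u s2)
      have f2: "fst s2 0 = n" "fst s2 2 = v" "fst s2 3 = u" "snd s2 0 = adjacency n T"
        using 7(3,4) f by (auto simp: frame_def)
      from 7(5) obtain M where M: "M \<subseteq> {1..n}" "snd s2 2 = marks M"
        and s3: "snd s2 3 = (g v)(v := (\<Sum>u'\<in>{1..<u}. card (R v u')))" unfolding J_def by blast
      have u: "u \<in> {1..n}" using 7 by simp
      show ?case
      proof (intro runs_Seq, rule runs_mono[OF runs_clear_marks[OF f2(1) M(2,1)] le_refl], goal_cases)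
        case (1 s4)
        have f4: "fst s4 0 = n" "fst s4 2 = v" "fst s4 3 = u" "snd s4 0 = adjacency n T"
            "snd s4 3 = snd s2 3"
          using 1 f2 by (auto simp: frame_def)
        show ?case
        proof (rule runs_Seq, rule runs_Write, goal_cases)
          case upd: 1
          show ?case
          proof (rule runs_Seq, rule runs_mono[OF runs_rounds[where n = n and v = v and T = T and u = u] le_refl], goal_cases)
            case (7 s5)
            have f5: "fst s5 0 = n" "fst s5 2 = v" "fst s5 3 = u" "snd s5 0 = adjacency n T"
              "snd s5 3 = snd s2 3" "snd s5 2 = marks (R v u)"
              using 7 f4 by (auto simp: frame_def R_def)
            show ?case
            proof (rule runs_mono[OF runs_add_marks[OF f5(1,2,6,5) Rn[OF u]] le_refl], goal_cases)
              case (1 s6)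
              have "snd s6 2 = marks (R v u)" using 1 f5 by (auto simp: frame_def)
              moreover have "{1..<Suc u} = insert u {1..<u}" using u by auto
              then have "(\<Sum>u'\<in>{1..<Suc u}. card (R v u')) =
                  (\<Sum>u'\<in>{1..<u}. card (R v u')) + card (R v u)" by simp
              then have "snd s6 3 = (g v)(v := \<Sum>u'\<in>{1..<Suc u}. card (R v u'))"
                using 1 s3 by simp
              ultimately show ?case using Rn[OF u] unfolding J_def by blast
            qed
          qed (use f4 1 u T in \<open>simp_all add: marks_insert\<close>)
        qed simp
      qed
    next
      case 5
      have "g v = (g v)(v := 0)" by (auto simp: g_def)
      then show ?case using \<open>Inv v s'\<close> by (auto simp: J_def Inv_def)
    qed (use f in \<open>auto simp: J_def\<close>)
    then show ?case
    proof (rule runs_mono[OF _ le_refl], goal_cases)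
      case (1 s'')
      have "(g v)(v := score n T v) = g (Suc v)" using \<open>1 \<le> v\<close> by (auto simp: g_def less_Suc_eq)
      moreover have "(\<Sum>u'\<in>{1..<Suc n}. card (R v u')) = score n T v"
        unfolding score_def R_def atLeastLessThanSuc_atLeastAtMost ..
      ultimately show ?case using 1 unfolding J_def Inv_def by simp
    qed
  next
    case 5
    have "g 1 = (\<lambda>_. 0)" by (auto simp: g_def)
    with s show ?case by (auto simp: Inv_def)
  qed (use s in \<open>auto simp: Inv_def\<close>)
  then show ?thesis
    by (rule runs_mono) (simp_all add: Inv_def g_def)
qed

lemma runs_compute_rank:
  assumes s: "fst s 0 = n" "fst s 2 = v" "fst s 8 = 0" "\<forall>v\<in>{1..n}. snd s 3 v = f v"
    and v: "v \<in> {1..n}"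
  shows "runs compute_rank s (for_time n 4)
     (\<lambda>s'. fst s' 8 = card {u \<in> {1..n}. beats f u v} \<and> frame compute_rank s s')"
proof -
  have "runs compute_rank s (for_time n 4)
     (\<lambda>s'. fst s' 8 = card {u \<in> {1..<Suc n}. beats f u v} \<and> frame compute_rank s s')"
    unfolding compute_rank_def
  proof (rule runs_For[where Inv = "\<lambda>u s'. fst s' 8 = card {u' \<in> {1..<u}. beats f u' v}"], goal_cases)
    case (7 u s')
    have g: "fst s' 0 = n" "fst s' 2 = v" "snd s' 3 = snd s 3"
      using 7(3) s by (auto simp: frame_def)
    have 4: "(4::nat) = Suc (Suc (Suc 1))" by simp
    have "{u' \<in> {1..<Suc u}. beats f u' v} =
        (if beats f u v then insert u {u' \<in> {1..<u}. beats f u' v} else {u' \<in> {1..<u}. beats f u' v})"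
      using 7(1) by (auto simp: less_Suc_eq)
    then have "card {u' \<in> {1..<Suc u}. beats f u' v} =
        card {u' \<in> {1..<u}. beats f u' v} + (if beats f u v then 1 else 0)"
      by simp
    moreover have b: "beats f u v \<longleftrightarrow> f u < f v \<or> f u = f v \<and> u < v" by (rule beats_def)
    moreover have fu: "snd s' 3 u = f u" "snd s' 3 v = f v" using 7 g s(4) v by auto
    ultimately show ?case unfolding 4
      by (intro runs_IfLess runs_Skip runs_Assign) (simp_all add: 7 g)
  qed (use s in auto)
  then show ?thesis by (simp add: atLeastLessThanSuc_atLeastAtMost)
qed

lemma runs_select_lowest:
  assumes s: "fst s 0 = n" "fst s 1 = K" "\<forall>v\<in>{1..n}. snd s 3 v = score n T v" "snd s 1 = marks {}"
  shows "runs select_lowest s (for_time n (1 + (for_time n 4 + 2)))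
     (\<lambda>s'. snd s' 1 = marks (lowest K n T))"
proof -
  define Inv where "Inv v s' \<longleftrightarrow> snd s' 1 = marks (lowest K n T \<inter> {1..<v})" for v and s' :: state
  let ?body = "Seq (Assign 8 (Const 0)) (Seq compute_rank
     (IfLess (Var 8) (Var 1) (Write 1 (Var 2) (Const 1)) Skip))"
  have [simp]: "assigned compute_rank = {3, 8}" "written compute_rank = {}"
    by (auto simp: compute_rank_def)
  have main: "runs select_lowest s (for_time n (1 + (for_time n 4 + 2)))
      (\<lambda>s'. Inv (Suc n) s' \<and> frame (For 2 ?body) s s')"
    unfolding select_lowest_def
  proof (rule runs_For[where Inv = Inv], goal_cases)
    case (7 v s')
    have f: "fst s' 0 = n" "fst s' 1 = K" "fst s' 2 = v" "snd s' 3 = snd s 3"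
      using 7(3,4) s by (auto simp: frame_def)
    have v: "v \<in> {1..n}" using 7 by simp
    show ?case
    proof (intro runs_Seq, rule runs_Assign, goal_cases)
      case 1
      show ?case
      proof (rule runs_Seq, rule runs_mono[OF runs_compute_rank[where n = n and v = v and f = "score n T"] le_refl], goal_cases)
        case (6 s2)
        have f2: "fst s2 1 = K" "fst s2 2 = v" "snd s2 1 = snd s' 1"
            "fst s2 8 = card {u \<in> {1..n}. beats (score n T) u v}"
          using 6 f by (auto simp: frame_def)
        have 2: "(2::nat) = Suc 1" by simp
        have lt: "fst s2 8 < K \<longleftrightarrow> v \<in> lowest K n T" using f2 v by (simp add: lowest_def)
        have "lowest K n T \<inter> {1..<Suc v} =
          (if v \<in> lowest K n T then insert v (lowest K n T \<inter> {1..<v}) else lowest K n T \<inter> {1..<v})"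
          using v by (auto simp: less_Suc_eq)
        then show ?case using f2 lt \<open>Inv v s'\<close> unfolding 2
          by (intro runs_IfLess runs_Write runs_Skip) (auto simp: Inv_def marks_insert)
      qed (use f s v in auto)
    qed simp
  qed (use s in \<open>auto simp: Inv_def\<close>)
  have "lowest K n T \<inter> {1..<Suc n} = lowest K n T"
    by (auto simp: lowest_def)
  then show ?thesis
    by (intro runs_mono[OF main]) (simp_all add: Inv_def)
qed

theorem root_finder_poly_time: "computes_in_poly_time root_finder lowest"
proof -
  let ?n = "[:0, 1:] :: nat poly"
  let ?F = "\<lambda>B. 2 + ?n * (B + 2)"
  let ?p = "?F (?F (?F 1 + (1 + (?F (2 + ?F (1 + ?F 4)) + ?F 1)))) + ?F (1 + (?F 4 + 2))"
  have p: "poly ?p n = scores_time n + for_time n (1 + (for_time n 4 + 2))" for n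
    by (simp add: scores_time_def for_time_def algebra_simps)
  have "\<exists>t s. exec root_finder (input_state n K T) t s \<and> t \<le> poly ?p n \<and> output_set n s = lowest K n T"
    if T: "labeled_tree n T" for n K T
  proof -
    let ?s = "input_state n K T"
    have sT: "simple_graph n T" using T by (simp add: labeled_tree_def)
    have s: "fst ?s 0 = n" "fst ?s 1 = K" "snd ?s 0 = adjacency n T" "snd ?s 1 = marks {}"
       "snd ?s 2 = marks {}" "snd ?s 3 = (\<lambda>_. 0)"
      by (auto simp: input_state_def adjacency_def marks_def)
    have "runs root_finder ?s (poly ?p n) (\<lambda>s'. snd s' 1 = marks (lowest K n T))"
      unfolding root_finder_def p
    proof (intro runs_Seq, rule runs_mono[OF runs_compute_scores[OF s(1,3,5,6) sT] le_refl], goal_cases)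
      case (1 s')
      show ?case
        by (rule runs_select_lowest)
          (use 1 s in \<open>auto simp: frame_def compute_scores_def clear_marks_def spread_marks_def
             scan_row_def add_marks_def\<close>)
    qed
    then obtain t s' where "exec root_finder ?s t s'" "t \<le> poly ?p n" "snd s' 1 = marks (lowest K n T)"
      unfolding runs_def by blast
    moreover from this have "output_set n s' = lowest K n T"
      unfolding output_set_def by (auto simp: marks_def lowest_def)
    ultimately show ?thesis by blast
  qed
  then show ?thesis unfolding computes_in_poly_time_def by blast
qed

theorem theorem2:
  shows "\<exists>c c' :: real. c > 0 \<and> c' > 0 \<and>
    (\<forall>(\<epsilon>::real) (K::nat). 0 < \<epsilon> \<and> \<epsilon> < 1 \<and> 0 < K \<and>
        (\<exists>H. root_finding_procedure H K \<epsilon>) \<longrightarrow> real K \<ge> c / \<epsilon>) \<and>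
    (\<exists>(P::prog) F. computes_in_poly_time P F \<and>
       (\<exists>K :: real \<Rightarrow> nat. \<forall>\<epsilon>::real. 0 < \<epsilon> \<and> \<epsilon> < 1 \<longrightarrow>
          root_finding_procedure (F (K \<epsilon>)) (K \<epsilon>) \<epsilon> \<and>
          real (K \<epsilon>) \<le> max 1 (c' * (ln (1 / \<epsilon>))\<^sup>2 / \<epsilon> ^ 4)))"
proof -
  obtain c' :: real and K :: "real \<Rightarrow> nat" where c': "0 < c'" and
    K: "\<forall>\<epsilon>::real. 0 < \<epsilon> \<and> \<epsilon> < 1 \<longrightarrow> root_finding_procedure (lowest (K \<epsilon>)) (K \<epsilon>) \<epsilon> \<and>
      real (K \<epsilon>) \<le> max 1 (c' * (ln (1 / \<epsilon>))\<^sup>2 / \<epsilon> ^ 4)"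
    using lowest_root_finding by blast
  show ?thesis
  proof (intro exI conjI allI impI)
    show "0 < (1 / 1024 :: real)" by simp
    show "0 < c'" by (rule c')
    show "1 / 1024 / \<epsilon> \<le> real K"
      if "0 < \<epsilon> \<and> \<epsilon> < 1 \<and> 0 < K \<and> (\<exists>H. root_finding_procedure H K \<epsilon>)" for \<epsilon> :: real and K
      using that root_finding_lower_bound by blast
    show "computes_in_poly_time root_finder lowest" by (rule root_finder_poly_time)
    show "root_finding_procedure (lowest (K \<epsilon>)) (K \<epsilon>) \<epsilon>"
      and "real (K \<epsilon>) \<le> max 1 (c' * (ln (1 / \<epsilon>))\<^sup>2 / \<epsilon> ^ 4)" if "0 < \<epsilon> \<and> \<epsilon> < 1" for \<epsilon>
      using K that by blast+
  qed
qed

end
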